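(* Let $n\ge 1$, let $\mathbb{V}=\mathbb{C}^{n+1}$ with a Hermitian form $\langle\cdot,\cdot\rangle$ of signature $(n,1)$, and let $U(n,1)$ be its unitary group, acting on complex hyperbolic space $H^n_{\mathbb{C}}$. (1) Let $T\in U(n,1)$ act as an elliptic isometry of $H^n_{\mathbb{C}}$. Then an element $S\in U(n,1)$ commutes with $T$ if and only if $S$ preserves each eigenspace of $T$. (2) Let $T\in U(n,1)$ act as a hyperbolic isometry of $H^n_{\mathbb{C}}$. Then an element $S\in U(n,1)$ commutes with $T$ if and only if $S$ preserves each eigenspace of $T$ and $S$ acts either as the identity or as a strictly hyperbolic isometry on the complex line joining the two fixed points of $T$. (3) Let $T\in U(n,1)$ be a translation with fixed point $x\in\partial H^n_{\mathbb{C}}$, and let $S\in U(n,1)$ commute with $T$. Then one of the following holds: (i) $S$ is a boundary elliptic with $S(x)=x$ and $T(\mathrm{fix}(S))=\mathrm{fix}(S)$; (ii) $S$ is a translation with $S(x)=x$, and $S$ and $T$ are isotropic; (iii) $S$ is an ellipto-parabolic with fixed point $x$, and its Jordan decomposition $S=S_sS_u$ satisfies $T(\mathrm{fix}(S_s))=\mathrm{fix}(S_s)$ and $T$ and $S_u$ are isotropic. (4) Let $T=T_sT_u\in U(n,1)$ be an ellipto-parabolic with fixed point $x\in\partial H^n_{\mathbb{C}}$ (Jordan decomposition $T=T_sT_u$), and let $S\in U(n,1)$ commute with $T$. Then one of the following holds: (i) $S$ is a boundary elliptic with $S(x)=x$, $T_u(\mathrm{fix}(S))=\mathrm{fix}(S)$,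 and $T_s$ preserves each eigenspace of $S$; (ii) $S$ is a translation with $S(x)=x$, $S(\mathrm{fix}(T_s))=\mathrm{fix}(T_s)$, and $S$ and $T_u$ are isotropic; (iii) $S$ is an ellipto-parabolic with fixed point $x$, and its Jordan decomposition $S=S_sS_u$ satisfies $T_u(\mathrm{fix}(S_s))=\mathrm{fix}(S_s)$, $S_u(\mathrm{fix}(T_s))=\mathrm{fix}(T_s)$, $T_u$ and $S_u$ are isotropic, and $T_s$ preserves each eigenspace of $S_s$.
   Context: Let $\mathbb{V}_-=\{z:\langle z,z\rangle<0\}$, $\mathbb{V}_0=\{z\ne0:\langle z,z\rangle=0\}$, and $\pi:\mathbb{V}\setminus\{0\}\to P(\mathbb{V})$ the projectivization. Complex hyperbolic space is $H^n_{\mathbb{C}}=\pi(\mathbb{V}_-)$, with boundary $\partial H^n_{\mathbb{C}}=\pi(\mathbb{V}_0)$; $U(n,1)$ acts on $\overline{H^n_{\mathbb{C}}}=H^n_{\mathbb{C}}\cup\partial H^n_{\mathbb{C}}$ by isometries (via $PU(n,1)$). For $g\in U(n,1)$, $\mathrm{fix}(g)$ is the set of points of $\overline{H^n_{\mathbb{C}}}$ fixed by $g$ (these correspond to eigenvectors of $g$ in $\mathbb{V}_-\cup\mathbb{V}_0$). An element is elliptic if it fixes a point of $H^n_{\mathbb{C}}$; parabolic, resp. hyperbolic, if it is not elliptic and has exactly one, resp. exactly two, fixed points on $\partial H^n_{\mathbb{C}}$. An eigenvalue of $g$ is negative if it has an eigenvector in $\mathbb{V}_-$; an elliptic $g$ is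 a boundary elliptic if its negative eigenvalue has multiplicity at least $2$. A hyperbolic element is strictly hyperbolic if all its eigenvalues are real. For hyperbolic $T$, the complex line joining its fixed points is the projective image (intersected with $\overline{H^n_{\mathbb{C}}}$) of the 2-dimensional subspace spanned by its two null eigenvectors; it is a copy of $H^1_{\mathbb{C}}$. A parabolic element is a translation if it is unipotent (all eigenvalues $1$), and an ellipto-parabolic otherwise; a parabolic $g$ has a Jordan decomposition $g=g_sg_u=g_ug_s$ with $g_s\in U(n,1)$ semisimple and $g_u\in U(n,1)$ unipotent. Heisenberg translations: in the Siegel model (Hermitian form $\langle z,w\rangle=w^*Jz$ with $J=\begin{pmatrix}0&0&1\\0&I_{n-1}&0\\1&0&0\end{pmatrix}$, point $\infty=\pi((1,0,\dots,0)^t)$), for $(\tau,t)\in\mathbb{C}^{n-1}\times\mathbb{R}$ let $T_{(\tau,t)}=\begin{pmatrix}1&-\tau^*&\frac{-|\tau|^2+ti}{2}\\0&I_{n-1}&\tau\\0&0&1\end{pmatrix}$. Two unipotent parabolic elements $S,T$ with a common fixed point $x\in\partial H^n_{\mathbb{C}}$ are called isotropic if, for $K\in U(n,1)$ with $K(x)=\infty$ (conjugating both into Siegel form), $KTK^{-1}=T_{(\tau,t)}$ and $KSK^{-1}=T_{(\sigma,s)}$ with $\mathrm{Im}(\tau^*\sigma)=0$ (this is independent of the choice of $K$). *)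

theory Defs
  imports "Jordan_Normal_Form.Jordan_Normal_Form" "Jordan_Normal_Form.Schur_Decomposition"
begin

text \<open>Vectors of V = C^(n+1) are complex vecs of dimension dim_row H, where H is the
  Gram matrix of the Hermitian form: form H z w = w^* H z.\<close>

definition hform :: "complex mat \<Rightarrow> complex vec \<Rightarrow> complex vec \<Rightarrow> complex" where
  "hform H z w = (\<Sum>i<dim_row H. \<Sum>j<dim_row H. cnj (w $ i) * H $$ (i, j) * z $ j)"

definition std_diag :: "nat \<Rightarrow> complex mat" where
  "std_diag n = mat (n+1) (n+1) (\<lambda>(i,j). if i = j then (if i = n then -1 else 1) else 0)"

definition hermitian_sig :: "complex mat \<Rightarrow> nat \<Rightarrow> bool" where
  "hermitian_sig H n \<longleftrightarrow> H \<in> carrier_mat (n+1) (n+1) \<and> mat_adjoint H = H \<and>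
     (\<exists>P \<in> carrier_mat (n+1) (n+1). invertible_mat P \<and> mat_adjoint P * H * P = std_diag n)"

definition unitary_grp :: "complex mat \<Rightarrow> complex mat set" where
  "unitary_grp H = {g \<in> carrier_mat (dim_row H) (dim_row H). mat_adjoint g * H * g = H}"

definition neg_vecs :: "complex mat \<Rightarrow> complex vec set" where
  "neg_vecs H = {z \<in> carrier_vec (dim_row H). Re (hform H z z) < 0}"

definition null_vecs :: "complex mat \<Rightarrow> complex vec set" where
  "null_vecs H = {z \<in> carrier_vec (dim_row H). z \<noteq> 0\<^sub>v (dim_row H) \<and> hform H z z = 0}"

definition proj_pt :: "complex vec \<Rightarrow> complex vec set" where
  "proj_pt v = {c \<cdot>\<^sub>v v | c. True}"

definition hyp_space :: "complex mat \<Rightarrow> complex vec set set" where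
  "hyp_space H = proj_pt ` neg_vecs H"

definition bdry :: "complex mat \<Rightarrow> complex vec set set" where
  "bdry H = proj_pt ` null_vecs H"

definition cl_space :: "complex mat \<Rightarrow> complex vec set set" where
  "cl_space H = hyp_space H \<union> bdry H"

definition act :: "complex mat \<Rightarrow> complex vec set \<Rightarrow> complex vec set" where
  "act g p = (\<lambda>v. g *\<^sub>v v) ` p"

definition fix_pts :: "complex mat \<Rightarrow> complex mat \<Rightarrow> complex vec set set" where
  "fix_pts H g = {p \<in> cl_space H. act g p = p}"

definition bdry_fix :: "complex mat \<Rightarrow> complex mat \<Rightarrow> complex vec set set" where
  "bdry_fix H g = {p \<in> bdry H. act g p = p}"

definition elliptic :: "complex mat \<Rightarrow> complex mat \<Rightarrow> bool" where
  "elliptic H g \<longleftrightarrow> g \<in> unitary_grp H \<and> (\<exists>p \<in> hyp_space H. act g p = p)"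

definition parabolic :: "complex mat \<Rightarrow> complex mat \<Rightarrow> bool" where
  "parabolic H g \<longleftrightarrow> g \<in> unitary_grp H \<and> \<not> elliptic H g \<and> card (bdry_fix H g) = 1"

definition hyperbolic :: "complex mat \<Rightarrow> complex mat \<Rightarrow> bool" where
  "hyperbolic H g \<longleftrightarrow> g \<in> unitary_grp H \<and> \<not> elliptic H g \<and> card (bdry_fix H g) = 2"

definition eigenspace :: "complex mat \<Rightarrow> complex \<Rightarrow> complex vec set" where
  "eigenspace g l = {v \<in> carrier_vec (dim_row g). g *\<^sub>v v = l \<cdot>\<^sub>v v}"

definition preserves :: "complex mat \<Rightarrow> complex vec set \<Rightarrow> bool" where
  "preserves g E \<longleftrightarrow> act g E = E"

definition negative_eigenvalue :: "complex mat \<Rightarrow> complex mat \<Rightarrow> complex \<Rightarrow> bool" where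
  "negative_eigenvalue H g l \<longleftrightarrow> (\<exists>v \<in> neg_vecs H. g *\<^sub>v v = l \<cdot>\<^sub>v v)"

definition boundary_elliptic :: "complex mat \<Rightarrow> complex mat \<Rightarrow> bool" where
  "boundary_elliptic H g \<longleftrightarrow> elliptic H g \<and>
     (\<exists>l. negative_eigenvalue H g l \<and> Polynomial.order l (char_poly g) \<ge> 2)"

definition strictly_hyperbolic :: "complex mat \<Rightarrow> complex mat \<Rightarrow> bool" where
  "strictly_hyperbolic H g \<longleftrightarrow> hyperbolic H g \<and> (\<forall>l. eigenvalue g l \<longrightarrow> l \<in> \<real>)"

definition unipotent :: "complex mat \<Rightarrow> bool" where
  "unipotent g \<longleftrightarrow> (\<forall>l. eigenvalue g l \<longrightarrow> l = 1)"

definition semisimple :: "complex mat \<Rightarrow> bool" where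
  "semisimple g \<longleftrightarrow> (\<exists>D. diagonal_mat D \<and> similar_mat g D)"

definition translation :: "complex mat \<Rightarrow> complex mat \<Rightarrow> bool" where
  "translation H g \<longleftrightarrow> parabolic H g \<and> unipotent g"

definition ellipto_parabolic :: "complex mat \<Rightarrow> complex mat \<Rightarrow> bool" where
  "ellipto_parabolic H g \<longleftrightarrow> parabolic H g \<and> \<not> unipotent g"

definition jordan_decomp :: "complex mat \<Rightarrow> complex mat \<Rightarrow> complex mat \<Rightarrow> complex mat \<Rightarrow> bool" where
  "jordan_decomp H g gs gu \<longleftrightarrow> gs \<in> unitary_grp H \<and> gu \<in> unitary_grp H \<and>
     semisimple gs \<and> unipotent gu \<and> g = gs * gu \<and> gs * gu = gu * gs"

definition cline_sub :: "complex mat \<Rightarrow> complex mat \<Rightarrow> complex vec set" where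
  "cline_sub H T = {u + w | u w p q. p \<in> bdry_fix H T \<and> q \<in> bdry_fix H T \<and> u \<in> p \<and> w \<in> q}"

definition cline_pts :: "complex mat \<Rightarrow> complex mat \<Rightarrow> complex vec set set" where
  "cline_pts H T = {p \<in> cl_space H. p \<subseteq> cline_sub H T}"

definition acts_identity_on :: "complex mat \<Rightarrow> complex vec set set \<Rightarrow> bool" where
  "acts_identity_on S L \<longleftrightarrow> (\<forall>p \<in> L. act S p = p)"

text \<open>S acts on the complex line L (a copy of H^1_C, points L, subspace W) as a strictly
  hyperbolic isometry: it preserves L, fixes no point of L inside H^n_C, fixes exactly two
  boundary points of L, and some lift (unit scalar multiple, which induces the same isometry)
  of its restriction to W has only real eigenvalues.\<close>
definition acts_strictly_hyperbolic_on ::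
  "complex mat \<Rightarrow> complex mat \<Rightarrow> complex vec set \<Rightarrow> complex vec set set \<Rightarrow> bool" where
  "acts_strictly_hyperbolic_on H S W L \<longleftrightarrow>
     act S ` L = L \<and>
     (\<forall>p \<in> L \<inter> hyp_space H. act S p \<noteq> p) \<and>
     card {p \<in> L \<inter> bdry H. act S p = p} = 2 \<and>
     (\<exists>\<mu>. cmod \<mu> = 1 \<and> (\<forall>l w. w \<in> W \<and> w \<noteq> 0\<^sub>v (dim_row S) \<and> S *\<^sub>v w = l \<cdot>\<^sub>v w \<longrightarrow> \<mu> * l \<in> \<real>))"

definition siegel_J :: "nat \<Rightarrow> complex mat" where
  "siegel_J n = mat (n+1) (n+1)
     (\<lambda>(i,j). if (i = 0 \<and> j = n) \<or> (i = n \<and> j = 0) \<or> (i = j \<and> 0 < i \<and> i < n) then 1 else 0)"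

definition inf_pt :: "nat \<Rightarrow> complex vec set" where
  "inf_pt n = proj_pt (unit_vec (n+1) 0)"

text \<open>T_(tau,t), tau in C^(n-1) indexed 0..n-2 (row/column j of the matrix, 1<=j<=n-1,
  corresponds to tau $ (j-1))\<close>
definition heis :: "nat \<Rightarrow> complex vec \<Rightarrow> real \<Rightarrow> complex mat" where
  "heis n \<tau> t = mat (n+1) (n+1) (\<lambda>(i,j).
     if i = j then 1
     else if i = 0 \<and> 0 < j \<and> j < n then - cnj (\<tau> $ (j - 1))
     else if i = 0 \<and> j = n then
        (- of_real (\<Sum>k<n-1. (cmod (\<tau> $ k))\<^sup>2) + of_real t * \<i>) / 2
     else if 0 < i \<and> i < n \<and> j = n then \<tau> $ (i - 1)
     else 0)"

definition isotropic :: "complex mat \<Rightarrow> nat \<Rightarrow> complex vec set \<Rightarrow> complex mat \<Rightarrow> complex mat \<Rightarrow> bool" where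
  "isotropic H n x S T \<longleftrightarrow>
     (\<exists>K \<in> carrier_mat (n+1) (n+1). invertible_mat K \<and> mat_adjoint K * siegel_J n * K = H \<and>
        act K x = inf_pt n \<and>
        (\<exists>\<tau> t \<sigma> s. \<tau> \<in> carrier_vec (n-1) \<and> \<sigma> \<in> carrier_vec (n-1) \<and>
           K * T = heis n \<tau> t * K \<and> K * S = heis n \<sigma> s * K \<and>
           Im (\<Sum>k<n-1. cnj (\<tau> $ k) * \<sigma> $ k) = 0))"

end

theory Submission
  imports Defs "Jordan_Normal_Form.Jordan_Normal_Form_Existence"
begin

text \<open>Every \<open>g\<close> in the unitary group is \<open>g = a b\<close> with commuting semisimple \<open>a\<close> and unipotent \<open>b\<close>.
  The eigenspaces of \<open>a\<close> are the generalised eigenspaces of \<open>g\<close>; hence whatever commutes with \<open>g\<close>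
  commutes with \<open>a\<close> and \<open>b\<close>, and since generalised eigenspaces for \<open>l\<close> and \<open>m\<close> are orthogonal unless
  \<open>l * cnj m = 1\<close>, both factors preserve the form.

  The only consequence of the signature that is needed repeatedly is that two orthogonal vectors of nonpositive
  norm are linearly dependent. If a unipotent \<open>b\<close> fixes a negative vector, every vector \<open>b y - y\<close>
  that is fixed by \<open>b\<close> is null and orthogonal to it, so \<open>b = 1\<close>: elliptic and hyperbolic
  isometries are semisimple, and (1) and (2) reduce to eigenspaces. If \<open>b\<close> fixes a null vector
  \<open>x\<close>, the same computation gives \<open>b y - y\<close> in the span of \<open>x\<close> for \<open>y\<close> orthogonal
  to \<open>x\<close>, which in a Siegel frame says that \<open>b\<close> is a Heisenberg translation; commuting Heisenberg
  translations are isotropic. Finally, an isometry commuting with a parabolic one fixes its fixed point and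
  cannot be hyperbolic.\<close>

text \<open>Statement (4) starts from an arbitrary \<open>jordan_decomp H T Ts Tu\<close>, so the
  properties of the factors have to hold for every commuting pair of a semisimple and a unipotent
  matrix; the Jordan normal form serves only to show that such a pair exists. Describing the
  eigenspaces of \<open>a\<close> through \<open>g\<close> alone plays the role of the usual remark
  that \<open>a\<close> is a polynomial in \<open>g\<close>.

  Passing from fixed vectors \<open>b y - y\<close> to arbitrary \<open>y\<close> is an induction on
  the height of \<open>y\<close> in \<open>gev\<close>: \<open>b y - y\<close> has smaller height,
  so the induction hypothesis already says how \<open>b\<close> acts on it, and invariance of the
  form then computes its norm.

  \<open>isotropic\<close> demands a frame that carries the given \<open>x\<close> to
  \<open>inf_pt n\<close>, whereas \<open>hermitian_sig\<close> supplies merely some diagonalising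
  frame; a reflection exchanging two null lines closes this gap. In a Siegel frame the
  noncommutativity of Heisenberg translations is concentrated in the corner entry
  \<open>(0, n)\<close>, which is where the condition on the imaginary part is read off.\<close>

declare index_mult_mat_vec [simp del]

section \<open>Adjoints, matrix entries and values of the form\<close>

lemma mat_adjoint_dim [simp]:
  "dim_row (mat_adjoint A) = dim_col A" "dim_col (mat_adjoint A) = dim_row A"
  unfolding mat_adjoint_def by auto

lemma mat_adjoint_carrier [simp]:
  "A \<in> carrier_mat nr nc \<Longrightarrow> mat_adjoint A \<in> carrier_mat nc nr"
  by (intro carrier_matI) auto

lemma mat_adjoint_index [simp]:
  "i < dim_col A \<Longrightarrow> j < dim_row A \<Longrightarrow> mat_adjoint A $$ (i, j) = conjugate (A $$ (j, i))"
  unfolding mat_adjoint_def by (simp add: mat_of_rows_index)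

lemma mult_mat_vec_index:
  assumes "A \<in> carrier_mat nr nc" "v \<in> carrier_vec nc" "i < nr"
  shows "(A *\<^sub>v v) $ i = (\<Sum>j<nc. A $$ (i, j) * v $ j)"
  using assms by (auto simp: mult_mat_vec_def scalar_prod_def atLeast0LessThan)

lemma mult_mat_index:
  assumes "A \<in> carrier_mat nr n" "B \<in> carrier_mat n nc" "i < nr" "j < nc"
  shows "(A * B) $$ (i, j) = (\<Sum>k<n. A $$ (i, k) * B $$ (k, j))"
  using assms by (simp add: scalar_prod_def atLeast0LessThan)

lemma mult_mat_unit_vec:
  fixes A :: "'a :: semiring_1 mat"
  assumes "A \<in> carrier_mat nr nc" "j < nc"
  shows "A *\<^sub>v unit_vec nc j = col A j"
proof (rule eq_vecI)
  fix i assume "i < dim_vec (col A j)"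
  then have i: "i < nr" using assms by simp
  have "(A *\<^sub>v unit_vec nc j) $ i = (\<Sum>k<nc. A $$ (i, k) * unit_vec nc j $ k)"
    by (rule mult_mat_vec_index) (use assms i in auto)
  also have "\<dots> = (\<Sum>k<nc. if k = j then A $$ (i, j) else 0)"
    using assms by (intro sum.cong) auto
  finally show "(A *\<^sub>v unit_vec nc j) $ i = col A j $ i" using assms i by simp
qed (use assms in auto)

lemma mult_mat_zero_vec [simp]:
  "A \<in> carrier_mat nr nc \<Longrightarrow> A *\<^sub>v 0\<^sub>v nc = 0\<^sub>v nr"
  by (auto simp: index_mult_mat_vec intro!: eq_vecI)

lemma hform_alt:
  assumes "M \<in> carrier_mat m m" "z \<in> carrier_vec m" "w \<in> carrier_vec m"
  shows "hform M z w = (\<Sum>i<m. cnj (w $ i) * (M *\<^sub>v z) $ i)"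
  unfolding hform_def using assms
  by (auto simp: mult_mat_vec_index sum_distrib_left mult.assoc intro!: sum.cong)

text \<open>\<open>mat_adjoint A * M * A\<close> is the Gram matrix of the form pulled back along
  \<open>A\<close>. This turns the matrix equations in \<open>hermitian_sig\<close>,
  \<open>unitary_grp\<close> and \<open>isotropic\<close> into statements about values of
  \<open>hform\<close>.\<close>

lemma hform_adjoint_mult:
  assumes M: "M \<in> carrier_mat m m" and A: "A \<in> carrier_mat m k"
    and z: "z \<in> carrier_vec k" and w: "w \<in> carrier_vec k"
  shows "hform (mat_adjoint A * M * A) z w = hform M (A *\<^sub>v z) (A *\<^sub>v w)"
proof -
  let ?y = "M *\<^sub>v (A *\<^sub>v z)"
  have y: "?y \<in> carrier_vec m" using assms by auto
  have eq: "(mat_adjoint A * M * A) *\<^sub>v z = mat_adjoint A *\<^sub>v ?y"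
  proof -
    have "mat_adjoint A * M * A = mat_adjoint A * (M * A)"
      by (rule assoc_mult_mat[of _ k m _ m]) (use assms in auto)
    then show ?thesis using assms
      by (simp add: assoc_mult_mat_vec[of _ k m _ k] assoc_mult_mat_vec[of _ m m _ k])
  qed
  have "hform (mat_adjoint A * M * A) z w = (\<Sum>i<k. cnj (w $ i) * (mat_adjoint A *\<^sub>v ?y) $ i)"
    unfolding eq[symmetric] by (rule hform_alt) (use assms in \<open>auto intro!: carrier_matI\<close>)
  also have "\<dots> = (\<Sum>i<k. cnj (w $ i) * (\<Sum>j<m. cnj (A $$ (j, i)) * ?y $ j))"
    using assms y by (intro sum.cong refl) (auto simp: mult_mat_vec_index[of _ k m])
  also have "\<dots> = (\<Sum>i<k. \<Sum>j<m. cnj (w $ i) * cnj (A $$ (j, i)) * ?y $ j)"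
    by (simp add: sum_distrib_left mult.assoc)
  also have "\<dots> = (\<Sum>j<m. \<Sum>i<k. cnj (w $ i) * cnj (A $$ (j, i)) * ?y $ j)"
    by (rule sum.swap)
  also have "\<dots> = (\<Sum>j<m. cnj ((A *\<^sub>v w) $ j) * ?y $ j)"
    using A w by (intro sum.cong refl)
      (simp add: mult_mat_vec_index[of _ m k] sum_distrib_left mult_ac)
  also have "\<dots> = hform M (A *\<^sub>v z) (A *\<^sub>v w)"
    by (rule hform_alt[symmetric]) (use assms in auto)
  finally show ?thesis .
qed

lemma hform_unit_vec:
  assumes "M \<in> carrier_mat m m" "i < m" "j < m"
  shows "hform M (unit_vec m j) (unit_vec m i) = M $$ (i, j)"
proof -
  have "hform M (unit_vec m j) (unit_vec m i) = (\<Sum>k<m. cnj (unit_vec m i $ k) * (M *\<^sub>v unit_vec m j) $ k)"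
    by (rule hform_alt) (use assms in auto)
  also have "\<dots> = (\<Sum>k<m. if k = i then M $$ (i, j) else 0)"
    using assms by (intro sum.cong refl) (auto simp: mult_mat_unit_vec[of _ m m])
  finally show ?thesis using assms by simp
qed

text \<open>The way back from form values to matrix equations, used for membership in
  \<open>unitary_grp\<close> and for the congruence in \<open>isotropic\<close>: the entries of a
  Gram matrix are its values on unit vectors.\<close>

lemma hform_eqI:
  assumes "M \<in> carrier_mat m m" "M' \<in> carrier_mat m m"
    and "\<And>z w. z \<in> carrier_vec m \<Longrightarrow> w \<in> carrier_vec m \<Longrightarrow> hform M z w = hform M' z w"
  shows "M = M'"
proof (rule eq_matI)
  fix i j assume "i < dim_row M'" "j < dim_col M'"
  then show "M $$ (i, j) = M' $$ (i, j)"
    using assms(1,2) assms(3)[of "unit_vec m j" "unit_vec m i"]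
    by (simp add: hform_unit_vec[of M m] hform_unit_vec[of M' m])
qed (use assms in auto)

lemma mat_eq_if_mult_vec_eq:
  fixes X Y :: "'a :: semiring_1 mat"
  assumes "X \<in> carrier_mat nr nc" "Y \<in> carrier_mat nr nc"
    and "\<And>v. v \<in> carrier_vec nc \<Longrightarrow> X *\<^sub>v v = Y *\<^sub>v v"
  shows "X = Y"
proof (rule mat_col_eqI)
  fix j assume "j < dim_col Y"
  then show "col X j = col Y j"
    using assms(1,2) assms(3)[of "unit_vec nc j"]
    by (simp add: mult_mat_unit_vec[of X nr nc] mult_mat_unit_vec[of Y nr nc])
qed (use assms in auto)

lemma hform_add_left:
  assumes "z' \<in> carrier_vec (dim_row M)"
  shows "hform M (z + z') w = hform M z w + hform M z' w"
  using assms by (simp add: hform_def algebra_simps sum.distrib)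

lemma hform_add_right:
  assumes "w' \<in> carrier_vec (dim_row M)"
  shows "hform M z (w + w') = hform M z w + hform M z w'"
  using assms by (simp add: hform_def algebra_simps sum.distrib)

lemma hform_smult_left:
  assumes "z \<in> carrier_vec (dim_row M)"
  shows "hform M (c \<cdot>\<^sub>v z) w = c * hform M z w"
  using assms by (simp add: hform_def sum_distrib_left mult_ac)

lemma hform_smult_right:
  assumes "w \<in> carrier_vec (dim_row M)"
  shows "hform M z (c \<cdot>\<^sub>v w) = cnj c * hform M z w"
  using assms by (simp add: hform_def sum_distrib_left mult_ac)

lemma hform_zero_left [simp]: "hform M (0\<^sub>v (dim_row M)) w = 0"
  by (simp add: hform_def)

lemma hform_zero_right [simp]: "hform M z (0\<^sub>v (dim_row M)) = 0"
  by (simp add: hform_def)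

lemmas hform_sesquilinear = hform_add_left hform_add_right hform_smult_left hform_smult_right

lemma smult_vec_cancel:
  fixes v :: "'a :: field vec"
  assumes "c \<cdot>\<^sub>v v = d \<cdot>\<^sub>v v" "v \<in> carrier_vec m" "v \<noteq> 0\<^sub>v m"
  shows "c = d"
proof -
  obtain i where "i < m" "v $ i \<noteq> 0"
    using assms(2,3) by (metis carrier_vecD eq_vecI index_zero_vec)
  then show ?thesis
    using arg_cong[OF assms(1), of "\<lambda>v. v $ i"] assms(2) by simp
qed

lemma smult_vec_eq_0:
  fixes v :: "'a :: field vec"
  assumes "v \<in> carrier_vec m"
  shows "c \<cdot>\<^sub>v v = 0\<^sub>v m \<longleftrightarrow> c = 0 \<or> v = 0\<^sub>v m"
proof
  assume "c \<cdot>\<^sub>v v = 0\<^sub>v m"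
  also have "0\<^sub>v m = 0 \<cdot>\<^sub>v v" using assms by auto
  finally show "c = 0 \<or> v = 0\<^sub>v m" using smult_vec_cancel[OF _ assms] by blast
qed (use assms in auto)

section \<open>Generalised eigenvectors and the multiplicative Jordan decomposition\<close>

text \<open>\<open>gev A l k v\<close> says that \<open>(A - l)^k v = 0\<close>, phrased so that no subtraction occurs.\<close>
primrec gev :: "complex mat \<Rightarrow> complex \<Rightarrow> nat \<Rightarrow> complex vec \<Rightarrow> bool" where
  "gev A l 0 v \<longleftrightarrow> v = 0\<^sub>v (dim_row A)"
| "gev A l (Suc k) v \<longleftrightarrow> v \<in> carrier_vec (dim_row A) \<and> (\<exists>v'. gev A l k v' \<and> A *\<^sub>v v = l \<cdot>\<^sub>v v + v')"

lemma gev_carrier: "gev A l k v \<Longrightarrow> v \<in> carrier_vec (dim_row A)"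
  by (cases k) auto

lemma gev_commute:
  assumes A: "A \<in> carrier_mat m m" and S: "S \<in> carrier_mat m m" and comm: "S * A = A * S"
  shows "gev A l k v \<Longrightarrow> gev A l k (S *\<^sub>v v)"
proof (induction k arbitrary: v)
  case 0
  then show ?case using A S
    by (auto simp: mult_mat_vec_def scalar_prod_def intro!: eq_vecI)
next
  case (Suc k)
  then obtain v' where v: "v \<in> carrier_vec m" and v': "gev A l k v'" "A *\<^sub>v v = l \<cdot>\<^sub>v v + v'"
    using A by auto
  have c: "v' \<in> carrier_vec m" using gev_carrier[OF v'(1)] A by simp
  have "A *\<^sub>v (S *\<^sub>v v) = S *\<^sub>v (A *\<^sub>v v)"
    using A S v comm by (metis assoc_mult_mat_vec)
  also have "\<dots> = l \<cdot>\<^sub>v (S *\<^sub>v v) + S *\<^sub>v v'"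
    using A S v c by (simp add: v' mult_add_distrib_mat_vec[of _ m m] mult_mat_vec[of _ m m])
  finally show ?case using Suc.IH[OF v'(1)] A S v by auto
qed

lemma gev_smult:
  assumes A: "A \<in> carrier_mat m m"
  shows "gev A l k v \<Longrightarrow> gev A l k (c \<cdot>\<^sub>v v)"
proof (induction k arbitrary: v)
  case (Suc k)
  then obtain v' where v: "v \<in> carrier_vec m" and v': "gev A l k v'" "A *\<^sub>v v = l \<cdot>\<^sub>v v + v'"
    using A by auto
  have c: "v' \<in> carrier_vec m" using gev_carrier[OF v'(1)] A by simp
  have "A *\<^sub>v (c \<cdot>\<^sub>v v) = l \<cdot>\<^sub>v (c \<cdot>\<^sub>v v) + c \<cdot>\<^sub>v v'"
    using A v c by (simp add: v' mult_mat_vec[of _ m m] smult_add_distrib_vec[of _ m]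
        smult_smult_assoc mult.commute)
  then show ?case using Suc.IH[OF v'(1)] A v by auto
qed auto

lemma gev_similar:
  assumes B: "B \<in> carrier_mat m m" and P: "P \<in> carrier_mat m m" and Q: "Q \<in> carrier_mat m m"
    and QP: "Q * P = 1\<^sub>m m"
  shows "gev B l k v \<Longrightarrow> gev (P * B * Q) l k (P *\<^sub>v v)"
proof (induction k arbitrary: v)
  case 0
  then show ?case using P B
    by (auto simp: mult_mat_vec_def scalar_prod_def intro!: eq_vecI)
next
  case (Suc k)
  then obtain v' where v: "v \<in> carrier_vec m" and v': "gev B l k v'" "B *\<^sub>v v = l \<cdot>\<^sub>v v + v'"
    using B by auto
  have c: "v' \<in> carrier_vec m" using gev_carrier[OF v'(1)] B by simp
  have "Q *\<^sub>v (P *\<^sub>v v) = v"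
    using P Q QP v by (metis assoc_mult_mat_vec one_mult_mat_vec)
  then have "(P * B * Q) *\<^sub>v (P *\<^sub>v v) = P *\<^sub>v (B *\<^sub>v v)"
    using B P Q v by (simp add: assoc_mult_mat_vec[of _ m m _ m])
  also have "\<dots> = l \<cdot>\<^sub>v (P *\<^sub>v v) + P *\<^sub>v v'"
    using P v c by (simp add: v' mult_add_distrib_mat_vec[of _ m m] mult_mat_vec[of _ m m])
  finally show ?case using Suc.IH[OF v'(1)] P v by auto
qed

text \<open>\<open>B - l\<close> is strictly upper triangular, so it shortens by one the initial
  segment of coordinates on which a vector is supported.\<close>

lemma gev_upper_triangular:
  assumes B: "B \<in> carrier_mat m m" and ut: "upper_triangular B" and d: "\<And>i. i < m \<Longrightarrow> B $$ (i, i) = l"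
  shows "v \<in> carrier_vec m \<Longrightarrow> (\<And>i. k \<le> i \<Longrightarrow> i < m \<Longrightarrow> v $ i = 0) \<Longrightarrow> gev B l k v"
proof (induction k arbitrary: v)
  case 0
  then show ?case using B by (auto intro!: eq_vecI)
next
  case (Suc k)
  define v' where "v' = B *\<^sub>v v - l \<cdot>\<^sub>v v"
  have v': "v' \<in> carrier_vec m" using B Suc.prems by (auto simp: v'_def)
  have "v' $ i = 0" if i: "k \<le> i" "i < m" for i
  proof -
    \<comment> \<open>For \<open>j < i\<close> the entry of \<open>B\<close> vanishes; for
      \<open>j > i\<close> the index \<open>j\<close> is at least \<open>Suc k\<close>, beyond the
      support of \<open>v\<close>.\<close>
    have "B $$ (i, j) * v $ j = (if j = i then l * v $ i else 0)" if "j < m" for j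
      using that i B ut d Suc.prems(2)[of j] by (cases j i rule: linorder_cases) auto
    then have "(B *\<^sub>v v) $ i = l * v $ i"
      using B Suc.prems(1) i by (simp add: mult_mat_vec_index[of _ m m])
    then show ?thesis using B Suc.prems(1) i by (simp add: v'_def)
  qed
  then have "gev B l k v'" by (rule Suc.IH[OF v'])
  moreover have "B *\<^sub>v v = l \<cdot>\<^sub>v v + v'"
    using B Suc.prems(1) by (auto simp: v'_def intro!: eq_vecI)
  ultimately show ?case using B Suc.prems(1) by auto
qed

text \<open>\<open>unipotent\<close> speaks of eigenvalues only; Schur triangularisation converts it
  into nilpotency of \<open>U - 1\<close>, with one exponent \<open>m\<close> for all vectors. The
  diagonal of the triangular form consists of roots of the characteristic polynomial, hence of
  ones.\<close>

lemma unipotent_gev: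
  assumes U: "U \<in> carrier_mat m m" "unipotent U" and v: "v \<in> carrier_vec m"
  shows "gev U 1 m v"
proof -
  obtain es where es: "char_poly U = (\<Prod>e\<leftarrow>es. [:- e, 1:])"
    using char_poly_factorized[OF U(1)] by blast
  obtain B P Q where "schur_decomposition U es = (B, P, Q)" by (metis prod_cases3)
  from schur_decomposition[OF U(1) es this]
  have s: "similar_mat_wit U B P Q" and ut: "upper_triangular B" and diag: "diag_mat B = es" by auto
  note w = similar_mat_witD2[OF U(1) s]
  have "B $$ (i, i) = 1" if "i < m" for i
  proof -
    have "B $$ (i, i) \<in> set es" using that w unfolding diag[symmetric] by (auto simp: diag_mat_def)
    then have "poly (char_poly U) (B $$ (i, i)) = 0" unfolding es
      by (induction es) auto
    then show ?thesis using U eigenvalue_root_char_poly[OF U(1)] by (auto simp: unipotent_def)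
  qed
  then have "gev B 1 m (Q *\<^sub>v v)"
    using gev_upper_triangular[OF w(5) ut] w v by auto
  from gev_similar[OF w(5-7) w(2) this] show ?thesis
    using w v by (metis assoc_mult_mat_vec one_mult_mat_vec)
qed

section \<open>Diagonalisable matrices\<close>

lemma semisimple_obtain:
  assumes "a \<in> carrier_mat m m" "semisimple a"
  obtains P Q D where "P \<in> carrier_mat m m" "Q \<in> carrier_mat m m" "D \<in> carrier_mat m m"
    "P * Q = 1\<^sub>m m" "Q * P = 1\<^sub>m m" "a = P * D * Q" "diagonal_mat D"
proof -
  obtain D P Q where "diagonal_mat D" and s: "similar_mat_wit a D P Q"
    using assms by (auto simp: semisimple_def similar_mat_def)
  with similar_mat_witD2[OF assms(1) s] that show thesis by metis
qed

lemma diagonal_mat_mult_vec: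
  assumes "D \<in> carrier_mat m m" "diagonal_mat D" "v \<in> carrier_vec m" "i < m"
  shows "(D *\<^sub>v v) $ i = D $$ (i, i) * v $ i"
proof -
  have "(D *\<^sub>v v) $ i = (\<Sum>j<m. if j = i then D $$ (i, i) * v $ i else 0)"
    unfolding mult_mat_vec_index[OF assms(1,3,4)]
    using assms by (intro sum.cong refl) (auto simp: diagonal_mat_def)
  then show ?thesis using assms by simp
qed

text \<open>A diagonalisable matrix has no Jordan chain of length two. In diagonal coordinates the
  two equations read \<open>(D_i - l) y_i = z_i\<close> and \<open>(D_i - l) z_i = 0\<close>; if
  \<open>D_i = l\<close> the former kills \<open>z_i\<close>, otherwise the latter does.\<close>

lemma semisimple_gev2:
  assumes a: "a \<in> carrier_mat m m" "semisimple a" and y: "y \<in> carrier_vec m" and z: "z \<in> carrier_vec m"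
    and ay: "a *\<^sub>v y = l \<cdot>\<^sub>v y + z" and az: "a *\<^sub>v z = l \<cdot>\<^sub>v z"
  shows "z = 0\<^sub>v m"
proof -
  obtain P Q D where PQD: "P \<in> carrier_mat m m" "Q \<in> carrier_mat m m" "D \<in> carrier_mat m m"
    "P * Q = 1\<^sub>m m" "Q * P = 1\<^sub>m m" "a = P * D * Q" "diagonal_mat D"
    using semisimple_obtain[OF a] .
  have *: "Q *\<^sub>v (a *\<^sub>v x) = D *\<^sub>v (Q *\<^sub>v x)" if "x \<in> carrier_vec m" for x
  proof -
    have "Q * (P * D * Q) = D * Q"
      using PQD by (metis assoc_mult_mat left_mult_one_mat mult_carrier_mat)
    then show ?thesis using PQD that by (metis assoc_mult_mat_vec mult_carrier_mat)
  qed
  have Qc: "Q *\<^sub>v y \<in> carrier_vec m" "Q *\<^sub>v z \<in> carrier_vec m" using PQD y z by auto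
  have Qy: "D *\<^sub>v (Q *\<^sub>v y) = l \<cdot>\<^sub>v (Q *\<^sub>v y) + Q *\<^sub>v z"
    using *[OF y] PQD(1-3) y z by (simp add: ay mult_add_distrib_mat_vec[of _ m m] mult_mat_vec[of _ m m])
  have Qz: "D *\<^sub>v (Q *\<^sub>v z) = l \<cdot>\<^sub>v (Q *\<^sub>v z)"
    using *[OF z] PQD(1-3) z by (simp add: az mult_mat_vec[of _ m m])
  have "Q *\<^sub>v z = 0\<^sub>v m"
  proof (rule eq_vecI)
    fix i assume "i < dim_vec (0\<^sub>v m)"
    then have i: "i < m" by simp
    have "D $$ (i, i) * (Q *\<^sub>v y) $ i = l * (Q *\<^sub>v y) $ i + (Q *\<^sub>v z) $ i"
      using arg_cong[OF Qy, of "\<lambda>v. v $ i"] i PQD y z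
      by (simp add: diagonal_mat_mult_vec[OF PQD(3,7) Qc(1)])
    moreover have "D $$ (i, i) * (Q *\<^sub>v z) $ i = l * (Q *\<^sub>v z) $ i"
      using arg_cong[OF Qz, of "\<lambda>v. v $ i"] i PQD y z
      by (simp add: diagonal_mat_mult_vec[OF PQD(3,7) Qc(2)])
    ultimately show "(Q *\<^sub>v z) $ i = 0\<^sub>v m $ i" using i
      by (cases "D $$ (i, i) = l") (auto simp: mult_right_cancel)
  qed (use PQD in auto)
  then have "P *\<^sub>v (Q *\<^sub>v z) = 0\<^sub>v m" using PQD by (auto simp: mult_mat_vec_def scalar_prod_def intro!: eq_vecI)
  then show ?thesis using PQD z by (metis assoc_mult_mat_vec one_mult_mat_vec)
qed

text \<open>Diagonalisability as an induction principle: the columns of \<open>P\<close> are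
  eigenvectors and span. Linear and sesquilinear identities can then be checked on eigenvectors
  without forming direct sums.\<close>

lemma semisimple_induct [consumes 3, case_names eigenvector add]:
  assumes a: "a \<in> carrier_mat m m" "semisimple a" and v: "v \<in> carrier_vec m"
    and eig: "\<And>v l. v \<in> carrier_vec m \<Longrightarrow> a *\<^sub>v v = l \<cdot>\<^sub>v v \<Longrightarrow> R v"
    and add: "\<And>v w. v \<in> carrier_vec m \<Longrightarrow> w \<in> carrier_vec m \<Longrightarrow> R v \<Longrightarrow> R w \<Longrightarrow> R (v + w)"
  shows "R v"
proof -
  obtain P Q D where PQD: "P \<in> carrier_mat m m" "Q \<in> carrier_mat m m" "D \<in> carrier_mat m m"
    "P * Q = 1\<^sub>m m" "Q * P = 1\<^sub>m m" "a = P * D * Q" "diagonal_mat D"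
    using semisimple_obtain[OF a] .
  have ev: "a *\<^sub>v (P *\<^sub>v (c \<cdot>\<^sub>v unit_vec m k)) = D $$ (k, k) \<cdot>\<^sub>v (P *\<^sub>v (c \<cdot>\<^sub>v unit_vec m k))" if "k < m" for c k
  proof -
    let ?u = "c \<cdot>\<^sub>v unit_vec m k"
    have u: "?u \<in> carrier_vec m" by simp
    have "Q *\<^sub>v (P *\<^sub>v ?u) = ?u" using PQD u by (metis assoc_mult_mat_vec one_mult_mat_vec)
    then have "a *\<^sub>v (P *\<^sub>v ?u) = P *\<^sub>v (D *\<^sub>v ?u)" using PQD u
      by (simp add: assoc_mult_mat_vec[of _ m m _ m])
    also have "D *\<^sub>v ?u = D $$ (k, k) \<cdot>\<^sub>v ?u"
      by (rule eq_vecI) (use PQD u that in \<open>auto simp: diagonal_mat_mult_vec[of _ m]\<close>)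
    also have "P *\<^sub>v (D $$ (k, k) \<cdot>\<^sub>v ?u) = D $$ (k, k) \<cdot>\<^sub>v (P *\<^sub>v ?u)"
      using PQD(1) u by (rule mult_mat_vec)
    finally show ?thesis .
  qed
  \<comment> \<open>The truncations of the coordinate vector of \<open>v\<close> are built up one
    eigenvector at a time.\<close>
  have "R (P *\<^sub>v vec m (\<lambda>i. if i < k then (Q *\<^sub>v v) $ i else 0))" if "k \<le> m" for k
    using that
  proof (induction k)
    case 0
    have "P *\<^sub>v vec m (\<lambda>i. if i < 0 then (Q *\<^sub>v v) $ i else 0) = 0\<^sub>v m"
      using PQD by (auto simp: mult_mat_vec_def scalar_prod_def intro!: eq_vecI)
    \<comment> \<open>The eigenvector hypothesis admits the zero vector, so it also starts this
      induction; the eigenvalue 0 is an arbitrary choice.\<close>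
    moreover have "a *\<^sub>v 0\<^sub>v m = 0 \<cdot>\<^sub>v 0\<^sub>v m"
      using a by (auto simp: mult_mat_vec_def scalar_prod_def intro!: eq_vecI)
    ultimately show ?case using eig[of "0\<^sub>v m" 0] by simp
  next
    case (Suc k)
    let ?x = "vec m (\<lambda>i. if i < k then (Q *\<^sub>v v) $ i else 0)"
    let ?e = "(Q *\<^sub>v v) $ k \<cdot>\<^sub>v unit_vec m k"
    have "vec m (\<lambda>i. if i < Suc k then (Q *\<^sub>v v) $ i else 0) = ?x + ?e"
      using Suc.prems by (auto intro!: eq_vecI simp: less_Suc_eq)
    moreover have "R (P *\<^sub>v ?x + P *\<^sub>v ?e)"
      using Suc PQD by (intro add eig[OF _ ev]) auto
    ultimately show ?case using PQD by (simp add: mult_add_distrib_mat_vec[of _ m m])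
  qed
  from this[of m] have "R (P *\<^sub>v (Q *\<^sub>v v))"
  proof -
    have "vec m (\<lambda>i. if i < m then (Q *\<^sub>v v) $ i else 0) = Q *\<^sub>v v"
      using PQD by (auto intro!: eq_vecI)
    with \<open>m \<le> m \<Longrightarrow> _\<close> show ?thesis by simp
  qed
  then show ?thesis using PQD v by (metis assoc_mult_mat_vec one_mult_mat_vec)
qed

lemma semisimple_eqI:
  assumes a: "a \<in> carrier_mat m m" "semisimple a" and X: "X \<in> carrier_mat m m" and Y: "Y \<in> carrier_mat m m"
    and eq: "\<And>v l. v \<in> carrier_vec m \<Longrightarrow> a *\<^sub>v v = l \<cdot>\<^sub>v v \<Longrightarrow> X *\<^sub>v v = Y *\<^sub>v v"
  shows "X = Y"
proof (rule mat_eq_if_mult_vec_eq[OF X Y])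
  fix v :: "complex vec" assume "v \<in> carrier_vec m"
  with a show "X *\<^sub>v v = Y *\<^sub>v v"
  proof (induction rule: semisimple_induct)
    case (eigenvector v l)
    then show ?case by (rule eq)
  next
    case (add v w)
    then show ?case using X Y by (simp add: mult_add_distrib_mat_vec[of _ m m])
  qed
qed

lemma semisimple_commuteI:
  assumes a: "a \<in> carrier_mat m m" "semisimple a" and S: "S \<in> carrier_mat m m"
    and eig: "\<And>v l. v \<in> carrier_vec m \<Longrightarrow> a *\<^sub>v v = l \<cdot>\<^sub>v v \<Longrightarrow> a *\<^sub>v (S *\<^sub>v v) = l \<cdot>\<^sub>v (S *\<^sub>v v)"
  shows "S * a = a * S"
proof (rule semisimple_eqI[OF a])
  fix v l assume v: "v \<in> carrier_vec m" "a *\<^sub>v v = l \<cdot>\<^sub>v v"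
  have "(S * a) *\<^sub>v v = l \<cdot>\<^sub>v (S *\<^sub>v v)"
    using a S v by (simp add: assoc_mult_mat_vec[of _ m m _ m] mult_mat_vec[of _ m m])
  then show "(S * a) *\<^sub>v v = (a * S) *\<^sub>v v"
    using a S v eig[OF v] by (simp add: assoc_mult_mat_vec[of _ m m _ m])
qed (use a S in auto)

section \<open>The semisimple factor of an arbitrary commuting decomposition\<close>

context
  fixes a b g :: "complex mat" and m :: nat
  assumes a: "a \<in> carrier_mat m m" "semisimple a" and b: "b \<in> carrier_mat m m" "unipotent b"
    and g: "g = a * b" and comm: "a * b = b * a"
begin

private lemma gmult: "v \<in> carrier_vec m \<Longrightarrow> g *\<^sub>v v = a *\<^sub>v (b *\<^sub>v v)"
  "v \<in> carrier_vec m \<Longrightarrow> g *\<^sub>v v = b *\<^sub>v (a *\<^sub>v v)"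
  using a b g comm by (metis assoc_mult_mat_vec)+

private lemma gcarrier: "g \<in> carrier_mat m m"
  using a b g by simp

text \<open>Induction on the height of \<open>y\<close> for \<open>b\<close>. The difference
  \<open>y' = b y - y\<close> is again killed by \<open>g - l\<close>, so \<open>a y' = l y'\<close>
  by induction. Expanding \<open>l y = a (b y)\<close> gives \<open>a y = l y - l y'\<close>, a
  chain of length two for \<open>a\<close>; semisimplicity forces \<open>l y' = 0\<close>.\<close>

private lemma eigenvector_semisimple_part_aux:
  "gev b 1 k y \<Longrightarrow> g *\<^sub>v y = l \<cdot>\<^sub>v y \<Longrightarrow> a *\<^sub>v y = l \<cdot>\<^sub>v y"
proof (induction k arbitrary: y)
  case 0
  then show ?case using a b by (auto simp: mult_mat_vec_def scalar_prod_def intro!: eq_vecI)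
next
  case (Suc k)
  then obtain y' where y: "y \<in> carrier_vec m" and y': "gev b 1 k y'" "b *\<^sub>v y = 1 \<cdot>\<^sub>v y + y'"
    using b by auto
  have c: "y' \<in> carrier_vec m" using gev_carrier[OF y'(1)] b by simp
  have by_eq: "y' = b *\<^sub>v y - y" unfolding y' using y c by (auto intro!: eq_vecI)
  have "b * g = g * b" using a b g comm by (metis assoc_mult_mat)
  then have "g *\<^sub>v (b *\<^sub>v y) = b *\<^sub>v (g *\<^sub>v y)"
    using b gcarrier y by (metis assoc_mult_mat_vec)
  then have "g *\<^sub>v y' = l \<cdot>\<^sub>v y'" unfolding by_eq
    using gcarrier b y by (simp add: Suc.prems mult_minus_distrib_mat_vec[of _ m m]
        mult_mat_vec[of _ m m]) (auto intro!: eq_vecI simp: algebra_simps)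
  then have ay': "a *\<^sub>v y' = l \<cdot>\<^sub>v y'" using Suc.IH y' by blast
  have ly: "l \<cdot>\<^sub>v y = a *\<^sub>v y + l \<cdot>\<^sub>v y'"
    using Suc.prems(2) gmult(1)[OF y] y c a
    by (simp add: y' mult_add_distrib_mat_vec[of _ m m] ay')
  then have "l * y $ i = (a *\<^sub>v y) $ i + l * y' $ i" if "i < m" for i
  proof -
    have "(l \<cdot>\<^sub>v y) $ i = (a *\<^sub>v y + l \<cdot>\<^sub>v y') $ i" using ly by (rule arg_cong)
    then show ?thesis using that y c a(1) by simp
  qed
  then have *: "a *\<^sub>v y = l \<cdot>\<^sub>v y + (- l) \<cdot>\<^sub>v y'"
    using y c a by (auto intro!: eq_vecI)
  have "(- l) \<cdot>\<^sub>v y' = 0\<^sub>v m"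
  proof (rule semisimple_gev2[OF a y _ *])
    show "a *\<^sub>v (- l \<cdot>\<^sub>v y') = l \<cdot>\<^sub>v (- l \<cdot>\<^sub>v y')"
      using a c by (simp add: mult_mat_vec[of _ m m] ay' smult_smult_assoc)
  qed (use c in simp)
  then show ?case using * y by simp
qed

text \<open>Induction on the height \<open>k\<close>. The defect \<open>y = a v - l v\<close>
  satisfies \<open>g y = l y\<close>, because the contributions of \<open>v'\<close> cancel by the
  induction hypothesis. Hence \<open>a y = l y\<close>, so \<open>v\<close> and \<open>y\<close>
  form a chain of length two for \<open>a\<close> and \<open>y\<close> must vanish.\<close>

lemma gev_semisimple_part:
  "gev g l k v \<Longrightarrow> a *\<^sub>v v = l \<cdot>\<^sub>v v"
proof (induction k arbitrary: v)
  case 0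
  then show ?case using a g by (auto simp: mult_mat_vec_def scalar_prod_def intro!: eq_vecI)
next
  case (Suc k)
  then obtain v' where v: "v \<in> carrier_vec m" and v': "gev g l k v'" "g *\<^sub>v v = l \<cdot>\<^sub>v v + v'"
    using gcarrier by auto
  have c: "v' \<in> carrier_vec m" using gev_carrier[OF v'(1)] gcarrier by simp
  have av': "a *\<^sub>v v' = l \<cdot>\<^sub>v v'" using Suc.IH v' by blast
  define y where "y = a *\<^sub>v v - l \<cdot>\<^sub>v v"
  have y: "y \<in> carrier_vec m" using a v by (simp add: y_def)
  have "a * g = g * a" using a b g comm by (metis assoc_mult_mat)
  then have ga: "g *\<^sub>v (a *\<^sub>v v) = a *\<^sub>v (g *\<^sub>v v)"
    using a gcarrier v by (metis assoc_mult_mat_vec)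
  have "g *\<^sub>v y = a *\<^sub>v (g *\<^sub>v v) - l \<cdot>\<^sub>v (g *\<^sub>v v)" unfolding y_def
    using gcarrier a v by (simp add: mult_minus_distrib_mat_vec[of _ m m] mult_mat_vec[of _ m m] ga)
  also have "\<dots> = l \<cdot>\<^sub>v y" unfolding v' y_def
    using a v c by (simp add: mult_add_distrib_mat_vec[of _ m m] mult_mat_vec[of _ m m] av')
      (auto intro!: eq_vecI simp: algebra_simps)
  finally have ay: "a *\<^sub>v y = l \<cdot>\<^sub>v y"
    using eigenvector_semisimple_part_aux unipotent_gev[OF b y] by blast
  have av: "a *\<^sub>v v = l \<cdot>\<^sub>v v + y" using a v by (auto simp: y_def intro!: eq_vecI)
  have "y = 0\<^sub>v m" by (rule semisimple_gev2[OF a v y av ay])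
  then show ?case using av v by simp
qed

text \<open>On an eigenspace of \<open>a\<close> the matrix \<open>g\<close> acts as
  \<open>l\<close> times \<open>b\<close>, so chains of \<open>b\<close> for 1 become chains of
  \<open>g\<close> for \<open>l\<close> after rescaling.\<close>

lemma semisimple_part_gev:
  assumes "v \<in> carrier_vec m" "a *\<^sub>v v = l \<cdot>\<^sub>v v"
  shows "gev g l m v"
proof -
  have "gev b 1 k v \<Longrightarrow> a *\<^sub>v v = l \<cdot>\<^sub>v v \<Longrightarrow> gev g l k v" for k v
  proof (induction k arbitrary: v)
    case 0
    then show ?case using b gcarrier by simp
  next
    case (Suc k)
    then obtain v' where v: "v \<in> carrier_vec m" and v': "gev b 1 k v'" "b *\<^sub>v v = 1 \<cdot>\<^sub>v v + v'"
      using b by auto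
    have c: "v' \<in> carrier_vec m" using gev_carrier[OF v'(1)] b by simp
    have v'_eq: "v' = b *\<^sub>v v - v" unfolding v' using v c by (auto intro!: eq_vecI)
    have "a *\<^sub>v (b *\<^sub>v v) = b *\<^sub>v (a *\<^sub>v v)" using gmult v by metis
    then have "a *\<^sub>v v' = l \<cdot>\<^sub>v v'" unfolding v'_eq
      using a b v by (simp add: mult_minus_distrib_mat_vec[of _ m m] Suc.prems mult_mat_vec[of _ m m])
        (auto intro!: eq_vecI simp: algebra_simps)
    then have "gev g l k (l \<cdot>\<^sub>v v')" using Suc.IH v' gev_smult[OF gcarrier] by blast
    moreover have "g *\<^sub>v v = l \<cdot>\<^sub>v v + l \<cdot>\<^sub>v v'"
      using v c b by (simp add: gmult(2) Suc.prems v' mult_mat_vec[of _ m m] smult_add_distrib_vec[of _ m])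
    ultimately show ?case using v gcarrier by auto
  qed
  then show ?thesis using unipotent_gev[OF b] assms by blast
qed

text \<open>The eigenspaces of \<open>a\<close> have now been characterised by \<open>g\<close>
  alone, so whatever commutes with \<open>g\<close> preserves them, and they span.\<close>

lemma semisimple_part_commute:
  assumes S: "S \<in> carrier_mat m m" and Sg: "S * g = g * S"
  shows "S * a = a * S"
proof (rule semisimple_commuteI[OF a S])
  fix v l assume "v \<in> carrier_vec m" "a *\<^sub>v v = l \<cdot>\<^sub>v v"
  then have "gev g l m v" by (rule semisimple_part_gev)
  then have "gev g l m (S *\<^sub>v v)" by (rule gev_commute[OF gcarrier S Sg])
  then show "a *\<^sub>v (S *\<^sub>v v) = l \<cdot>\<^sub>v (S *\<^sub>v v)" by (rule gev_semisimple_part)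
qed

end

section \<open>Existence of a multiplicative Jordan decomposition\<close>

text \<open>A nonzero entry lies inside one Jordan block, where the diagonal is constant. This makes
  the diagonal part commute with the whole Jordan matrix.\<close>

lemma jordan_matrix_same_diag:
  "i < sum_list (map fst n_as) \<Longrightarrow> j < sum_list (map fst n_as) \<Longrightarrow> jordan_matrix n_as $$ (i, j) \<noteq> 0
    \<Longrightarrow> jordan_matrix n_as $$ (i, i) = jordan_matrix n_as $$ (j, j)"
proof (induction n_as arbitrary: i j)
  case (Cons na n_as)
  obtain n a where na: "na = (n, a)" by force
  show ?case using Cons.prems Cons.IH[of "i - n" "j - n"]
    unfolding na jordan_matrix_Cons by (auto split: if_splits)
qed simp

text \<open>Injectivity keeps 0 off the diagonal of the Jordan form \<open>J\<close>, so the
  diagonal part \<open>D\<close> can be divided out on either side. The unipotent quotient and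
  \<open>D\<close> are then conjugated back.\<close>

lemma multiplicative_jordan_decomposition:
  fixes g :: "complex mat"
  assumes g: "g \<in> carrier_mat m m" and inj: "\<And>v. v \<in> carrier_vec m \<Longrightarrow> g *\<^sub>v v = 0\<^sub>v m \<Longrightarrow> v = 0\<^sub>v m"
  obtains a b where "a \<in> carrier_mat m m" "semisimple a" "b \<in> carrier_mat m m" "unipotent b"
    "g = a * b" "a * b = b * a"
proof -
  obtain as where "char_poly g = (\<Prod>a\<leftarrow>as. [:- a, 1:])" using char_poly_factorized[OF g] by blast
  then obtain n_as where "jordan_nf g n_as" using jordan_nf_exists[OF g] by blast
  define J where "J = jordan_matrix n_as"
  obtain P Q where s: "similar_mat_wit g J P Q"
    using \<open>jordan_nf g n_as\<close> by (auto simp: jordan_nf_def similar_mat_def J_def)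
  note w = similar_mat_witD2[OF g s]
  have m: "sum_list (map fst n_as) = m" using w(5) by (auto simp: J_def)
  have ut: "upper_triangular J" using jordan_matrix_upper_triangular m w(5)
    by (auto simp: J_def upper_triangular_def)
  have sd: "J $$ (i, i) = J $$ (j, j)" if "i < m" "j < m" "J $$ (i, j) \<noteq> 0" for i j
    using jordan_matrix_same_diag that unfolding J_def m[symmetric] by blast
  have nz: "J $$ (i, i) \<noteq> 0" if "i < m" for i
  proof
    assume "J $$ (i, i) = 0"
    then have "0 \<in> set (diag_mat J)" using that w(5) by (force simp: diag_mat_def)
    then have "poly (\<Prod>a\<leftarrow>diag_mat J. [:- a, 1:]) 0 = 0" by (induction "diag_mat J") (auto simp: poly_prod_list o_def)
    moreover have "char_poly g = char_poly J"
      by (rule char_poly_similar) (use s in \<open>auto simp: similar_mat_def\<close>)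
    ultimately have "poly (char_poly g) 0 = 0"
      using char_poly_upper_triangular[OF w(5) ut] by simp
    then obtain v where "v \<in> carrier_vec m" "v \<noteq> 0\<^sub>v m" "g *\<^sub>v v = 0 \<cdot>\<^sub>v v"
      using eigenvalue_root_char_poly[OF g, of 0] g by (auto simp: eigenvalue_def eigenvector_def)
    then show False using inj by fastforce
  qed
  define D where "D = mat m m (\<lambda>(i, j). if i = j then J $$ (i, i) else 0)"
  \<comment> \<open>Row \<open>i\<close> is divided by its diagonal entry: this is the inverse of
    \<open>D\<close> times \<open>J\<close>, upper triangular with ones on the diagonal.\<close>
  define U where "U = mat m m (\<lambda>(i, j). J $$ (i, j) / J $$ (i, i))"
  have D: "D \<in> carrier_mat m m" and U: "U \<in> carrier_mat m m" by (auto simp: D_def U_def)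
  have DU: "D * U = J"
  proof (rule eq_matI)
    fix i j assume "i < dim_row J" "j < dim_col J"
    then have ij: "i < m" "j < m" using w(5) by auto
    have "(D * U) $$ (i, j) = (\<Sum>k<m. if k = i then J $$ (i, i) * U $$ (i, j) else 0)"
      unfolding mult_mat_index[OF D U ij] using ij by (intro sum.cong) (auto simp: D_def)
    then show "(D * U) $$ (i, j) = J $$ (i, j)" using ij nz by (simp add: U_def)
  qed (use D U w in auto)
  have UD: "U * D = J"
  proof (rule eq_matI)
    fix i j assume "i < dim_row J" "j < dim_col J"
    then have ij: "i < m" "j < m" using w(5) by auto
    have "(U * D) $$ (i, j) = (\<Sum>k<m. if k = j then U $$ (i, j) * J $$ (j, j) else 0)"
      unfolding mult_mat_index[OF U D ij] using ij by (intro sum.cong) (auto simp: D_def)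
    \<comment> \<open>Here columns are rescaled although \<open>U\<close> was obtained by rescaling
      rows; the result agrees because a nonzero \<open>J $$ (i, j)\<close> links equal diagonal
      entries.\<close>
    then show "(U * D) $$ (i, j) = J $$ (i, j)" using ij nz[OF ij(2)] sd[OF ij]
      by (cases "J $$ (i, j) = 0") (simp_all add: U_def)
  qed (use D U w in auto)
  define a b where "a = P * D * Q" and "b = P * U * Q"
  have ab: "a \<in> carrier_mat m m" "b \<in> carrier_mat m m" using w D U by (auto simp: a_def b_def)
  have conj: "(P * X * Q) * (P * Y * Q) = P * (X * Y) * Q"
    if "X \<in> carrier_mat m m" "Y \<in> carrier_mat m m" for X Y
  proof -
    have key: "Q * (P * Z) = Z" if "Z \<in> carrier_mat m m" for Z
      using assoc_mult_mat[OF w(7,6) that] w(2) that by simp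
    have "Y * Q \<in> carrier_mat m m" using that w by simp
    from key[OF this] show ?thesis
      using that w(5-7) by (simp add: assoc_mult_mat[of _ m m _ m _ m])
  qed
  have "semisimple a" unfolding semisimple_def
  proof (intro exI conjI)
    show "similar_mat a D"
      by (rule similar_matI[where P = P and Q = Q and n = m]) (use w D ab in \<open>auto simp: a_def\<close>)
    show "diagonal_mat D" by (auto simp: D_def diagonal_mat_def)
  qed
  moreover have "unipotent b" unfolding unipotent_def
  proof (intro allI impI)
    fix l assume "eigenvalue b l"
    then have "poly (char_poly b) l = 0" using eigenvalue_root_char_poly[OF ab(2)] by simp
    also have "similar_mat b U"
      by (rule similar_matI[where P = P and Q = Q and n = m]) (use w U ab in \<open>auto simp: b_def\<close>)
    then have "char_poly b = char_poly U" by (rule char_poly_similar)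
    also have "\<dots> = (\<Prod>a\<leftarrow>diag_mat U. [:- a, 1:])"
      by (rule char_poly_upper_triangular[OF U]) (use ut U w(5) in \<open>auto simp: U_def upper_triangular_def\<close>)
    finally have "l \<in> set (diag_mat U)" by (induction "diag_mat U") (auto simp: poly_prod_list prod_list_zero_iff)
    then show "l = 1" using nz by (auto simp: diag_mat_def U_def)
  qed
  moreover have "a * b = P * J * Q" "b * a = P * J * Q"
    using conj[OF D U] conj[OF U D] by (simp_all only: a_def b_def DU UD)
  ultimately show thesis using that[of a b] ab w(3) by simp
qed

lemma commute_inverse_mat:
  fixes g g' h :: "'a :: semiring_1 mat"
  assumes c: "g \<in> carrier_mat m m" "g' \<in> carrier_mat m m" "h \<in> carrier_mat m m"
    and comm: "g * h = h * g" and inv: "g' * g = 1\<^sub>m m" "g * g' = 1\<^sub>m m"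
  shows "g' * h = h * g'"
proof -
  have "g' * h = g' * (h * (g * g'))" using c inv by simp
  also have "h * (g * g') = h * g * g'" using assoc_mult_mat[OF c(3,1,2)] by simp
  also have "\<dots> = g * (h * g')" using assoc_mult_mat[OF c(1,3,2)] comm by simp
  also have "g' * (g * (h * g')) = g' * g * (h * g')"
    using assoc_mult_mat[OF c(2,1) mult_carrier_mat[OF c(3,2)]] by simp
  also have "\<dots> = h * g'" using inv c by simp
  finally show ?thesis .
qed

section \<open>Hermitian spaces of signature (n,1)\<close>

lemma std_diag_carrier [simp]: "std_diag n \<in> carrier_mat (Suc n) (Suc n)"
  by (simp add: std_diag_def)

lemma hform_std_diag:
  "hform (std_diag n) z w = (\<Sum>i<n. cnj (w $ i) * z $ i) - cnj (w $ n) * z $ n"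
proof -
  have "(\<Sum>j<Suc n. cnj (w $ i) * std_diag n $$ (i, j) * z $ j)
      = (if i = n then - cnj (w $ i) * z $ i else cnj (w $ i) * z $ i)" if "i < Suc n" for i
  proof -
    have "(\<Sum>j<Suc n. cnj (w $ i) * std_diag n $$ (i, j) * z $ j)
        = (\<Sum>j<Suc n. if j = i then (if i = n then - cnj (w $ i) * z $ i else cnj (w $ i) * z $ i) else 0)"
      using that by (intro sum.cong) (auto simp: std_diag_def)
    then show ?thesis using that by simp
  qed
  then have "hform (std_diag n) z w
      = (\<Sum>i<Suc n. if i = n then - cnj (w $ i) * z $ i else cnj (w $ i) * z $ i)"
    unfolding hform_def by (intro sum.cong) (auto simp: std_diag_def)
  then show ?thesis by simp
qed

section \<open>Projective points and the action on them\<close>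

lemma proj_pt_self [simp]: "v \<in> proj_pt v"
  unfolding proj_pt_def by (auto intro: exI[of _ 1])

lemma proj_pt_smult:
  assumes "c \<noteq> 0"
  shows "proj_pt (c \<cdot>\<^sub>v v) = proj_pt v"
proof
  show "proj_pt (c \<cdot>\<^sub>v v) \<subseteq> proj_pt v" by (auto simp: proj_pt_def smult_smult_assoc)
  have "d \<cdot>\<^sub>v v = (d / c) \<cdot>\<^sub>v (c \<cdot>\<^sub>v v)" for d using assms by (simp add: smult_smult_assoc)
  then show "proj_pt v \<subseteq> proj_pt (c \<cdot>\<^sub>v v)" unfolding proj_pt_def by blast
qed

lemma act_proj_pt:
  assumes "g \<in> carrier_mat m m" "v \<in> carrier_vec m"
  shows "act g (proj_pt v) = proj_pt (g *\<^sub>v v)"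
  using assms by (auto simp: act_def proj_pt_def image_iff mult_mat_vec[of _ m m])
    (metis mult_mat_vec)

lemma act_mult:
  assumes "g \<in> carrier_mat m m" "h \<in> carrier_mat m m" "p \<subseteq> carrier_vec m"
  shows "act (g * h) p = act g (act h p)"
  using assms unfolding act_def image_image
  by (intro image_cong refl) (auto simp: assoc_mult_mat_vec[of _ m m _ m])

lemma act_one: "p \<subseteq> carrier_vec m \<Longrightarrow> act (1\<^sub>m m) p = p"
  by (force simp: act_def image_iff)

locale hermitian_space =
  fixes n :: nat and H :: "complex mat"
  assumes n_pos: "1 \<le> n" and sig: "hermitian_sig H n"
begin

abbreviation "V \<equiv> carrier_vec (Suc n) :: complex vec set"
abbreviation "M \<equiv> carrier_mat (Suc n) (Suc n) :: complex mat set"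
abbreviation "hf \<equiv> hform H"
abbreviation "U \<equiv> unitary_grp H"

lemma H_carrier [simp]: "H \<in> M"
  using sig by (simp add: hermitian_sig_def)

lemma H_dim [simp]: "dim_row H = Suc n" "dim_col H = Suc n"
  by (rule carrier_matD[OF H_carrier])+

lemma hf_cnj: "hf w z = cnj (hf z w)"
proof -
  have "cnj (H $$ (i, j)) = H $$ (j, i)" if "i < Suc n" "j < Suc n" for i j
  proof -
    have "mat_adjoint H = H" using sig by (simp add: hermitian_sig_def)
    then have "H $$ (j, i) = mat_adjoint H $$ (j, i)" by simp
    then show ?thesis using that by simp
  qed
  then have "cnj (hf z w) = (\<Sum>i<Suc n. \<Sum>j<Suc n. cnj (z $ j) * H $$ (j, i) * w $ i)"
    unfolding hform_def by (auto simp del: sum.lessThan_Suc simp: mult_ac intro!: sum.cong)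
  also have "\<dots> = hf w z" unfolding hform_def H_dim by (rule sum.swap)
  finally show ?thesis by simp
qed

lemma hf_eq_0_commute: "hf z w = 0 \<longleftrightarrow> hf w z = 0"
  by (metis complex_cnj_zero hf_cnj)

lemma frame_obtain:
  obtains P Pi where "P \<in> M" "Pi \<in> M" "P * Pi = 1\<^sub>m (Suc n)" "Pi * P = 1\<^sub>m (Suc n)"
    "mat_adjoint P * H * P = std_diag n"
    "\<forall>z\<in>V. \<forall>w\<in>V. hf z w = hform (std_diag n) (Pi *\<^sub>v z) (Pi *\<^sub>v w)"
proof -
  let ?D = "std_diag n"
  obtain P where P: "P \<in> M" and PHP: "mat_adjoint P * H * P = ?D"
    using sig by (auto simp: hermitian_sig_def)
  have aP: "mat_adjoint P \<in> M" using P by simp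
  \<comment> \<open>Since \<open>mat_adjoint P * H * P\<close> is \<open>?D\<close> and
    \<open>?D\<close> squares to the identity, this matrix is a left inverse of
    \<open>P\<close>.\<close>
  define Pi where "Pi = ?D * (mat_adjoint P * H)"
  have Pi: "Pi \<in> M"
    unfolding Pi_def by (rule mult_carrier_mat[OF std_diag_carrier mult_carrier_mat[OF aP H_carrier]])
  have DD: "?D * ?D = 1\<^sub>m (Suc n)"
  proof (rule mat_eq_if_mult_vec_eq[of _ "Suc n" "Suc n"])
    fix v :: "complex vec" assume v: "v \<in> V"
    have d: "diagonal_mat ?D" by (auto simp: diagonal_mat_def std_diag_def)
    have "?D *\<^sub>v (?D *\<^sub>v v) = v"
    proof (rule eq_vecI)
      fix i assume "i < dim_vec v"
      then have i: "i < Suc n" using v by simp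
      have "?D *\<^sub>v v \<in> V" by (rule mult_mat_vec_carrier[OF std_diag_carrier v])
      then show "(?D *\<^sub>v (?D *\<^sub>v v)) $ i = v $ i"
        using i v by (simp add: diagonal_mat_mult_vec[OF std_diag_carrier d]) (simp add: std_diag_def)
    qed (use v in \<open>simp add: std_diag_def\<close>)
    then show "?D * ?D *\<^sub>v v = 1\<^sub>m (Suc n) *\<^sub>v v"
      using v by (simp add: assoc_mult_mat_vec[OF std_diag_carrier std_diag_carrier])
  qed (simp_all add: mult_carrier_mat[OF std_diag_carrier std_diag_carrier])
  have "Pi * P = ?D * (mat_adjoint P * H * P)"
    unfolding Pi_def by (rule assoc_mult_mat[OF std_diag_carrier mult_carrier_mat[OF aP H_carrier] P])
  then have PiP: "Pi * P = 1\<^sub>m (Suc n)" using PHP DD by simp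
  then have PPi: "P * Pi = 1\<^sub>m (Suc n)" using mat_mult_left_right_inverse[OF Pi P] by simp
  have "hf z w = hform ?D (Pi *\<^sub>v z) (Pi *\<^sub>v w)" if "z \<in> V" "w \<in> V" for z w
  proof -
    have "P *\<^sub>v (Pi *\<^sub>v v) = v" if "v \<in> V" for v
      using that P Pi PPi by (metis assoc_mult_mat_vec one_mult_mat_vec)
    then have "hf z w = hf (P *\<^sub>v (Pi *\<^sub>v z)) (P *\<^sub>v (Pi *\<^sub>v w))" using that by simp
    also have "\<dots> = hform ?D (Pi *\<^sub>v z) (Pi *\<^sub>v w)"
      using hform_adjoint_mult[OF H_carrier P, of "Pi *\<^sub>v z" "Pi *\<^sub>v w"] that Pi PHP by simp
    finally show ?thesis .
  qed
  with P Pi PPi PiP PHP that[of P Pi] show thesis by simp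
qed

text \<open>Some nontrivial combination of \<open>u\<close> and \<open>w\<close> has vanishing last
  coordinate in a diagonal frame. There the form is positive definite, while orthogonality keeps the
  norm of the combination nonpositive; so the combination is zero.\<close>

lemma nonspacelike_orthogonal_dependent:
  assumes u: "u \<in> V" and w: "w \<in> V" and nu: "Re (hf u u) \<le> 0" and nw: "Re (hf w w) \<le> 0" and orth: "hf u w = 0"
  obtains r s where "r \<noteq> 0 \<or> s \<noteq> 0" "r \<cdot>\<^sub>v u = s \<cdot>\<^sub>v w"
proof -
  obtain P Pi where P: "P \<in> M" "Pi \<in> M" "P * Pi = 1\<^sub>m (Suc n)" "Pi * P = 1\<^sub>m (Suc n)"
    "mat_adjoint P * H * P = std_diag n"
    and hf: "\<forall>z\<in>V. \<forall>w\<in>V. hf z w = hform (std_diag n) (Pi *\<^sub>v z) (Pi *\<^sub>v w)"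
    using frame_obtain .
  have zero: "v = 0\<^sub>v (Suc n)" if v: "v \<in> V" and "(Pi *\<^sub>v v) $ n = 0" and "Re (hf v v) \<le> 0" for v
  proof -
    have "hf v v = (\<Sum>i<n. cnj ((Pi *\<^sub>v v) $ i) * (Pi *\<^sub>v v) $ i)"
      using that by (simp add: hf hform_std_diag)
    also have "\<dots> = complex_of_real (\<Sum>i<n. (cmod ((Pi *\<^sub>v v) $ i))\<^sup>2)"
      unfolding of_real_sum by (intro sum.cong refl) (metis complex_norm_square mult.commute)
    finally have "(\<Sum>i<n. (cmod ((Pi *\<^sub>v v) $ i))\<^sup>2) \<le> 0" using that by simp
    then have "(\<Sum>i<n. (cmod ((Pi *\<^sub>v v) $ i))\<^sup>2) = 0"
      by (intro order.antisym sum_nonneg) auto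
    then have "\<forall>i<n. (Pi *\<^sub>v v) $ i = 0" by (simp add: sum_nonneg_eq_0_iff)
    then have "Pi *\<^sub>v v = 0\<^sub>v (Suc n)"
      using that P by (auto intro!: eq_vecI simp: less_Suc_eq)
    then have "P *\<^sub>v (Pi *\<^sub>v v) = 0\<^sub>v (Suc n)" using P by simp
    then show ?thesis using P v by (metis assoc_mult_mat_vec one_mult_mat_vec)
  qed
  \<comment> \<open>The last coordinates are taken crosswise, so that \<open>r u - s w\<close> has
    last coordinate \<open>r s - s r = 0\<close>. If both vanish, \<open>u\<close> itself is already
    zero.\<close>
  define r s where "r = (Pi *\<^sub>v w) $ n" and "s = (Pi *\<^sub>v u) $ n"
  show thesis
  proof (cases "r = 0 \<and> s = 0")
    case True
    then have "u = 0\<^sub>v (Suc n)" using zero[OF u _ nu] by (simp add: s_def)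
    then have "1 \<cdot>\<^sub>v u = 0 \<cdot>\<^sub>v w" using w by auto
    then show ?thesis using that[of 1 0] by simp
  next
    case False
    define y where "y = r \<cdot>\<^sub>v u + (- s) \<cdot>\<^sub>v w"
    have y: "y \<in> V" using u w by (simp add: y_def)
    have "hf w u = 0" using orth hf_eq_0_commute by blast
    then have "hf y y = of_real ((cmod r)\<^sup>2) * hf u u + of_real ((cmod s)\<^sup>2) * hf w w"
      using u w orth unfolding y_def complex_norm_square
      by (simp add: hform_sesquilinear algebra_simps)
    then have "Re (hf y y) = (cmod r)\<^sup>2 * Re (hf u u) + (cmod s)\<^sup>2 * Re (hf w w)"
      by simp
    then have "Re (hf y y) \<le> 0" using nu nw
      by (simp add: add_nonpos_nonpos mult_nonneg_nonpos)
    moreover have "Pi *\<^sub>v y = r \<cdot>\<^sub>v (Pi *\<^sub>v u) + (- s) \<cdot>\<^sub>v (Pi *\<^sub>v w)"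
      using P u w unfolding y_def
      by (simp add: mult_add_distrib_mat_vec[of _ "Suc n" "Suc n"] mult_mat_vec[of _ "Suc n" "Suc n"])
    then have "(Pi *\<^sub>v y) $ n = 0" using P u w by (simp add: r_def s_def)
    ultimately have y0: "y = 0\<^sub>v (Suc n)" using zero y by blast
    have "r \<cdot>\<^sub>v u = s \<cdot>\<^sub>v w"
    proof (rule eq_vecI)
      fix i assume "i < dim_vec (s \<cdot>\<^sub>v w)"
      then have i: "i < Suc n" using w by simp
      have "y $ i = 0" using y0 i by simp
      then show "(r \<cdot>\<^sub>v u) $ i = (s \<cdot>\<^sub>v w) $ i" using u w i by (simp add: y_def)
    qed (use u w in simp)
    then show ?thesis using that False by blast
  qed
qed

lemma null_orthogonal_collinear:
  assumes "u \<in> V" "u \<noteq> 0\<^sub>v (Suc n)" "hf u u = 0" "w \<in> V" "Re (hf w w) \<le> 0" "hf u w = 0"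
  obtains c where "w = c \<cdot>\<^sub>v u"
proof -
  obtain r s where rs: "r \<noteq> 0 \<or> s \<noteq> 0" "r \<cdot>\<^sub>v u = s \<cdot>\<^sub>v w"
    using nonspacelike_orthogonal_dependent[of u w] assms by auto
  have "s \<noteq> 0"
  proof
    assume "s = 0"
    then have "r \<cdot>\<^sub>v u = 0\<^sub>v (Suc n)" using rs assms by auto
    then show False using rs \<open>s = 0\<close> assms smult_vec_eq_0 by blast
  qed
  then have "w = (1 / s) \<cdot>\<^sub>v (s \<cdot>\<^sub>v w)" by (simp add: smult_smult_assoc)
  also have "\<dots> = (r / s) \<cdot>\<^sub>v u" by (simp add: rs(2)[symmetric] smult_smult_assoc)
  finally show thesis by (rule that)
qed

lemma null_negative_not_orthogonal:
  assumes "u \<in> V" "u \<noteq> 0\<^sub>v (Suc n)" "hf u u = 0" "v \<in> V" "Re (hf v v) < 0"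
  shows "hf u v \<noteq> 0"
proof
  assume "hf u v = 0"
  with assms obtain c where "v = c \<cdot>\<^sub>v u" using null_orthogonal_collinear[of u v] by auto
  then have "hf v v = 0" using assms by (simp add: hform_sesquilinear)
  then show False using assms by simp
qed

section \<open>The unitary group and its action on the closure of hyperbolic space\<close>

lemma unitary_carrier: "g \<in> U \<Longrightarrow> g \<in> M"
  by (simp add: unitary_grp_def)

lemma unitary_vec_carrier [simp]: "g \<in> U \<Longrightarrow> v \<in> V \<Longrightarrow> g *\<^sub>v v \<in> V"
  using mult_mat_vec_carrier unitary_carrier by blast

lemma unitary_hf: "g \<in> U \<Longrightarrow> z \<in> V \<Longrightarrow> w \<in> V \<Longrightarrow> hf (g *\<^sub>v z) (g *\<^sub>v w) = hf z w"
  using hform_adjoint_mult[OF H_carrier, of g "Suc n" z w] by (simp add: unitary_grp_def)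

lemma unitaryI:
  assumes g: "g \<in> M" and "\<And>z w. z \<in> V \<Longrightarrow> w \<in> V \<Longrightarrow> hf (g *\<^sub>v z) (g *\<^sub>v w) = hf z w"
  shows "g \<in> U"
proof -
  have "mat_adjoint g * H * g \<in> M"
    by (rule mult_carrier_mat[OF mult_carrier_mat[OF mat_adjoint_carrier[OF g] H_carrier] g])
  then have "mat_adjoint g * H * g = H"
    by (rule hform_eqI[of _ "Suc n"]) (use assms in \<open>simp_all add: hform_adjoint_mult[OF H_carrier g]\<close>)
  then show ?thesis using g by (simp add: unitary_grp_def)
qed

text \<open>A kernel vector of \<open>K\<close> is orthogonal to every vector for \<open>H\<close>.
  The diagonal form is nondegenerate, as pairing with unit vectors recovers each coordinate up to
  sign, so the kernel is trivial.\<close>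

lemma form_preserving_inverse:
  assumes K: "K \<in> M" and A: "A \<in> M" and eq: "mat_adjoint K * A * K = H"
  obtains Ki where "Ki \<in> M" "Ki * K = 1\<^sub>m (Suc n)" "K * Ki = 1\<^sub>m (Suc n)"
proof -
  obtain P Pi where P: "P \<in> M" "Pi \<in> M" "P * Pi = 1\<^sub>m (Suc n)" "Pi * P = 1\<^sub>m (Suc n)"
    "mat_adjoint P * H * P = std_diag n"
    "\<forall>z\<in>V. \<forall>w\<in>V. hf z w = hform (std_diag n) (Pi *\<^sub>v z) (Pi *\<^sub>v w)"
    using frame_obtain .
  have "K *\<^sub>v v = 0\<^sub>v (Suc n) \<Longrightarrow> v \<in> V \<Longrightarrow> v = 0\<^sub>v (Suc n)" for v
  proof -
    assume v: "K *\<^sub>v v = 0\<^sub>v (Suc n)" "v \<in> V"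
    have "hf v w = 0" if "w \<in> V" for w
      using hform_adjoint_mult[OF A K v(2) that] eq v(1) carrier_matD(1)[OF A] hform_zero_left[of A] by metis
    have 0: "hform (std_diag n) (Pi *\<^sub>v v) w = 0" if "w \<in> V" for w
    proof -
      have Pv: "Pi *\<^sub>v v \<in> V" using P(2) v(2) by simp
      have "P *\<^sub>v (Pi *\<^sub>v v) = v" using P(1-3) v(2) by (metis assoc_mult_mat_vec one_mult_mat_vec)
      then have "hform (std_diag n) (Pi *\<^sub>v v) w = hf v (P *\<^sub>v w)"
        using hform_adjoint_mult[OF H_carrier P(1) Pv that] by (simp only: P(5))
      also have "\<dots> = 0" using \<open>\<And>w. w \<in> V \<Longrightarrow> hf v w = 0\<close> P(1) that by simp
      finally show ?thesis .
    qed
    have "Pi *\<^sub>v v = 0\<^sub>v (Suc n)"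
    proof (rule eq_vecI)
      fix i assume "i < dim_vec (0\<^sub>v (Suc n))"
      then have i: "i < Suc n" by simp
      have "(\<Sum>j<n. cnj (unit_vec (Suc n) i $ j) * (Pi *\<^sub>v v) $ j) = (if i < n then (Pi *\<^sub>v v) $ i else 0)"
      proof -
        have "(\<Sum>j<n. cnj (unit_vec (Suc n) i $ j) * (Pi *\<^sub>v v) $ j) = (\<Sum>j<n. if j = i then (Pi *\<^sub>v v) $ i else 0)"
          using i by (intro sum.cong) auto
        then show ?thesis by simp
      qed
      then show "(Pi *\<^sub>v v) $ i = 0\<^sub>v (Suc n) $ i"
        using 0[of "unit_vec (Suc n) i"] i by (auto simp: hform_std_diag less_Suc_eq split: if_splits)
    qed (use P v in auto)
    then have "P *\<^sub>v (Pi *\<^sub>v v) = 0\<^sub>v (Suc n)" using P by simp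
    then show "v = 0\<^sub>v (Suc n)" using P v by (metis assoc_mult_mat_vec one_mult_mat_vec)
  qed
  then have "det K \<noteq> 0" using det_0_iff_vec_prod_zero[OF K] by blast
  from det_non_zero_imp_unit[OF K this, of "()"] obtain Ki where "Ki \<in> M" "Ki * K = 1\<^sub>m (Suc n)" "K * Ki = 1\<^sub>m (Suc n)"
    by (auto simp: Units_def ring_mat_def)
  then show thesis by (rule that)
qed

lemma unitary_inverse:
  assumes g: "g \<in> U"
  obtains g' where "g' \<in> U" "g' * g = 1\<^sub>m (Suc n)" "g * g' = 1\<^sub>m (Suc n)"
proof -
  obtain g' where g': "g' \<in> M" "g' * g = 1\<^sub>m (Suc n)" "g * g' = 1\<^sub>m (Suc n)"
    using form_preserving_inverse[OF unitary_carrier[OF g] H_carrier] g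
    by (auto simp: unitary_grp_def)
  have "g *\<^sub>v (g' *\<^sub>v z) = z" if "z \<in> V" for z
    using that g' unitary_carrier[OF g] by (metis assoc_mult_mat_vec one_mult_mat_vec)
  then have "g' \<in> U" using unitary_hf[OF g] g'
    by (intro unitaryI) (auto, metis mult_mat_vec_carrier)
  then show thesis using that g' by blast
qed

lemma unitary_inj:
  assumes "g \<in> U" "v \<in> V" "w \<in> V" "g *\<^sub>v v = g *\<^sub>v w"
  shows "v = w"
proof -
  obtain g' where g': "g' \<in> U" "g' * g = 1\<^sub>m (Suc n)" using unitary_inverse assms by metis
  note c = unitary_carrier[OF g'(1)] unitary_carrier[OF assms(1)]
  have "g' *\<^sub>v (g *\<^sub>v z) = z" if "z \<in> V" for z
    using assoc_mult_mat_vec[OF c that] g'(2) that by simp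
  then show ?thesis using assms(2-4) by metis
qed

lemma unitary_eigenvalue_nonzero:
  assumes "g \<in> U" "v \<in> V" "v \<noteq> 0\<^sub>v (Suc n)" "g *\<^sub>v v = c \<cdot>\<^sub>v v"
  shows "c \<noteq> 0"
proof
  assume "c = 0"
  then have "g *\<^sub>v v = g *\<^sub>v 0\<^sub>v (Suc n)" using assms unitary_carrier[OF assms(1)] by auto
  then show False using unitary_inj[OF assms(1,2)] assms(3) by simp
qed

text \<open>Points are full complex lines including 0. An eigenline is mapped onto itself, not
  merely into itself, because eigenvalues of unitary elements are nonzero.\<close>

lemma act_eq_proj_pt_iff:
  assumes g: "g \<in> U" and v: "v \<in> V" "v \<noteq> 0\<^sub>v (Suc n)"
  shows "act g (proj_pt v) = proj_pt v \<longleftrightarrow> (\<exists>c. g *\<^sub>v v = c \<cdot>\<^sub>v v)"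
proof -
  have eq: "act g (proj_pt v) = proj_pt (g *\<^sub>v v)"
    using act_proj_pt[OF unitary_carrier[OF g] v(1)] .
  show ?thesis
  proof
    assume "act g (proj_pt v) = proj_pt v"
    then have "g *\<^sub>v v \<in> proj_pt v" using eq proj_pt_self by blast
    then show "\<exists>c. g *\<^sub>v v = c \<cdot>\<^sub>v v" by (auto simp: proj_pt_def)
  next
    assume "\<exists>c. g *\<^sub>v v = c \<cdot>\<^sub>v v"
    then obtain c where c: "g *\<^sub>v v = c \<cdot>\<^sub>v v" by blast
    then show "act g (proj_pt v) = proj_pt v"
      using eq unitary_eigenvalue_nonzero[OF g v c] by (simp add: proj_pt_smult)
  qed
qed

lemma hyp_spaceE:
  assumes "p \<in> hyp_space H"
  obtains v where "p = proj_pt v" "v \<in> V" "v \<noteq> 0\<^sub>v (Suc n)" "Re (hf v v) < 0"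
proof -
  obtain v where v: "p = proj_pt v" "v \<in> V" "Re (hf v v) < 0"
    using assms by (auto simp: hyp_space_def neg_vecs_def)
  moreover have "v \<noteq> 0\<^sub>v (Suc n)" using v(3) hform_zero_left[of H v] by auto
  ultimately show thesis using that by blast
qed

lemma bdryE:
  assumes "p \<in> bdry H"
  obtains v where "p = proj_pt v" "v \<in> V" "v \<noteq> 0\<^sub>v (Suc n)" "hf v v = 0"
  using assms by (auto simp: bdry_def null_vecs_def)

lemma cl_spaceE:
  assumes "p \<in> cl_space H"
  obtains v where "p = proj_pt v" "v \<in> V" "v \<noteq> 0\<^sub>v (Suc n)"
  using assms hyp_spaceE bdryE by (metis UnE cl_space_def)

lemma cl_space_subset: "p \<in> cl_space H \<Longrightarrow> p \<subseteq> V"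
  by (elim cl_spaceE) (auto simp: proj_pt_def)

lemma act_hyp_space: "g \<in> U \<Longrightarrow> p \<in> hyp_space H \<Longrightarrow> act g p \<in> hyp_space H"
  by (auto simp: hyp_space_def neg_vecs_def act_proj_pt[OF unitary_carrier] unitary_hf unitary_carrier
      intro!: imageI)

lemma act_bdry:
  assumes "g \<in> U" "p \<in> bdry H"
  shows "act g p \<in> bdry H"
proof -
  obtain v where v: "p = proj_pt v" "v \<in> V" "v \<noteq> 0\<^sub>v (Suc n)" "hf v v = 0"
    using assms(2) by (rule bdryE)
  have "g *\<^sub>v v \<noteq> 0\<^sub>v (Suc n)"
    using unitary_inj[OF assms(1) v(2), of "0\<^sub>v (Suc n)"] v unitary_carrier[OF assms(1)] by auto
  then show ?thesis using assms v
    by (auto simp: bdry_def null_vecs_def act_proj_pt[OF unitary_carrier] unitary_hf unitary_carrier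
      intro!: imageI)
qed

lemma act_cl_space: "g \<in> U \<Longrightarrow> p \<in> cl_space H \<Longrightarrow> act g p \<in> cl_space H"
  using act_bdry act_hyp_space by (auto simp: cl_space_def)

lemma act_inverse:
  assumes "g \<in> U" "g' \<in> U" "g * g' = 1\<^sub>m (Suc n)" "p \<subseteq> V"
  shows "act g (act g' p) = p"
  using assms act_mult[OF unitary_carrier unitary_carrier] act_one by metis

lemma act_commute_fixed:
  assumes "g \<in> U" "h \<in> U" "g * h = h * g" "p \<subseteq> V" "act h p = p"
  shows "act h (act g p) = act g p"
  using assms act_mult[OF unitary_carrier unitary_carrier] by metis

text \<open>Commutation yields one inclusion; the inverse of \<open>g\<close> also commutes with
  \<open>h\<close>, and the inclusion for it gives the other one.\<close>

lemma act_image_fix_pts: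
  assumes g: "g \<in> U" and h: "h \<in> U" and comm: "g * h = h * g"
  shows "act g ` fix_pts H h = fix_pts H h"
proof
  have sub: "act g ` fix_pts H h \<subseteq> fix_pts H h" if "g \<in> U" "g * h = h * g" for g
    using that h act_commute_fixed act_cl_space cl_space_subset by (auto simp: fix_pts_def)
  show "act g ` fix_pts H h \<subseteq> fix_pts H h" using sub g comm by blast
  obtain g' where g': "g' \<in> U" "g' * g = 1\<^sub>m (Suc n)" "g * g' = 1\<^sub>m (Suc n)"
    using unitary_inverse[OF g] .
  have "g' * h = h * g'"
    by (rule commute_inverse_mat[OF unitary_carrier[OF g] unitary_carrier[OF g'(1)] unitary_carrier[OF h] comm g'(2,3)])
  then have "act g' p \<in> fix_pts H h" if "p \<in> fix_pts H h" for p using sub[OF g'(1)] that by blast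
  moreover have "act g (act g' p) = p" if "p \<in> fix_pts H h" for p
    using act_inverse[OF g g'(1,3)] that cl_space_subset by (auto simp: fix_pts_def)
  ultimately show "fix_pts H h \<subseteq> act g ` fix_pts H h" by (metis imageI subsetI)
qed

lemma preserves_eigenspaceI:
  assumes g: "g \<in> U" and h: "h \<in> U" and comm: "g * h = h * g"
  shows "preserves g (eigenspace h l)"
proof -
  have sub: "g *\<^sub>v v \<in> eigenspace h l" if "g \<in> U" "g * h = h * g" "v \<in> eigenspace h l" for g v
  proof -
    note c = unitary_carrier[OF that(1)] unitary_carrier[OF h]
    have v: "v \<in> V" "h *\<^sub>v v = l \<cdot>\<^sub>v v" using that(3) c(2) by (auto simp: eigenspace_def)
    have "h *\<^sub>v (g *\<^sub>v v) = g *\<^sub>v (h *\<^sub>v v)" using that(2) c v(1) by (metis assoc_mult_mat_vec)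
    then show ?thesis using c v by (simp add: eigenspace_def mult_mat_vec[of _ "Suc n" "Suc n"])
  qed
  obtain g' where g': "g' \<in> U" "g' * g = 1\<^sub>m (Suc n)" "g * g' = 1\<^sub>m (Suc n)"
    using unitary_inverse[OF g] .
  have "g' * h = h * g'"
    by (rule commute_inverse_mat[OF unitary_carrier[OF g] unitary_carrier[OF g'(1)] unitary_carrier[OF h] comm g'(2,3)])
  then have "g' *\<^sub>v v \<in> eigenspace h l" if "v \<in> eigenspace h l" for v using sub[OF g'(1)] that by blast
  moreover have "g *\<^sub>v (g' *\<^sub>v v) = v" if "v \<in> eigenspace h l" for v
  proof -
    have "v \<in> V" using that unitary_carrier[OF h] by (auto simp: eigenspace_def)
    then show ?thesis using g' g unitary_carrier by (metis assoc_mult_mat_vec one_mult_mat_vec)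
  qed
  ultimately have "eigenspace h l \<subseteq> act g (eigenspace h l)" unfolding act_def by (metis imageI subsetI)
  then show ?thesis using sub[OF g comm] by (auto simp: preserves_def act_def)
qed

text \<open>The common core of statements (1) and (2): the eigenspaces span, so it suffices to
  compare \<open>S * T\<close> and \<open>T * S\<close> on them.\<close>

lemma semisimple_commute_iff_preserves:
  assumes T: "T \<in> U" "semisimple T" and S: "S \<in> U"
  shows "S * T = T * S \<longleftrightarrow> (\<forall>l. preserves S (eigenspace T l))"
proof
  assume pres: "\<forall>l. preserves S (eigenspace T l)"
  show "S * T = T * S"
  proof (rule semisimple_commuteI[OF unitary_carrier T(2) unitary_carrier])
    fix v l assume "v \<in> V" "T *\<^sub>v v = l \<cdot>\<^sub>v v"
    then have "v \<in> eigenspace T l" using unitary_carrier[OF T(1)] by (simp add: eigenspace_def)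
    then have "S *\<^sub>v v \<in> eigenspace T l" using pres by (auto simp: preserves_def act_def)
    then show "T *\<^sub>v (S *\<^sub>v v) = l \<cdot>\<^sub>v (S *\<^sub>v v)" by (simp add: eigenspace_def)
  qed (use T S in auto)
qed (use preserves_eigenspaceI T S in blast)

end


section \<open>Jordan decomposition, elliptic and hyperbolic isometries\<close>

context hermitian_space
begin

text \<open>Double induction on the two heights. Expanding \<open>hf (g z) (g w)\<close> with
  \<open>g z = l z + z'\<close> and \<open>g w = \<mu> w + w'\<close>, every term containing
  \<open>z'\<close> or \<open>w'\<close> has smaller height in one argument and vanishes; what
  remains is \<open>(1 - l * cnj \<mu>) * hf z w = 0\<close>.\<close>

lemma gev_orthogonal:
  assumes g: "g \<in> U" and ne: "l * cnj \<mu> \<noteq> 1"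
  shows "gev g l k z \<Longrightarrow> gev g \<mu> j w \<Longrightarrow> hf z w = 0"
proof (induction k arbitrary: j z w)
  case 0
  then show ?case using carrier_matD(1)[OF unitary_carrier[OF g]] hform_zero_left[of H] by simp
next
  case (Suc k)
  note dim = carrier_matD(1)[OF unitary_carrier[OF g]]
  obtain z' where z: "z \<in> V" and z': "gev g l k z'" "g *\<^sub>v z = l \<cdot>\<^sub>v z + z'"
    using Suc.prems(1) dim by auto
  have cz: "z' \<in> V" using gev_carrier[OF z'(1)] dim by simp
  show ?case using Suc.prems(2)
  proof (induction j arbitrary: w)
    case 0
    then show ?case using dim hform_zero_right[of H] by simp
  next
    case (Suc j)
    obtain w' where w: "w \<in> V" and w': "gev g \<mu> j w'" "g *\<^sub>v w = \<mu> \<cdot>\<^sub>v w + w'"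
      using Suc.prems dim by auto
    have cw: "w' \<in> V" using gev_carrier[OF w'(1)] dim by simp
    have "hf z w = hf (g *\<^sub>v z) (g *\<^sub>v w)" using unitary_hf[OF g z w] by simp
    also have "\<dots> = l * cnj \<mu> * hf z w + l * hf z w' + cnj \<mu> * hf z' w + hf z' w'"
      using z cz w cw by (simp add: z'(2) w'(2) hform_sesquilinear algebra_simps)
    also have "hf z w' = 0" by (rule Suc.IH[OF w'(1)])
    also have "hf z' w = 0" by (rule \<open>\<And>j z w. gev g l k z \<Longrightarrow> gev g \<mu> j w \<Longrightarrow> hf z w = 0\<close>[OF z'(1) Suc.prems])
    also have "hf z' w' = 0" by (rule \<open>\<And>j z w. gev g l k z \<Longrightarrow> gev g \<mu> j w \<Longrightarrow> hf z w = 0\<close>[OF z'(1) w'(1)])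
    finally have "(1 - l * cnj \<mu>) * hf z w = 0" by (simp add: algebra_simps)
    then show ?case using ne by simp
  qed
qed

lemma jordan_decompD:
  assumes "jordan_decomp H g a b"
  shows "a \<in> U" "b \<in> U" "semisimple a" "unipotent b" "g = a * b" "a * b = b * a"
  using assms by (auto simp: jordan_decomp_def)

text \<open>That \<open>a\<close> preserves the form is checked on pairs of eigenvectors: either
  \<open>l * cnj \<mu> = 1\<close> and the scalars cancel, or both sides vanish by orthogonality of
  generalised eigenspaces. Spanning extends this to all vectors, one argument at a time. Then
  \<open>b\<close> is an isometry because \<open>a\<close> and \<open>g\<close> are.\<close>

lemma jordan_decomp_exists:
  assumes g: "g \<in> U"
  obtains a b where "jordan_decomp H g a b"
proof -
  have "v = 0\<^sub>v (Suc n)" if "v \<in> V" "g *\<^sub>v v = 0\<^sub>v (Suc n)" for v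
    using unitary_inj[OF g that(1), of "0\<^sub>v (Suc n)"] that(2) mult_mat_zero_vec[OF unitary_carrier[OF g]] by simp
  then obtain a b where a: "a \<in> M" "semisimple a" and b: "b \<in> M" "unipotent b" and gab: "g = a * b" "a * b = b * a"
    using multiplicative_jordan_decomposition[OF unitary_carrier[OF g]] by blast
  have eig: "hf (a *\<^sub>v z) (a *\<^sub>v w) = hf z w"
    if "z \<in> V" "a *\<^sub>v z = l \<cdot>\<^sub>v z" "w \<in> V" "a *\<^sub>v w = \<mu> \<cdot>\<^sub>v w" for z w l \<mu>
  proof (cases "l * cnj \<mu> = 1")
    case True
    have "hf (a *\<^sub>v z) (a *\<^sub>v w) = l * cnj \<mu> * hf z w" using that by (simp add: hform_sesquilinear)
    then show ?thesis using True by simp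
  next
    case False
    note gev = semisimple_part_gev[OF a b gab]
    show ?thesis using gev_orthogonal[OF g False gev[OF that(1,2)] gev[OF that(3,4)]] that
      by (simp add: hform_sesquilinear)
  qed
  have "hf (a *\<^sub>v z) (a *\<^sub>v w) = hf z w" if z: "z \<in> V" "a *\<^sub>v z = l \<cdot>\<^sub>v z" and w: "w \<in> V" for z w l
    using a w
  proof (induction rule: semisimple_induct)
    case (eigenvector v mu)
    then show ?case using eig[OF z] by blast
  next
    case (add v w)
    then show ?case using a(1) z
      by (simp add: mult_add_distrib_mat_vec[of _ "Suc n" "Suc n"] hform_sesquilinear)
  qed
  note eig' = this
  have aU: "a \<in> U"
  proof (rule unitaryI[OF a(1)])
    fix z w :: "complex vec" assume z: "z \<in> V" and w: "w \<in> V"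
    from a z show "hf (a *\<^sub>v z) (a *\<^sub>v w) = hf z w"
    proof (induction rule: semisimple_induct)
      case (eigenvector v l)
      then show ?case using eig' w by blast
    next
      case (add v v')
      then show ?case using a(1) w
        by (simp add: mult_add_distrib_mat_vec[of _ "Suc n" "Suc n"] hform_sesquilinear)
    qed
  qed
  have "b \<in> U"
  proof (rule unitaryI[OF b(1)])
    fix z w :: "complex vec" assume z: "z \<in> V" and w: "w \<in> V"
    have bc: "b *\<^sub>v z \<in> V" "b *\<^sub>v w \<in> V" using b z w by auto
    have "g *\<^sub>v v = a *\<^sub>v (b *\<^sub>v v)" if "v \<in> V" for v
      using assoc_mult_mat_vec[OF a(1) b(1) that] gab(1) by simp
    then show "hf (b *\<^sub>v z) (b *\<^sub>v w) = hf z w"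
      using unitary_hf[OF aU bc] unitary_hf[OF g z w] z w by simp
  qed
  with aU a b gab have "jordan_decomp H g a b" by (simp add: jordan_decomp_def)
  then show thesis by (rule that)
qed

lemma jordan_decomp_commute:
  assumes jd: "jordan_decomp H g a b" and S: "S \<in> M" and comm: "S * g = g * S"
  shows "S * a = a * S" "S * b = b * S"
proof -
  note d = jordan_decompD[OF jd]
  note c = unitary_carrier[OF d(1)] unitary_carrier[OF d(2)]
  show Sa: "S * a = a * S"
    by (rule semisimple_part_commute[OF c(1) d(3) c(2) d(4-6) S comm])
  show "S * b = b * S"
  proof (rule mat_eq_if_mult_vec_eq[of _ "Suc n" "Suc n"])
    fix v :: "complex vec" assume v: "v \<in> V"
    have bv: "b *\<^sub>v v \<in> V" and Sv: "S *\<^sub>v v \<in> V" using c S v by auto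
    have "a *\<^sub>v (S *\<^sub>v (b *\<^sub>v v)) = S *\<^sub>v (a *\<^sub>v (b *\<^sub>v v))"
      using Sa assoc_mult_mat_vec[OF S c(1) bv] assoc_mult_mat_vec[OF c(1) S bv] by simp
    also have "\<dots> = (S * g) *\<^sub>v v"
      using d(5) assoc_mult_mat_vec[OF c v] assoc_mult_mat_vec[OF S mult_carrier_mat[OF c] v] by simp
    also have "\<dots> = a *\<^sub>v (b *\<^sub>v (S *\<^sub>v v))"
      unfolding comm using d(5) assoc_mult_mat_vec[OF c Sv] assoc_mult_mat_vec[OF mult_carrier_mat[OF c] S v] by simp
    \<comment> \<open>Cancelling the injective \<open>a\<close> from
      \<open>a (S b v) = a (b S v)\<close> moves the commutation from \<open>g\<close> to its
      unipotent factor.\<close>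
    finally have "S *\<^sub>v (b *\<^sub>v v) = b *\<^sub>v (S *\<^sub>v v)"
      using unitary_inj[OF d(1)] c S bv Sv by simp
    then show "S * b *\<^sub>v v = b * S *\<^sub>v v"
      using assoc_mult_mat_vec[OF S c(2) v] assoc_mult_mat_vec[OF c(2) S v] by simp
  qed (use c S in auto)
qed

text \<open>A true eigenvector is a generalised one of height 1, so \<open>a\<close> acts on it by
  the same scalar; then \<open>a (b v) = a v\<close> and \<open>a\<close> cancels.\<close>

lemma jordan_decomp_eigenvector:
  assumes jd: "jordan_decomp H g a b" and v: "v \<in> V" and ev: "g *\<^sub>v v = l \<cdot>\<^sub>v v"
  shows "a *\<^sub>v v = l \<cdot>\<^sub>v v" "b *\<^sub>v v = v"
proof -
  note d = jordan_decompD[OF jd]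
  note c = unitary_carrier[OF d(1)] unitary_carrier[OF d(2)]
  have "gev g l (Suc 0) v" using v ev c d(5) by simp
  then show av: "a *\<^sub>v v = l \<cdot>\<^sub>v v"
    by (rule gev_semisimple_part[OF c(1) d(3) c(2) d(4-6)])
  have "a *\<^sub>v (b *\<^sub>v v) = a *\<^sub>v v"
    using assoc_mult_mat_vec[OF c v] d(5) ev av by simp
  then show "b *\<^sub>v v = v" using unitary_inj[OF d(1)] c v by simp
qed

lemma unipotent_fixing_negative:
  assumes b: "b \<in> U" "unipotent b" and v: "v \<in> V" "Re (hf v v) < 0" "b *\<^sub>v v = v"
  shows "b = 1\<^sub>m (Suc n)"
proof -
  note c = unitary_carrier[OF b(1)]
  have "gev b 1 k y \<Longrightarrow> b *\<^sub>v y = y" for k y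
  proof (induction k arbitrary: y)
    case 0
    then show ?case using c by simp
  next
    case (Suc k)
    then obtain y' where y: "y \<in> V" and y': "gev b 1 k y'" "b *\<^sub>v y = y + y'"
      using c by auto
    have cy: "y' \<in> V" using gev_carrier[OF y'(1)] c by simp
    have by': "b *\<^sub>v y' = y'" by (rule Suc.IH[OF y'(1)])
    \<comment> \<open>Comparing \<open>hf (b y) (b x)\<close> with \<open>hf y x\<close> leaves
      exactly \<open>hf y' x = 0\<close>. Taking \<open>x = y'\<close> shows that \<open>y'\<close>
      is null, taking \<open>x = v\<close> that it is orthogonal to a negative vector.\<close>
    have orth: "hf y' x = 0" if "x \<in> V" "b *\<^sub>v x = x" for x
      using unitary_hf[OF b(1) y that(1)] that y cy by (simp add: y'(2) hform_sesquilinear)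
    have "y' = 0\<^sub>v (Suc n)"
      using null_negative_not_orthogonal[OF cy _ orth[OF cy by'] v(1,2)] orth[OF v(1,3)] by blast
    then show ?case using y y' by simp
  qed
  then have "b *\<^sub>v y = y" if "y \<in> V" for y using unipotent_gev[OF c b(2) that] by blast
  then show ?thesis using c by (intro mat_eq_if_mult_vec_eq[of _ "Suc n" "Suc n"]) auto
qed

lemma jordan_decomp_fixing_negative:
  assumes jd: "jordan_decomp H g a b" and v: "v \<in> V" "Re (hf v v) < 0" "b *\<^sub>v v = v"
  shows "semisimple g"
proof -
  note d = jordan_decompD[OF jd]
  have "b = 1\<^sub>m (Suc n)" by (rule unipotent_fixing_negative[OF d(2,4) v])
  then show ?thesis using d(3,5) right_mult_one_mat[OF unitary_carrier[OF d(1)]] by simp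
qed

section \<open>Elliptic and hyperbolic isometries are semisimple\<close>

lemma ellipticI:
  assumes "g \<in> U" "v \<in> V" "Re (hf v v) < 0" "g *\<^sub>v v = l \<cdot>\<^sub>v v"
  shows "elliptic H g"
proof -
  have "proj_pt v \<in> hyp_space H" using assms by (auto simp: hyp_space_def neg_vecs_def)
  moreover have "v \<noteq> 0\<^sub>v (Suc n)" using assms(3) hform_zero_left[of H v] by auto
  ultimately show ?thesis using act_eq_proj_pt_iff[of g v] assms by (auto simp: elliptic_def)
qed

lemma ellipticE:
  assumes "elliptic H g"
  obtains v l where "v \<in> V" "v \<noteq> 0\<^sub>v (Suc n)" "Re (hf v v) < 0" "g *\<^sub>v v = l \<cdot>\<^sub>v v"
proof -
  obtain p where p: "p \<in> hyp_space H" "act g p = p" and g: "g \<in> U" using assms by (auto simp: elliptic_def)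
  obtain v where v: "p = proj_pt v" "v \<in> V" "v \<noteq> 0\<^sub>v (Suc n)" "Re (hf v v) < 0"
    using p(1) by (rule hyp_spaceE)
  then show thesis using that p(2) act_eq_proj_pt_iff[OF g v(2,3)] by auto
qed

lemma elliptic_semisimple:
  assumes "elliptic H g"
  shows "semisimple g"
proof -
  obtain v l where v: "v \<in> V" "Re (hf v v) < 0" "g *\<^sub>v v = l \<cdot>\<^sub>v v" using ellipticE[OF assms] by metis
  obtain a b where jd: "jordan_decomp H g a b" using jordan_decomp_exists assms by (auto simp: elliptic_def)
  show ?thesis using jordan_decomp_fixing_negative[OF jd v(1,2)] jordan_decomp_eigenvector[OF jd v(1,3)] by blast
qed

lemma negative_combination:
  assumes "u \<in> V" "w \<in> V" "hf u u = 0" "hf w w = 0" "hf u w \<noteq> 0"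
  obtains c where "Re (hf (w + c \<cdot>\<^sub>v u) (w + c \<cdot>\<^sub>v u)) < 0"
proof -
  \<comment> \<open>For null \<open>u\<close> and \<open>w\<close> the norm of
    \<open>w + c u\<close> is \<open>2 Re (c * hf u w)\<close>; this choice of \<open>c\<close>
    makes it \<open>-2 |hf u w|^2\<close>.\<close>
  let ?c = "- cnj (hf u w)"
  have "hf (w + ?c \<cdot>\<^sub>v u) (w + ?c \<cdot>\<^sub>v u) = - 2 * (hf u w * cnj (hf u w))"
    using assms hf_cnj[of w u] by (simp add: hform_sesquilinear)
  also have "\<dots> = of_real (- 2 * (cmod (hf u w))\<^sup>2)"
    unfolding complex_norm_square[symmetric] by simp
  finally have "Re (hf (w + ?c \<cdot>\<^sub>v u) (w + ?c \<cdot>\<^sub>v u)) = - 2 * (cmod (hf u w))\<^sup>2"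
    by (metis Re_complex_of_real)
  also have "\<dots> < 0" using assms(5) by simp
  finally show thesis by (rule that)
qed

lemma null_not_orthogonal:
  assumes "u \<in> V" "u \<noteq> 0\<^sub>v (Suc n)" "hf u u = 0" "w \<in> V" "w \<noteq> 0\<^sub>v (Suc n)" "hf w w = 0"
    and ne: "proj_pt u \<noteq> proj_pt w"
  shows "hf u w \<noteq> 0"
proof
  assume "hf u w = 0"
  with assms obtain c where c: "w = c \<cdot>\<^sub>v u" using null_orthogonal_collinear[of u w] by auto
  then have "c \<noteq> 0" using assms by auto
  then show False using ne c proj_pt_smult by blast
qed

text \<open>Two distinct null lines span a plane containing negative vectors, and a common
  eigenvalue makes every vector of that plane an eigenvector.\<close>

lemma elliptic_if_null_eigenspace:
  assumes g: "g \<in> U" and u: "u \<in> V" "u \<noteq> 0\<^sub>v (Suc n)" "hf u u = 0" and w: "w \<in> V" "w \<noteq> 0\<^sub>v (Suc n)" "hf w w = 0"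
    and ne: "proj_pt u \<noteq> proj_pt w" and ev: "g *\<^sub>v u = l \<cdot>\<^sub>v u" "g *\<^sub>v w = l \<cdot>\<^sub>v w"
  shows "elliptic H g"
proof -
  obtain c where c: "Re (hf (w + c \<cdot>\<^sub>v u) (w + c \<cdot>\<^sub>v u)) < 0"
    using negative_combination[OF u(1) w(1) u(3) w(3) null_not_orthogonal[OF u w ne]] .
  have "g *\<^sub>v (w + c \<cdot>\<^sub>v u) = l \<cdot>\<^sub>v (w + c \<cdot>\<^sub>v u)"
    using unitary_carrier[OF g] u w ev
    by (simp add: mult_add_distrib_mat_vec[of _ "Suc n" "Suc n"] mult_mat_vec[of _ "Suc n" "Suc n"]
        smult_add_distrib_vec[of _ "Suc n"] smult_smult_assoc mult.commute)
  then show ?thesis using ellipticI[OF g _ c] u w by simp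
qed

lemma hyperbolic_obtain:
  assumes T: "hyperbolic H T"
  obtains u w a b where "u \<in> V" "u \<noteq> 0\<^sub>v (Suc n)" "hf u u = 0" "w \<in> V" "w \<noteq> 0\<^sub>v (Suc n)" "hf w w = 0"
    "proj_pt u \<noteq> proj_pt w" "T *\<^sub>v u = a \<cdot>\<^sub>v u" "T *\<^sub>v w = b \<cdot>\<^sub>v w" "a \<noteq> b"
    "bdry_fix H T = {proj_pt u, proj_pt w}"
proof -
  have TU: "T \<in> U" and ne: "\<not> elliptic H T" using T by (auto simp: hyperbolic_def)
  obtain p q where pq: "bdry_fix H T = {p, q}" "p \<noteq> q"
    using T by (auto simp: hyperbolic_def card_2_iff)
  then have "p \<in> bdry H" "q \<in> bdry H" "act T p = p" "act T q = q" by (auto simp: bdry_fix_def)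
  obtain u where u: "p = proj_pt u" "u \<in> V" "u \<noteq> 0\<^sub>v (Suc n)" "hf u u = 0" by (rule bdryE[OF \<open>p \<in> bdry H\<close>])
  obtain w where w: "q = proj_pt w" "w \<in> V" "w \<noteq> 0\<^sub>v (Suc n)" "hf w w = 0" by (rule bdryE[OF \<open>q \<in> bdry H\<close>])
  obtain a where a: "T *\<^sub>v u = a \<cdot>\<^sub>v u"
    using act_eq_proj_pt_iff[OF TU u(2,3)] \<open>act T p = p\<close> u(1) by auto
  obtain b where b: "T *\<^sub>v w = b \<cdot>\<^sub>v w"
    using act_eq_proj_pt_iff[OF TU w(2,3)] \<open>act T q = q\<close> w(1) by auto
  have "proj_pt u \<noteq> proj_pt w" using pq u w by simp
  moreover have "a \<noteq> b"
    using elliptic_if_null_eigenspace[OF TU u(2-4) w(2-4) calculation a] b ne by auto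
  ultimately show thesis using that[of u w a b] u w a b pq by blast
qed

lemma hyperbolic_semisimple:
  assumes T: "hyperbolic H T"
  shows "semisimple T"
proof -
  obtain u w a b where u: "u \<in> V" "u \<noteq> 0\<^sub>v (Suc n)" "hf u u = 0" and w: "w \<in> V" "w \<noteq> 0\<^sub>v (Suc n)" "hf w w = 0"
    and ne: "proj_pt u \<noteq> proj_pt w" and ev: "T *\<^sub>v u = a \<cdot>\<^sub>v u" "T *\<^sub>v w = b \<cdot>\<^sub>v w"
    using hyperbolic_obtain[OF T] by metis
  have TU: "T \<in> U" using T by (simp add: hyperbolic_def)
  obtain c where c: "Re (hf (w + c \<cdot>\<^sub>v u) (w + c \<cdot>\<^sub>v u)) < 0"
    using negative_combination[OF u(1) w(1) u(3) w(3) null_not_orthogonal[OF u w ne]] .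
  obtain s t where jd: "jordan_decomp H T s t" using jordan_decomp_exists[OF TU] .
  \<comment> \<open>The negative vector need not be an eigenvector of \<open>T\<close>, but the
    unipotent factor fixes both null eigenvectors and hence every combination of them.\<close>
  have "t *\<^sub>v (w + c \<cdot>\<^sub>v u) = w + c \<cdot>\<^sub>v u"
    using unitary_carrier[OF jordan_decompD(2)[OF jd]] u w
      jordan_decomp_eigenvector(2)[OF jd u(1) ev(1)] jordan_decomp_eigenvector(2)[OF jd w(1) ev(2)]
    by (simp add: mult_add_distrib_mat_vec[of _ "Suc n" "Suc n"] mult_mat_vec[of _ "Suc n" "Suc n"])
  then show ?thesis using jordan_decomp_fixing_negative[OF jd _ c] u w by simp
qed

section \<open>Action of the centraliser on the complex line of a hyperbolic isometry\<close>

text \<open>\<open>S\<close> scales the null eigenvectors of \<open>T\<close> by some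
  \<open>c\<close> and \<open>d\<close>, and invariance of their product gives
  \<open>c * cnj d = 1\<close>. So \<open>c / d = |c|^2\<close> is real and positive:
  \<open>c\<close> and \<open>d\<close> share a phase. If they coincide, \<open>S\<close> is scalar
  on the plane; otherwise the two null lines are its only eigenlines there.\<close>

lemma complex_line_dichotomy:
  assumes T: "hyperbolic H T" and S: "S \<in> U" and comm: "S * T = T * S"
  shows "acts_identity_on S (cline_pts H T) \<or> acts_strictly_hyperbolic_on H S (cline_sub H T) (cline_pts H T)"
proof -
  obtain u w a b where u: "u \<in> V" "u \<noteq> 0\<^sub>v (Suc n)" "hf u u = 0" and w: "w \<in> V" "w \<noteq> 0\<^sub>v (Suc n)" "hf w w = 0"
    and ne: "proj_pt u \<noteq> proj_pt w" and ev: "T *\<^sub>v u = a \<cdot>\<^sub>v u" "T *\<^sub>v w = b \<cdot>\<^sub>v w" and ab: "a \<noteq> b"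
    and fixT: "bdry_fix H T = {proj_pt u, proj_pt w}"
    using hyperbolic_obtain[OF T] .
  have TU: "T \<in> U" using T by (simp add: hyperbolic_def)
  note Sc = unitary_carrier[OF S] and Tc = unitary_carrier[OF TU]
  have uw: "hf u w \<noteq> 0" by (rule null_not_orthogonal[OF u w ne])
  have wu: "hf w u \<noteq> 0" using uw hf_eq_0_commute by blast
  have pu: "proj_pt u \<in> bdry H" and pw: "proj_pt w \<in> bdry H" using fixT by (auto simp: bdry_fix_def)
  \<comment> \<open>Stated for arbitrary \<open>u\<close>, \<open>w\<close>, \<open>a\<close>,
    \<open>b\<close> so that it applies to both null lines. \<open>S\<close> cannot exchange them,
    since \<open>S u\<close> would then be scaled by \<open>T\<close> with both \<open>a\<close> and
    \<open>b\<close>.\<close>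
  have eigS: "\<exists>c. S *\<^sub>v u = c \<cdot>\<^sub>v u"
    if u: "u \<in> V" "u \<noteq> 0\<^sub>v (Suc n)" and ev: "T *\<^sub>v u = a \<cdot>\<^sub>v u" "T *\<^sub>v w = b \<cdot>\<^sub>v w" and w: "w \<in> V"
      and fixT: "bdry_fix H T = {proj_pt u, proj_pt w}" and ab: "a \<noteq> b" for u w a b
  proof -
    have p: "proj_pt u \<in> bdry H" "act T (proj_pt u) = proj_pt u" using fixT by (auto simp: bdry_fix_def)
    then have "proj_pt u \<subseteq> V" using cl_space_subset by (auto simp: cl_space_def)
    then have "act S (proj_pt u) \<in> bdry_fix H T"
      using act_commute_fixed[OF S TU comm _ p(2)] act_bdry[OF S p(1)] by (simp add: bdry_fix_def)
    then consider "act S (proj_pt u) = proj_pt u" | "act S (proj_pt u) = proj_pt w" using fixT by blast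
    then show ?thesis
    proof cases
      case 1
      then show ?thesis using act_eq_proj_pt_iff[OF S u] by simp
    next
      case 2
      then have "S *\<^sub>v u \<in> proj_pt w" using act_proj_pt[OF Sc u(1)] proj_pt_self by metis
      then obtain e where e: "S *\<^sub>v u = e \<cdot>\<^sub>v w" by (auto simp: proj_pt_def)
      have "T *\<^sub>v (S *\<^sub>v u) = S *\<^sub>v (T *\<^sub>v u)"
        using comm assoc_mult_mat_vec[OF Sc Tc u(1)] assoc_mult_mat_vec[OF Tc Sc u(1)] by simp
      also have "\<dots> = a \<cdot>\<^sub>v (S *\<^sub>v u)" using ev(1) mult_mat_vec[OF Sc u(1)] by simp
      finally have "a \<cdot>\<^sub>v (S *\<^sub>v u) = b \<cdot>\<^sub>v (S *\<^sub>v u)"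
        using e ev(2) mult_mat_vec[OF Tc w] by (simp add: smult_smult_assoc mult.commute)
      moreover have "S *\<^sub>v u \<noteq> 0\<^sub>v (Suc n)"
        using unitary_inj[OF S u(1), of "0\<^sub>v (Suc n)"] u(2) mult_mat_zero_vec[OF Sc] by auto
      ultimately show ?thesis using smult_vec_cancel[of a "S *\<^sub>v u" b "Suc n"] ab S u by simp
    qed
  qed
  obtain c where c: "S *\<^sub>v u = c \<cdot>\<^sub>v u" using eigS[OF u(1,2) ev w(1) fixT ab] by blast
  obtain d where d: "S *\<^sub>v w = d \<cdot>\<^sub>v w"
    using eigS[OF w(1,2) ev(2,1) u(1) _ ab[symmetric]] fixT by (auto simp: insert_commute)
  let ?W = "cline_sub H T" and ?L = "cline_pts H T"
  have W: "?W = {\<alpha> \<cdot>\<^sub>v u + \<beta> \<cdot>\<^sub>v w | \<alpha> \<beta>. True}"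
  proof
    have "\<alpha> \<cdot>\<^sub>v u + \<beta> \<cdot>\<^sub>v w \<in> ?W" for \<alpha> \<beta>
    proof -
      have "\<alpha> \<cdot>\<^sub>v u \<in> proj_pt u" "\<beta> \<cdot>\<^sub>v w \<in> proj_pt w" by (auto simp: proj_pt_def)
      then show ?thesis unfolding cline_sub_def fixT by blast
    qed
    then show "{\<alpha> \<cdot>\<^sub>v u + \<beta> \<cdot>\<^sub>v w | \<alpha> \<beta>. True} \<subseteq> ?W" by blast
    \<comment> \<open>\<open>cline_sub\<close> chooses the two fixed points independently, so sums
      from one and the same line and sums in the opposite order have to be brought into the normal
      form as well.\<close>
    have "\<alpha> \<cdot>\<^sub>v u + \<beta> \<cdot>\<^sub>v u = (\<alpha> + \<beta>) \<cdot>\<^sub>v u + 0 \<cdot>\<^sub>v w" "\<alpha> \<cdot>\<^sub>v w + \<beta> \<cdot>\<^sub>v w = 0 \<cdot>\<^sub>v u + (\<alpha> + \<beta>) \<cdot>\<^sub>v w"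
      "\<alpha> \<cdot>\<^sub>v w + \<beta> \<cdot>\<^sub>v u = \<beta> \<cdot>\<^sub>v u + \<alpha> \<cdot>\<^sub>v w" for \<alpha> \<beta>
      by (rule eq_vecI; use u(1) w(1) in \<open>simp add: algebra_simps\<close>)+
    then show "?W \<subseteq> {\<alpha> \<cdot>\<^sub>v u + \<beta> \<cdot>\<^sub>v w | \<alpha> \<beta>. True}"
      unfolding cline_sub_def fixT by (auto simp: proj_pt_def) blast+
  qed
  have lin: "R *\<^sub>v (\<alpha> \<cdot>\<^sub>v u + \<beta> \<cdot>\<^sub>v w) = (\<alpha> * c) \<cdot>\<^sub>v u + (\<beta> * d) \<cdot>\<^sub>v w"
    if "R \<in> M" "R *\<^sub>v u = c \<cdot>\<^sub>v u" "R *\<^sub>v w = d \<cdot>\<^sub>v w" for R c d \<alpha> \<beta>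
    using that u w by (simp add: mult_add_distrib_mat_vec[of _ "Suc n" "Suc n"]
        mult_mat_vec[of _ "Suc n" "Suc n"] smult_smult_assoc)
  \<comment> \<open>As \<open>u\<close> and \<open>w\<close> are null, pairing with \<open>u\<close>
    isolates the coefficient of \<open>w\<close>, and pairing with \<open>w\<close> that of
    \<open>u\<close>.\<close>
  have indep: "\<alpha> = \<alpha>' \<and> \<beta> = \<beta>'" if eq: "\<alpha> \<cdot>\<^sub>v u + \<beta> \<cdot>\<^sub>v w = \<alpha>' \<cdot>\<^sub>v u + \<beta>' \<cdot>\<^sub>v w" for \<alpha> \<beta> \<alpha>' \<beta>'
    using arg_cong[OF eq, of "\<lambda>v. hf v u"] arg_cong[OF eq, of "\<lambda>v. hf v w"] u w uw wu
    by (simp add: hform_sesquilinear)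
  have L: "p \<in> ?L \<longleftrightarrow> p \<in> cl_space H \<and> p \<subseteq> ?W" for p by (simp add: cline_pts_def)
  have cd: "c * cnj d = 1"
  proof -
    have "hf (S *\<^sub>v u) (S *\<^sub>v w) = c * cnj d * hf u w" using u w by (simp add: c d hform_sesquilinear)
    then show ?thesis using unitary_hf[OF S u(1) w(1)] uw by simp
  qed
  show ?thesis
  proof (cases "c = d")
    case True
    have "act S p = p" if "p \<in> ?L" for p
    proof -
      have "p \<in> cl_space H" using that L by blast
      then obtain v where v: "p = proj_pt v" "v \<in> V" "v \<noteq> 0\<^sub>v (Suc n)" by (rule cl_spaceE)
      then have "v \<in> ?W" using that L proj_pt_self by blast
      then obtain \<alpha> \<beta> where "v = \<alpha> \<cdot>\<^sub>v u + \<beta> \<cdot>\<^sub>v w" using W by auto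
      then have "S *\<^sub>v v = c \<cdot>\<^sub>v v" using lin[OF Sc c d] True u w
        by (simp add: smult_add_distrib_vec[of _ "Suc n"] smult_smult_assoc mult.commute)
      then show ?thesis using act_eq_proj_pt_iff[OF S v(2,3)] v(1) by blast
    qed
    then show ?thesis by (simp add: acts_identity_on_def)
  next
    case False
    have eigW: "v = \<alpha> \<cdot>\<^sub>v u \<and> \<alpha> \<noteq> 0 \<and> l = c \<or> v = \<beta> \<cdot>\<^sub>v w \<and> \<beta> \<noteq> 0 \<and> l = d"
      if v: "v = \<alpha> \<cdot>\<^sub>v u + \<beta> \<cdot>\<^sub>v w" "v \<noteq> 0\<^sub>v (Suc n)" "S *\<^sub>v v = l \<cdot>\<^sub>v v" for v l \<alpha> \<beta>
    proof -
      have "(\<alpha> * c) \<cdot>\<^sub>v u + (\<beta> * d) \<cdot>\<^sub>v w = (\<alpha> * l) \<cdot>\<^sub>v u + (\<beta> * l) \<cdot>\<^sub>v w"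
        using v(3) u w unfolding v(1) lin[OF Sc c d]
        by (simp add: smult_add_distrib_vec[of _ "Suc n"] smult_smult_assoc mult.commute)
      then have eqs: "\<alpha> * c = \<alpha> * l" "\<beta> * d = \<beta> * l" using indep by blast+
      have z: "0 \<cdot>\<^sub>v u = 0\<^sub>v (Suc n)" "0 \<cdot>\<^sub>v w = 0\<^sub>v (Suc n)" using u w by auto
      have "v = \<beta> \<cdot>\<^sub>v w" if "\<alpha> = 0" using v(1) that z w by simp
      moreover have "v = \<alpha> \<cdot>\<^sub>v u" if "\<beta> = 0" using v(1) that z u by simp
      moreover have "\<alpha> = 0 \<or> \<beta> = 0" using eqs False by auto
      ultimately show ?thesis using eqs v(2) z by auto
    qed
    have fixL: "p = proj_pt u \<or> p = proj_pt w" if p: "p \<in> ?L" "act S p = p" for p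
    proof -
      have "p \<in> cl_space H" using p L by blast
      then obtain v where v: "p = proj_pt v" "v \<in> V" "v \<noteq> 0\<^sub>v (Suc n)" by (rule cl_spaceE)
      then have "v \<in> ?W" using p L proj_pt_self by blast
      then obtain \<alpha> \<beta> where "v = \<alpha> \<cdot>\<^sub>v u + \<beta> \<cdot>\<^sub>v w" using W by auto
      moreover obtain l where "S *\<^sub>v v = l \<cdot>\<^sub>v v" using act_eq_proj_pt_iff[OF S v(2,3)] p(2) v(1) by blast
      ultimately show ?thesis using eigW[OF _ v(3)] v(1) proj_pt_smult by metis
    qed
    have not_hyp: "proj_pt v \<notin> hyp_space H" if v: "v \<in> V" "hf v v = 0" for v
    proof
      assume "proj_pt v \<in> hyp_space H"
      then obtain v' where v': "proj_pt v = proj_pt v'" "Re (hf v' v') < 0" by (elim hyp_spaceE) auto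
      then have "v' \<in> proj_pt v" by simp
      then obtain k where "v' = k \<cdot>\<^sub>v v" by (auto simp: proj_pt_def)
      then show False using v v' by (simp add: hform_sesquilinear)
    qed
    have subL: "act R ` ?L \<subseteq> ?L" if "R \<in> U" "R *\<^sub>v u = c \<cdot>\<^sub>v u" "R *\<^sub>v w = d \<cdot>\<^sub>v w" for R c d
    proof
      fix q assume "q \<in> act R ` ?L"
      then obtain p where p: "p \<in> cl_space H" "p \<subseteq> ?W" and q: "q = act R p" using L by blast
      have "R *\<^sub>v v \<in> ?W" if "v \<in> ?W" for v
        using that lin[OF unitary_carrier[OF \<open>R \<in> U\<close>] \<open>R *\<^sub>v u = c \<cdot>\<^sub>v u\<close> \<open>R *\<^sub>v w = d \<cdot>\<^sub>v w\<close>] unfolding W by auto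
      then have "q \<subseteq> ?W" using p q by (auto simp: act_def)
      then show "q \<in> ?L" using L q act_cl_space[OF that(1) p(1)] by simp
    qed
    obtain S' where S': "S' \<in> U" "S' * S = 1\<^sub>m (Suc n)" "S * S' = 1\<^sub>m (Suc n)" using unitary_inverse[OF S] .
    have inv: "S' *\<^sub>v x = (1 / e) \<cdot>\<^sub>v x" if "x \<in> V" "x \<noteq> 0\<^sub>v (Suc n)" "S *\<^sub>v x = e \<cdot>\<^sub>v x" for x e
    proof -
      have "x = S' *\<^sub>v (S *\<^sub>v x)"
        using assoc_mult_mat_vec[OF unitary_carrier[OF S'(1)] Sc that(1)] S'(2) that(1) by simp
      also have "\<dots> = e \<cdot>\<^sub>v (S' *\<^sub>v x)"
        using that mult_mat_vec[OF unitary_carrier[OF S'(1)] that(1)] by simp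
      finally have "(1 / e) \<cdot>\<^sub>v x = (1 / e) \<cdot>\<^sub>v (e \<cdot>\<^sub>v (S' *\<^sub>v x))" by simp
      then show ?thesis using unitary_eigenvalue_nonzero[OF S that] by (simp add: smult_smult_assoc)
    qed
    have "act S ` ?L = ?L"
    proof
      show "act S ` ?L \<subseteq> ?L" using subL[OF S c d] .
      have "act S' p \<in> ?L" if "p \<in> ?L" for p
        using subL[OF S'(1) inv[OF u(1,2) c] inv[OF w(1,2) d]] that by blast
      moreover have "act S (act S' p) = p" if "p \<in> ?L" for p
      proof -
        have "p \<in> cl_space H" using that L by simp
        then show ?thesis by (rule act_inverse[OF S S'(1,3) cl_space_subset])
      qed
      ultimately show "?L \<subseteq> act S ` ?L" by (metis imageI subsetI)
    qed
    moreover have "\<forall>p\<in>?L \<inter> hyp_space H. act S p \<noteq> p"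
      using fixL not_hyp[OF u(1,3)] not_hyp[OF w(1,3)] by blast
    moreover have "card {p \<in> ?L \<inter> bdry H. act S p = p} = 2"
    proof -
      have "proj_pt u \<subseteq> ?W" "proj_pt w \<subseteq> ?W"
      proof -
        have "k \<cdot>\<^sub>v u = k \<cdot>\<^sub>v u + 0 \<cdot>\<^sub>v w" "k \<cdot>\<^sub>v w = 0 \<cdot>\<^sub>v u + k \<cdot>\<^sub>v w" for k
          by (rule eq_vecI; use u(1) w(1) in simp)+
        then show "proj_pt u \<subseteq> ?W" "proj_pt w \<subseteq> ?W" unfolding W proj_pt_def by blast+
      qed
      then have "proj_pt u \<in> ?L" "proj_pt w \<in> ?L" using L pu pw by (simp_all add: cl_space_def)
      moreover have "act S (proj_pt u) = proj_pt u" "act S (proj_pt w) = proj_pt w"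
        using act_eq_proj_pt_iff[OF S u(1,2)] act_eq_proj_pt_iff[OF S w(1,2)] c d by blast+
      ultimately have "{p \<in> ?L \<inter> bdry H. act S p = p} = {proj_pt u, proj_pt w}"
        using fixL pu pw by blast
      then show ?thesis using ne by simp
    qed
    moreover have "\<exists>\<mu>. cmod \<mu> = 1 \<and> (\<forall>l v. v \<in> ?W \<and> v \<noteq> 0\<^sub>v (dim_row S) \<and> S *\<^sub>v v = l \<cdot>\<^sub>v v \<longrightarrow> \<mu> * l \<in> \<real>)"
    proof (intro exI conjI allI impI)
      \<comment> \<open>The inverse phase of \<open>c\<close>. Because \<open>cnj c * d = 1\<close>,
        it turns \<open>c\<close> into \<open>|c|\<close> and \<open>d\<close> into
        \<open>1 / |c|\<close>.\<close>
      define \<mu> where "\<mu> = cnj c / cmod c"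
      have c0: "c \<noteq> 0" using cd by auto
      show "cmod \<mu> = 1" using c0 by (simp add: \<mu>_def norm_divide)
      fix l v assume "v \<in> ?W \<and> v \<noteq> 0\<^sub>v (dim_row S) \<and> S *\<^sub>v v = l \<cdot>\<^sub>v v"
      then obtain \<alpha> \<beta> where "v = \<alpha> \<cdot>\<^sub>v u + \<beta> \<cdot>\<^sub>v w" "v \<noteq> 0\<^sub>v (Suc n)" "S *\<^sub>v v = l \<cdot>\<^sub>v v"
        using carrier_matD(1)[OF Sc] unfolding W by auto
      then have "l = c \<or> l = d" using eigW by blast
      moreover have "\<mu> * c = cmod c"
        using c0 complex_norm_square[of c] by (simp add: \<mu>_def field_simps power2_eq_square)
      moreover have "\<mu> * d = 1 / cmod c"
        using arg_cong[OF cd, of cnj] by (simp add: \<mu>_def)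
      ultimately have "\<mu> * l = of_real (cmod c) \<or> \<mu> * l = of_real (1 / cmod c)" by auto
      then show "\<mu> * l \<in> \<real>" by (metis Reals_of_real)
    qed
    ultimately show ?thesis unfolding acts_strictly_hyperbolic_on_def by blast
  qed
qed

end

section \<open>Siegel frames and Heisenberg translations\<close>

lemma sum_lessThan_Suc_ends:
  fixes f :: "nat \<Rightarrow> 'a :: comm_monoid_add"
  assumes "1 \<le> n"
  shows "sum f {..<Suc n} = f 0 + sum f {1..<n} + f n"
proof -
  have "{..<n} = insert 0 {1..<n}" using assms by auto
  then show ?thesis by simp
qed

lemma siegel_J_carrier [simp]: "siegel_J n \<in> carrier_mat (Suc n) (Suc n)"
  by (simp add: siegel_J_def)

lemma siegel_J_mult_vec:
  assumes n: "1 \<le> n" and z: "z \<in> carrier_vec (Suc n)" and i: "i < Suc n"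
  shows "(siegel_J n *\<^sub>v z) $ i = (if i = 0 then z $ n else if i = n then z $ 0 else z $ i)"
proof -
  have "(siegel_J n *\<^sub>v z) $ i = (\<Sum>j<Suc n. siegel_J n $$ (i, j) * z $ j)"
    by (rule mult_mat_vec_index[OF siegel_J_carrier z i])
  also have "\<dots> = (\<Sum>j<Suc n. if j = (if i = 0 then n else if i = n then 0 else i)
      then z $ (if i = 0 then n else if i = n then 0 else i) else 0)"
    using n i by (intro sum.cong) (auto simp: siegel_J_def)
  also have "\<dots> = z $ (if i = 0 then n else if i = n then 0 else i)"
    using i by (subst sum.delta) auto
  finally show ?thesis by simp
qed

lemma hform_siegel_J:
  assumes n: "1 \<le> n" and z: "z \<in> carrier_vec (Suc n)" and w: "w \<in> carrier_vec (Suc n)"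
  shows "hform (siegel_J n) z w = cnj (w $ 0) * z $ n + cnj (w $ n) * z $ 0 + (\<Sum>i\<in>{1..<n}. cnj (w $ i) * z $ i)"
proof -
  have "hform (siegel_J n) z w = (\<Sum>i<Suc n. cnj (w $ i) * (siegel_J n *\<^sub>v z) $ i)"
    by (rule hform_alt[OF siegel_J_carrier z w])
  also have "\<dots> = (\<Sum>i<Suc n. cnj (w $ i) * (if i = 0 then z $ n else if i = n then z $ 0 else z $ i))"
    by (intro sum.cong refl) (simp add: siegel_J_mult_vec[OF n z])
  also have "\<dots> = cnj (w $ 0) * z $ n + cnj (w $ n) * z $ 0 + (\<Sum>i\<in>{1..<n}. cnj (w $ i) * z $ i)"
    unfolding sum_lessThan_Suc_ends[OF n] using n by simp
  finally show ?thesis .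
qed

lemma siegel_J_involution: "1 \<le> n \<Longrightarrow> siegel_J n * siegel_J n = 1\<^sub>m (Suc n)"
proof (rule mat_eq_if_mult_vec_eq[of _ "Suc n" "Suc n"])
  fix v :: "complex vec" assume n: "1 \<le> n" and v: "v \<in> carrier_vec (Suc n)"
  have Jv: "siegel_J n *\<^sub>v v \<in> carrier_vec (Suc n)" by (rule mult_mat_vec_carrier[OF siegel_J_carrier v])
  have "siegel_J n *\<^sub>v (siegel_J n *\<^sub>v v) = v"
  proof (rule eq_vecI)
    fix i assume "i < dim_vec v"
    then show "(siegel_J n *\<^sub>v (siegel_J n *\<^sub>v v)) $ i = v $ i"
      using v n by (simp add: siegel_J_mult_vec[OF n Jv] siegel_J_mult_vec[OF n v])
  qed (use v in \<open>simp add: siegel_J_def\<close>)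
  then show "siegel_J n * siegel_J n *\<^sub>v v = 1\<^sub>m (Suc n) *\<^sub>v v"
    using assoc_mult_mat_vec[OF siegel_J_carrier siegel_J_carrier v] v by simp
qed (simp_all add: mult_carrier_mat[OF siegel_J_carrier siegel_J_carrier])

text \<open>The columns \<open>e\<^sub>0 + e\<^sub>n\<close> and \<open>(e\<^sub>0 - e\<^sub>n) / 2\<close> are null with product 1 for the diagonal form.\<close>
definition cayley_mat :: "nat \<Rightarrow> complex mat" where
  "cayley_mat n = mat (Suc n) (Suc n) (\<lambda>(i, j).
     if j = 0 then (if i = 0 \<or> i = n then 1 else 0)
     else if j = n then (if i = 0 then 1 / 2 else if i = n then - 1 / 2 else 0)
     else if i = j then 1 else 0)"

lemma cayley_mat_carrier [simp]: "cayley_mat n \<in> carrier_mat (Suc n) (Suc n)"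
  by (simp add: cayley_mat_def)

lemma cayley_mat_mult_vec:
  assumes n: "1 \<le> n" and z: "z \<in> carrier_vec (Suc n)" and i: "i < Suc n"
  shows "(cayley_mat n *\<^sub>v z) $ i
    = (if i = 0 then z $ 0 + z $ n / 2 else if i = n then z $ 0 - z $ n / 2 else z $ i)"
proof -
  have "(cayley_mat n *\<^sub>v z) $ i = (\<Sum>j<Suc n. cayley_mat n $$ (i, j) * z $ j)"
    by (rule mult_mat_vec_index[OF cayley_mat_carrier z i])
  also have "\<dots> = cayley_mat n $$ (i, 0) * z $ 0 + (\<Sum>j\<in>{1..<n}. cayley_mat n $$ (i, j) * z $ j)
      + cayley_mat n $$ (i, n) * z $ n"
    by (rule sum_lessThan_Suc_ends[OF n])
  also have "(\<Sum>j\<in>{1..<n}. cayley_mat n $$ (i, j) * z $ j) = (\<Sum>j\<in>{1..<n}. if j = i then z $ i else 0)"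
    using i by (intro sum.cong) (auto simp: cayley_mat_def)
  also have "\<dots> = (if 1 \<le> i \<and> i < n then z $ i else 0)" by simp
  finally show ?thesis using n i by (auto simp: cayley_mat_def)
qed

lemma cayley_mat_congruence:
  assumes n: "1 \<le> n"
  shows "mat_adjoint (cayley_mat n) * std_diag n * cayley_mat n = siegel_J n"
proof (rule hform_eqI[of _ "Suc n"])
  fix z w :: "complex vec" assume z: "z \<in> carrier_vec (Suc n)" and w: "w \<in> carrier_vec (Suc n)"
  have ins: "{..<n} = insert 0 {1..<n}" using n by auto
  have "hform (mat_adjoint (cayley_mat n) * std_diag n * cayley_mat n) z w
      = hform (std_diag n) (cayley_mat n *\<^sub>v z) (cayley_mat n *\<^sub>v w)"
    by (rule hform_adjoint_mult[OF std_diag_carrier cayley_mat_carrier z w])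
  also have "\<dots> = cnj (w $ 0 + w $ n / 2) * (z $ 0 + z $ n / 2) + (\<Sum>i\<in>{1..<n}. cnj (w $ i) * z $ i)
      - cnj (w $ 0 - w $ n / 2) * (z $ 0 - z $ n / 2)"
    unfolding hform_std_diag ins using n
    by (simp add: cayley_mat_mult_vec[OF n z] cayley_mat_mult_vec[OF n w])
  also have "\<dots> = hform (siegel_J n) z w"
    unfolding hform_siegel_J[OF n z w] by (simp add: algebra_simps)
  finally show "hform (mat_adjoint (cayley_mat n) * std_diag n * cayley_mat n) z w = hform (siegel_J n) z w" .
qed (auto intro!: mult_carrier_mat[OF mult_carrier_mat[OF mat_adjoint_carrier[OF cayley_mat_carrier]
    std_diag_carrier] cayley_mat_carrier])

section \<open>Algebraic multiplicity from independent eigenvectors\<close>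

lemma order_char_poly_diagonal:
  fixes D :: "complex mat"
  assumes D: "D \<in> carrier_mat m m" "diagonal_mat D" and ij: "i < m" "j < m" "i \<noteq> j"
    and d: "D $$ (i, i) = l" "D $$ (j, j) = l"
  shows "2 \<le> Polynomial.order l (char_poly D)"
proof -
  let ?f = "\<lambda>k. [:- (D $$ (k, k)), 1:]"
  have ut: "upper_triangular D" using D by (auto simp: upper_triangular_def diagonal_mat_def)
  have "char_poly D = (\<Prod>k\<leftarrow>[0..<m]. ?f k)"
    unfolding char_poly_upper_triangular[OF D(1) ut] using D(1) by (simp add: diag_mat_def o_def)
  also have "\<dots> = (\<Prod>k\<in>{0..<m}. ?f k)" by (simp add: prod.distinct_set_conv_list[symmetric])
  finally have cp: "char_poly D = (\<Prod>k\<in>{0..<m}. ?f k)" .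
  have "(\<Prod>k\<in>{i, j}. ?f k) dvd (\<Prod>k\<in>{0..<m}. ?f k)"
    by (rule prod_dvd_prod_subset) (use ij in auto)
  moreover have "(\<Prod>k\<in>{i, j}. ?f k) = [:- l, 1:] ^ 2" using ij d by (simp add: power2_eq_square)
  ultimately have "[:- l, 1:] ^ 2 dvd char_poly D" by (simp add: cp)
  moreover have "char_poly D \<noteq> 0" using degree_monic_char_poly[OF D(1)] by auto
  ultimately show ?thesis by (simp add: order_divides)
qed

text \<open>Bridges independent eigenvectors and the algebraic multiplicity in
  \<open>boundary_elliptic\<close>: in diagonal coordinates both eigenvectors are supported where
  the diagonal equals \<open>l\<close>, and a single such index would make them
  proportional.\<close>

lemma semisimple_order_ge_2:
  assumes g: "g \<in> carrier_mat m m" "semisimple g"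
    and v: "v \<in> carrier_vec m" "g *\<^sub>v v = l \<cdot>\<^sub>v v" and x: "x \<in> carrier_vec m" "x \<noteq> 0\<^sub>v m" "g *\<^sub>v x = l \<cdot>\<^sub>v x"
    and indep: "\<And>c. v \<noteq> c \<cdot>\<^sub>v x"
  shows "2 \<le> Polynomial.order l (char_poly g)"
proof -
  obtain P Q D where PQD: "P \<in> carrier_mat m m" "Q \<in> carrier_mat m m" "D \<in> carrier_mat m m"
    "P * Q = 1\<^sub>m m" "Q * P = 1\<^sub>m m" "g = P * D * Q" "diagonal_mat D"
    using semisimple_obtain[OF g] .
  have PQ: "P *\<^sub>v (Q *\<^sub>v y) = y" if "y \<in> carrier_vec m" for y
    using assoc_mult_mat_vec[OF PQD(1,2) that] PQD(4) that by simp
  have supp: "(Q *\<^sub>v y) $ i = 0 \<or> D $$ (i, i) = l"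
    if y: "y \<in> carrier_vec m" "g *\<^sub>v y = l \<cdot>\<^sub>v y" and i: "i < m" for y i
  proof -
    have Qy: "Q *\<^sub>v y \<in> carrier_vec m" using PQD(2) y(1) by simp
    have "P *\<^sub>v (D *\<^sub>v (Q *\<^sub>v y)) = l \<cdot>\<^sub>v y"
      using y PQD(1-3) unfolding PQD(6) by (simp add: assoc_mult_mat_vec[of _ m m _ m])
    then have "Q *\<^sub>v (P *\<^sub>v (D *\<^sub>v (Q *\<^sub>v y))) = l \<cdot>\<^sub>v (Q *\<^sub>v y)"
      using mult_mat_vec[OF PQD(2) y(1)] by simp
    moreover have DQ: "D *\<^sub>v (Q *\<^sub>v y) \<in> carrier_vec m" using PQD(3) Qy by simp
    ultimately have "D *\<^sub>v (Q *\<^sub>v y) = l \<cdot>\<^sub>v (Q *\<^sub>v y)"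
      using assoc_mult_mat_vec[OF PQD(2,1) DQ] PQD(5) by simp
    then have "(D *\<^sub>v (Q *\<^sub>v y)) $ i = (l \<cdot>\<^sub>v (Q *\<^sub>v y)) $ i" by simp
    then have "D $$ (i, i) * (Q *\<^sub>v y) $ i = l * (Q *\<^sub>v y) $ i"
      using diagonal_mat_mult_vec[OF PQD(3,7) Qy i] Qy PQD(2) i by simp
    then show ?thesis by auto
  qed
  have Qx: "Q *\<^sub>v x \<in> carrier_vec m" and Qv: "Q *\<^sub>v v \<in> carrier_vec m" using PQD(2) x v by auto
  have "Q *\<^sub>v x \<noteq> 0\<^sub>v m" using PQ[OF x(1)] x(2) mult_mat_zero_vec[OF PQD(1)] by auto
  then obtain i where i: "i < m" "(Q *\<^sub>v x) $ i \<noteq> 0"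
    using Qx by (metis carrier_vecD eq_vecI index_zero_vec)
  \<comment> \<open>With this factor \<open>Q v\<close> and \<open>c\<close> times
    \<open>Q x\<close> agree at \<open>i\<close>, so an index where they differ is a second
    one.\<close>
  define c where "c = (Q *\<^sub>v v) $ i / (Q *\<^sub>v x) $ i"
  have "Q *\<^sub>v v \<noteq> c \<cdot>\<^sub>v (Q *\<^sub>v x)"
    using PQ[OF v(1)] PQ[OF x(1)] mult_mat_vec[OF PQD(1) Qx] indep[of c] by metis
  then obtain j where j: "j < m" "(Q *\<^sub>v v) $ j \<noteq> c * (Q *\<^sub>v x) $ j"
    using Qx Qv by (metis (no_types, lifting) carrier_vecD eq_vecI index_smult_vec)
  have "j \<noteq> i" using j(2) i(2) by (auto simp: c_def)
  moreover have "(Q *\<^sub>v v) $ j \<noteq> 0 \<or> (Q *\<^sub>v x) $ j \<noteq> 0" using j(2) by auto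
  then have "D $$ (j, j) = l" using supp[OF v j(1)] supp[OF x(1,3) j(1)] by blast
  moreover have "D $$ (i, i) = l" using supp[OF x(1,3) i(1)] i(2) by blast
  ultimately have "2 \<le> Polynomial.order l (char_poly D)"
    using order_char_poly_diagonal[OF PQD(3,7) i(1) j(1)] by blast
  moreover have "similar_mat g D"
    by (rule similar_matI[where P = P and Q = Q and n = m]) (use PQD g(1) in auto)
  ultimately show ?thesis using char_poly_similar by metis
qed

section \<open>Siegel frames adapted to a boundary point\<close>

context hermitian_space
begin

lemma siegel_frame_obtain:
  obtains K Q where "K \<in> M" "Q \<in> M" "K * Q = 1\<^sub>m (Suc n)" "Q * K = 1\<^sub>m (Suc n)"
    "\<forall>z\<in>V. \<forall>w\<in>V. hform (siegel_J n) (K *\<^sub>v z) (K *\<^sub>v w) = hf z w"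
proof -
  obtain P Pi where P: "P \<in> M" "Pi \<in> M" "P * Pi = 1\<^sub>m (Suc n)" "Pi * P = 1\<^sub>m (Suc n)"
    "mat_adjoint P * H * P = std_diag n"
    "\<forall>z\<in>V. \<forall>w\<in>V. hf z w = hform (std_diag n) (Pi *\<^sub>v z) (Pi *\<^sub>v w)"
    using frame_obtain .
  let ?J = "siegel_J n" and ?C = "cayley_mat n"
  \<comment> \<open>The inverse of \<open>?C\<close>, obtained from the congruence between the
    diagonal and the Siegel form because \<open>?J\<close> squares to the identity.\<close>
  let ?Ci = "?J * (mat_adjoint ?C * std_diag n)"
  have aC: "mat_adjoint ?C * std_diag n \<in> M"
    by (rule mult_carrier_mat[OF mat_adjoint_carrier[OF cayley_mat_carrier] std_diag_carrier])
  have Ci: "?Ci \<in> M" by (rule mult_carrier_mat[OF siegel_J_carrier aC])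
  have "?Ci * ?C = ?J * (mat_adjoint ?C * std_diag n * ?C)"
    by (rule assoc_mult_mat[OF siegel_J_carrier aC cayley_mat_carrier])
  then have CiC: "?Ci * ?C = 1\<^sub>m (Suc n)"
    using cayley_mat_congruence[OF n_pos] siegel_J_involution[OF n_pos] by simp
  then have CCi: "?C * ?Ci = 1\<^sub>m (Suc n)" using mat_mult_left_right_inverse[OF Ci cayley_mat_carrier] by simp
  have form: "hform ?J (?Ci *\<^sub>v z) (?Ci *\<^sub>v w) = hform (std_diag n) z w" if z: "z \<in> V" and w: "w \<in> V" for z w
  proof -
    have c: "?Ci *\<^sub>v z \<in> V" "?Ci *\<^sub>v w \<in> V" using mult_mat_vec_carrier[OF Ci] z w by auto
    have "?C *\<^sub>v (?Ci *\<^sub>v v) = v" if "v \<in> V" for v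
      using assoc_mult_mat_vec[OF cayley_mat_carrier Ci that] CCi that by simp
    then show ?thesis
      using hform_adjoint_mult[OF std_diag_carrier cayley_mat_carrier c] z w
      by (simp only: cayley_mat_congruence[OF n_pos])
  qed
  define K Q where "K = ?Ci * Pi" and "Q = P * ?C"
  have K: "K \<in> M" unfolding K_def by (rule mult_carrier_mat[OF Ci P(2)])
  have Q: "Q \<in> M" unfolding Q_def by (rule mult_carrier_mat[OF P(1) cayley_mat_carrier])
  have "Q * K = P * (?C * (?Ci * Pi))"
    unfolding K_def Q_def by (rule assoc_mult_mat[OF P(1) cayley_mat_carrier mult_carrier_mat[OF Ci P(2)]])
  also have "?C * (?Ci * Pi) = Pi"
    using assoc_mult_mat[OF cayley_mat_carrier Ci P(2)] CCi P(2) by simp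
  finally have QK: "Q * K = 1\<^sub>m (Suc n)" using P(3) by simp
  have "K * Q = 1\<^sub>m (Suc n)" by (rule mat_mult_left_right_inverse[OF Q K QK])
  moreover have "\<forall>z\<in>V. \<forall>w\<in>V. hform ?J (K *\<^sub>v z) (K *\<^sub>v w) = hf z w"
    using form P(2,6) assoc_mult_mat_vec[OF Ci P(2)] by (simp add: K_def)
  ultimately show thesis using that K Q QK by blast
qed

text \<open>The map sending \<open>z\<close> to \<open>z + hf z v\<close> times \<open>v\<close>.
  When \<open>hf v v = - 2\<close> it sends \<open>v\<close> to \<open>- v\<close> and fixes its
  orthogonal complement, so it is the reflection in a negative vector.\<close>

definition reflection_mat :: "complex vec \<Rightarrow> complex mat" where
  "reflection_mat v = mat (Suc n) (Suc n)
     (\<lambda>(i, j). (if i = j then 1 else 0) + v $ i * (\<Sum>k<Suc n. cnj (v $ k) * H $$ (k, j)))"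

lemma reflection_mat_carrier [simp]: "reflection_mat v \<in> M"
  by (simp add: reflection_mat_def)

lemma reflection_mat_mult_vec:
  assumes v: "v \<in> V" and z: "z \<in> V"
  shows "reflection_mat v *\<^sub>v z = z + hf z v \<cdot>\<^sub>v v"
proof (rule eq_vecI)
  fix i assume "i < dim_vec (z + hf z v \<cdot>\<^sub>v v)"
  then have i: "i < Suc n" using v by simp
  have "(reflection_mat v *\<^sub>v z) $ i = (\<Sum>j<Suc n. reflection_mat v $$ (i, j) * z $ j)"
    by (rule mult_mat_vec_index[OF reflection_mat_carrier z i])
  also have "\<dots> = (\<Sum>j<Suc n. (if j = i then z $ i else 0)
      + v $ i * (\<Sum>k<Suc n. cnj (v $ k) * H $$ (k, j) * z $ j))"
    using i by (intro sum.cong refl)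
      (auto simp: reflection_mat_def distrib_right sum_distrib_right mult.assoc simp del: sum.lessThan_Suc)
  also have "\<dots> = z $ i + v $ i * (\<Sum>j<Suc n. \<Sum>k<Suc n. cnj (v $ k) * H $$ (k, j) * z $ j)"
    using i unfolding sum.distrib sum_distrib_left[symmetric] by (simp del: sum.lessThan_Suc)
  also have "(\<Sum>j<Suc n. \<Sum>k<Suc n. cnj (v $ k) * H $$ (k, j) * z $ j) = hf z v"
    unfolding hform_def H_dim by (rule sum.swap)
  finally show "(reflection_mat v *\<^sub>v z) $ i = (z + hf z v \<cdot>\<^sub>v v) $ i"
    using i v z by (simp add: mult.commute)
qed (use v in \<open>simp add: reflection_mat_def\<close>)

lemma reflection_mat_unitary:
  assumes v: "v \<in> V" "hf v v = - 2"
  shows "reflection_mat v \<in> U"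
proof (rule unitaryI[OF reflection_mat_carrier])
  fix z w :: "complex vec" assume z: "z \<in> V" and w: "w \<in> V"
  have "hf v w = cnj (hf w v)" by (rule hf_cnj)
  then show "hf (reflection_mat v *\<^sub>v z) (reflection_mat v *\<^sub>v w) = hf z w"
    using v z w by (simp add: reflection_mat_mult_vec hform_sesquilinear algebra_simps)
qed

text \<open>Distinct null lines have representatives \<open>x\<close> and \<open>y\<close> with
  product 1, and the reflection in their difference exchanges them.\<close>

lemma unitary_transitive_on_bdry:
  assumes p: "p \<in> bdry H" and q: "q \<in> bdry H"
  obtains R where "R \<in> U" "act R p = q"
proof -
  obtain u where u: "p = proj_pt u" "u \<in> V" "u \<noteq> 0\<^sub>v (Suc n)" "hf u u = 0" using p by (rule bdryE)
  obtain y where y: "q = proj_pt y" "y \<in> V" "y \<noteq> 0\<^sub>v (Suc n)" "hf y y = 0" using q by (rule bdryE)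
  show thesis
  proof (cases "p = q")
    case True
    have "1\<^sub>m (Suc n) \<in> U" by (rule unitaryI) auto
    moreover have "p \<subseteq> V" using p cl_space_subset by (simp add: cl_space_def)
    ultimately show ?thesis using that[of "1\<^sub>m (Suc n)"] act_one True by blast
  next
    case False
    then have uy: "hf u y \<noteq> 0" using null_not_orthogonal[OF u(2-4) y(2-4)] u y by simp
    \<comment> \<open>Normalising the product to 1 gives \<open>x - y\<close> the norm
      \<open>-2\<close>, the value required for a reflection, and makes \<open>x\<close> map to
      \<open>x - (x - y) = y\<close>.\<close>
    define x where "x = (1 / hf u y) \<cdot>\<^sub>v u"
    have x: "x \<in> V" "hf x x = 0" "hf x y = 1" using u uy by (auto simp: x_def hform_sesquilinear)
    have yx: "hf y x = 1" using hf_cnj[of y x] x by simp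
    define v where "v = x + (- 1) \<cdot>\<^sub>v y"
    have v: "v \<in> V" using x y by (simp add: v_def)
    have vv: "hf v v = - 2" using x y yx by (simp add: v_def hform_sesquilinear)
    have xv: "hf x v = - 1" using x y yx by (simp add: v_def hform_sesquilinear)
    have "reflection_mat v *\<^sub>v x = x + (- 1) \<cdot>\<^sub>v v"
      using reflection_mat_mult_vec[OF v x(1)] xv by simp
    also have "\<dots> = y" using x y by (auto simp: v_def intro!: eq_vecI)
    finally have "act (reflection_mat v) (proj_pt x) = q"
      using act_proj_pt[OF reflection_mat_carrier x(1)] y(1) by simp
    moreover have "proj_pt x = p" using uy u(1) by (simp add: x_def proj_pt_smult)
    ultimately show ?thesis using that reflection_mat_unitary[OF v vv] by blast
  qed
qed

text \<open>Any Siegel frame sends some null line to infinity; composing it with an isometry that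
  moves \<open>x\<close> to that line adapts it to \<open>x\<close>.\<close>

lemma siegel_frame_at_obtain:
  assumes x: "x \<in> bdry H"
  obtains K Q where "K \<in> M" "Q \<in> M" "K * Q = 1\<^sub>m (Suc n)" "Q * K = 1\<^sub>m (Suc n)"
    "\<forall>z\<in>V. \<forall>w\<in>V. hform (siegel_J n) (K *\<^sub>v z) (K *\<^sub>v w) = hf z w" "act K x = inf_pt n"
proof -
  obtain K Q where K: "K \<in> M" "Q \<in> M" "K * Q = 1\<^sub>m (Suc n)" "Q * K = 1\<^sub>m (Suc n)"
    and form: "\<forall>z\<in>V. \<forall>w\<in>V. hform (siegel_J n) (K *\<^sub>v z) (K *\<^sub>v w) = hf z w"
    using siegel_frame_obtain .
  let ?e = "unit_vec (Suc n) 0 :: complex vec"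
  have e: "?e \<in> V" by simp
  have Qe: "Q *\<^sub>v ?e \<in> V" using K(2) by simp
  have KQe: "K *\<^sub>v (Q *\<^sub>v ?e) = ?e" using assoc_mult_mat_vec[OF K(1,2) e] K(3) by simp
  have ee: "hform (siegel_J n) ?e ?e = 0" using n_pos by (simp add: hform_siegel_J[OF n_pos e e])
  have "hf (Q *\<^sub>v ?e) (Q *\<^sub>v ?e) = hform (siegel_J n) (K *\<^sub>v (Q *\<^sub>v ?e)) (K *\<^sub>v (Q *\<^sub>v ?e))"
    using form Qe by simp
  then have null: "hf (Q *\<^sub>v ?e) (Q *\<^sub>v ?e) = 0" using KQe ee by simp
  have "Q *\<^sub>v ?e \<noteq> 0\<^sub>v (Suc n)"
  proof
    assume "Q *\<^sub>v ?e = 0\<^sub>v (Suc n)"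
    then have "?e = 0\<^sub>v (Suc n)" using KQe mult_mat_zero_vec[OF K(1)] by simp
    then have "?e $ 0 = 0" by simp
    then show False by simp
  qed
  then have q: "proj_pt (Q *\<^sub>v ?e) \<in> bdry H" using Qe null by (auto simp: bdry_def null_vecs_def)
  obtain R where R: "R \<in> U" "act R x = proj_pt (Q *\<^sub>v ?e)" using unitary_transitive_on_bdry[OF x q] .
  obtain R' where R': "R' \<in> U" "R' * R = 1\<^sub>m (Suc n)" "R * R' = 1\<^sub>m (Suc n)" using unitary_inverse[OF R(1)] .
  note c = unitary_carrier[OF R(1)] unitary_carrier[OF R'(1)]
  have KR: "K * R \<in> M" and R'Q: "R' * Q \<in> M" using K(1,2) c by (auto intro: mult_carrier_mat)
  have "act (K * R) x = act K (act R x)"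
    using act_mult[OF K(1) c(1)] x cl_space_subset by (simp add: cl_space_def)
  also have "\<dots> = inf_pt n" using R(2) act_proj_pt[OF K(1) Qe] KQe by (simp add: inf_pt_def)
  finally have 1: "act (K * R) x = inf_pt n" .
  have "(K * R) * (R' * Q) = K * (R * (R' * Q))" by (rule assoc_mult_mat[OF K(1) c(1) R'Q])
  also have "R * (R' * Q) = Q" using assoc_mult_mat[OF c K(2)] R'(3) K(2) by simp
  finally have 2: "(K * R) * (R' * Q) = 1\<^sub>m (Suc n)" using K(3) by simp
  have 3: "(R' * Q) * (K * R) = 1\<^sub>m (Suc n)" by (rule mat_mult_left_right_inverse[OF KR R'Q 2])
  have "hform (siegel_J n) ((K * R) *\<^sub>v z) ((K * R) *\<^sub>v w) = hf z w" if "z \<in> V" "w \<in> V" for z w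
    using assoc_mult_mat_vec[OF K(1) c(1)] that form R(1) unitary_hf[OF R(1)] by simp
  then show thesis using that[OF KR R'Q 2 3 _ 1] by blast
qed

section \<open>Unipotent isometries fixing a boundary point\<close>

lemma unipotent_displacement:
  assumes A: "A \<in> U" "unipotent A" and x: "x \<in> V" "x \<noteq> 0\<^sub>v (Suc n)" "hf x x = 0" "A *\<^sub>v x = x"
    and y: "y \<in> V" "hf y x = 0"
  obtains c where "A *\<^sub>v y = y + c \<cdot>\<^sub>v x"
proof -
  note Ac = unitary_carrier[OF A(1)]
  have "gev A 1 k y \<Longrightarrow> hf y x = 0 \<Longrightarrow> \<exists>c. A *\<^sub>v y = y + c \<cdot>\<^sub>v x" for k y
  proof (induction k arbitrary: y)
    case 0
    then have "A *\<^sub>v y = y + 0 \<cdot>\<^sub>v x" using Ac x by (auto intro!: eq_vecI)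
    then show ?case by blast
  next
    case (Suc k)
    then obtain y' where y: "y \<in> V" and y': "gev A 1 k y'" "A *\<^sub>v y = y + y'"
      using Ac by auto
    have cy: "y' \<in> V" using gev_carrier[OF y'(1)] Ac by simp
    have y'x: "hf y' x = 0"
      using unitary_hf[OF A(1) y x(1)] x(4) y cy by (simp add: y'(2) hform_sesquilinear)
    obtain c where c: "A *\<^sub>v y' = y' + c \<cdot>\<^sub>v x" using Suc.IH[OF y'(1) y'x] by blast
    \<comment> \<open>In \<open>hf (A y) (A y') = hf y y'\<close> the terms with \<open>c\<close>
      drop out because \<open>y\<close> and \<open>y'\<close> are orthogonal to \<open>x\<close>;
      only the norm of \<open>y'\<close> is left.\<close>
    have "hf y' y' = 0"
      using unitary_hf[OF A(1) y cy] y cy x Suc.prems(2) y'x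
      by (simp add: y'(2) c hform_sesquilinear)
    then obtain d where "y' = d \<cdot>\<^sub>v x"
      using null_orthogonal_collinear[OF x(1-3) cy] y'x hf_eq_0_commute[of x y'] by auto
    then show ?case using y'(2) by blast
  qed
  then show thesis using that unipotent_gev[OF Ac A(2) y(1)] y(2) by blast
qed

lemma unipotent_fixes_vector:
  assumes A: "A \<in> U" "unipotent A" and x: "x \<in> V" "x \<noteq> 0\<^sub>v (Suc n)" "act A (proj_pt x) = proj_pt x"
  shows "A *\<^sub>v x = x"
proof -
  obtain c where c: "A *\<^sub>v x = c \<cdot>\<^sub>v x" using act_eq_proj_pt_iff[OF A(1) x(1,2)] x(3) by blast
  then have "eigenvalue A c"
    using x unitary_carrier[OF A(1)] by (auto simp: eigenvalue_def eigenvector_def)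
  then show ?thesis using A(2) c by (auto simp: unipotent_def)
qed

text \<open>The matrix of \<open>A\<close> in the frame is determined column by column: the first is
  fixed, the middle ones move only in direction \<open>e_0\<close> by the displacement lemma, and
  invariance of the form expresses all remaining constraints through the last column. Its middle
  part is \<open>\<tau>\<close>.\<close>

lemma unipotent_heis:
  assumes A: "A \<in> U" "unipotent A" and x: "x \<in> bdry H" "act A x = x"
    and K: "K \<in> M" "Q \<in> M" "K * Q = 1\<^sub>m (Suc n)" "Q * K = 1\<^sub>m (Suc n)"
    and form: "\<forall>z\<in>V. \<forall>w\<in>V. hform (siegel_J n) (K *\<^sub>v z) (K *\<^sub>v w) = hf z w" and Kx: "act K x = inf_pt n"
  obtains \<tau> t where "\<tau> \<in> carrier_vec (n - 1)" "K * A = heis n \<tau> t * K"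
proof -
  let ?e = "\<lambda>j. unit_vec (Suc n) j :: complex vec" and ?J = "siegel_J n"
  note Ac = unitary_carrier[OF A(1)]
  have QK: "Q *\<^sub>v (K *\<^sub>v v) = v" if "v \<in> V" for v
    using assoc_mult_mat_vec[OF K(2,1) that] K(4) that by simp
  have KQ: "K *\<^sub>v (Q *\<^sub>v v) = v" if "v \<in> V" for v
    using assoc_mult_mat_vec[OF K(1,2) that] K(3) that by simp
  define B where "B = K * A * Q"
  have KA: "K * A \<in> M" using K Ac by simp
  have B: "B \<in> M" using KA K(2) by (simp add: B_def)
  have Bv: "B *\<^sub>v v = K *\<^sub>v (A *\<^sub>v (Q *\<^sub>v v))" if "v \<in> V" for v
    using assoc_mult_mat_vec[OF KA K(2) that] assoc_mult_mat_vec[OF K(1) Ac] that K(2) by (simp add: B_def)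
  have hJ: "hform ?J z w = hf (Q *\<^sub>v z) (Q *\<^sub>v w)" if "z \<in> V" "w \<in> V" for z w
    using form[rule_format, of "Q *\<^sub>v z" "Q *\<^sub>v w"] KQ that K(2) by simp
  have B_form: "hform ?J (B *\<^sub>v z) (B *\<^sub>v w) = hform ?J z w" if "z \<in> V" "w \<in> V" for z w
    using that form unitary_hf[OF A(1)] K(2) Ac by (simp add: Bv hJ)
  obtain u where u: "x = proj_pt u" "u \<in> V" "u \<noteq> 0\<^sub>v (Suc n)" "hf u u = 0" using x(1) by (rule bdryE)
  define f where "f = Q *\<^sub>v ?e 0"
  have f: "f \<in> V" using K(2) by (simp add: f_def)
  have Kf: "K *\<^sub>v f = ?e 0" using KQ by (simp add: f_def)
  have "proj_pt (K *\<^sub>v u) = proj_pt (?e 0)" using Kx act_proj_pt[OF K(1) u(2)] u(1) by (simp add: inf_pt_def)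
  then have "?e 0 \<in> proj_pt (K *\<^sub>v u)" by simp
  then obtain k where k: "?e 0 = k \<cdot>\<^sub>v (K *\<^sub>v u)" by (auto simp: proj_pt_def)
  then have fk: "f = k \<cdot>\<^sub>v u"
    using mult_mat_vec[OF K(2), of "K *\<^sub>v u" k] QK[OF u(2)] K(1) u(2) by (simp add: f_def)
  have f0: "f \<noteq> 0\<^sub>v (Suc n)"
  proof
    assume "f = 0\<^sub>v (Suc n)"
    then have "?e 0 $ 0 = 0\<^sub>v (Suc n) $ 0" using Kf mult_mat_zero_vec[OF K(1)] by simp
    then show False by simp
  qed
  have "k \<noteq> 0" using fk f0 u by auto
  then have fx: "proj_pt f = x" using fk u(1) proj_pt_smult by simp
  have ff: "hf f f = 0" using fk u by (simp add: hform_sesquilinear)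
  have Af: "A *\<^sub>v f = f" using unipotent_fixes_vector[OF A f f0] fx x(2) by simp
  have B0: "B *\<^sub>v ?e 0 = ?e 0" using Bv[of "?e 0"] Af Kf by (simp add: f_def)
  have "\<exists>c. B *\<^sub>v ?e j = ?e j + c \<cdot>\<^sub>v ?e 0" if j: "0 < j" "j < n" for j
  proof -
    have Qj: "Q *\<^sub>v ?e j \<in> V" using K(2) by simp
    have "hf (Q *\<^sub>v ?e j) f = hform ?J (?e j) (?e 0)" using hJ[of "?e j" "?e 0"] by (simp add: f_def)
    also have "\<dots> = 0" using j by (subst hform_siegel_J[OF n_pos]) auto
    finally obtain c where "A *\<^sub>v (Q *\<^sub>v ?e j) = Q *\<^sub>v ?e j + c \<cdot>\<^sub>v f"
      using unipotent_displacement[OF A f f0 ff Af Qj] by blast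
    then have "B *\<^sub>v ?e j = ?e j + c \<cdot>\<^sub>v ?e 0"
      using Bv[of "?e j"] KQ[of "?e j"] Kf Qj f K(1)
      by (simp add: mult_add_distrib_mat_vec[OF K(1)] mult_mat_vec[OF K(1)])
    then show ?thesis by blast
  qed
  then obtain a where Bj: "\<And>j. 0 < j \<Longrightarrow> j < n \<Longrightarrow> B *\<^sub>v ?e j = ?e j + a j \<cdot>\<^sub>v ?e 0" by metis
  \<comment> \<open>Pairing the last column with the first gives \<open>c_n = 1\<close>, with a
    middle column \<open>a_j = - cnj c_j\<close>, and with itself the real part of
    \<open>c_0\<close>.\<close>
  define c where "c = B *\<^sub>v ?e n"
  have c: "c \<in> V" using B by (simp add: c_def)
  have "hform ?J (?e 0) c = hform ?J (?e 0) (?e n)"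
    using B_form[of "?e 0" "?e n"] B0 by (simp add: c_def)
  then have cn: "c $ n = 1"
    using n_pos c by (auto simp: hform_siegel_J[OF n_pos])
  have aj: "a j = - cnj (c $ j)" if j: "0 < j" "j < n" for j
  proof -
    have ej: "?e j + a j \<cdot>\<^sub>v ?e 0 \<in> V" by simp
    have "hform ?J (?e j + a j \<cdot>\<^sub>v ?e 0) c = hform ?J (?e j) (?e n)"
      using B_form[of "?e j" "?e n"] Bj[OF j] by (simp add: c_def)
    moreover have "hform ?J (?e j) (?e n) = 0"
      using j by (subst hform_siegel_J[OF n_pos]) auto
    moreover have "(\<Sum>i\<in>{1..<n}. cnj (c $ i) * (?e j + a j \<cdot>\<^sub>v ?e 0) $ i) = (\<Sum>i\<in>{1..<n}. if i = j then cnj (c $ j) else 0)"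
      using j by (intro sum.cong) auto
    then have "hform ?J (?e j + a j \<cdot>\<^sub>v ?e 0) c = a j + cnj (c $ j)"
      unfolding hform_siegel_J[OF n_pos ej c] using j cn by simp
    ultimately show ?thesis by (simp add: add_eq_0_iff2)
  qed
  define \<tau> where "\<tau> = vec (n - 1) (\<lambda>k. c $ Suc k)"
  \<comment> \<open>The factor 2 compensates the division by 2 in the corner entry of
    \<open>heis\<close>; this imaginary part is not constrained by the form.\<close>
  define t where "t = 2 * Im (c $ 0)"
  have \<tau>: "\<tau> $ (j - 1) = c $ j" if "0 < j" "j < n" for j using that by (cases j) (auto simp: \<tau>_def)
  have c0: "c $ 0 = (- of_real (\<Sum>k<n-1. (cmod (\<tau> $ k))\<^sup>2) + of_real t * \<i>) / 2"
  proof -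
    have "hform ?J c c = hform ?J (?e n) (?e n)"
      using B_form[of "?e n" "?e n"] by (simp add: c_def)
    also have "\<dots> = 0" using n_pos by (subst hform_siegel_J[OF n_pos]) auto
    finally have "c $ 0 + cnj (c $ 0) + (\<Sum>i\<in>{1..<n}. cnj (c $ i) * c $ i) = 0"
      unfolding hform_siegel_J[OF n_pos c c] cn by (simp add: add.commute)
    moreover have "(\<Sum>i\<in>{1..<n}. cnj (c $ i) * c $ i) = of_real (\<Sum>k<n-1. (cmod (\<tau> $ k))\<^sup>2)"
    proof -
      have "(\<Sum>i\<in>{1..<n}. cnj (c $ i) * c $ i) = (\<Sum>k<n-1. cnj (c $ Suc k) * c $ Suc k)"
        by (rule sum.reindex_bij_witness[of _ Suc "\<lambda>i. i - 1"]) auto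
      also have "\<dots> = (\<Sum>k<n-1. of_real ((cmod (\<tau> $ k))\<^sup>2))"
      proof (intro sum.cong refl)
        fix k assume "k \<in> {..<n-1}"
        then have "\<tau> $ k = c $ Suc k" by (simp add: \<tau>_def)
        then show "cnj (c $ Suc k) * c $ Suc k = of_real ((cmod (\<tau> $ k))\<^sup>2)"
          by (simp only: complex_norm_square mult.commute)
      qed
      finally show ?thesis by simp
    qed
    ultimately have "c $ 0 + cnj (c $ 0) = - of_real (\<Sum>k<n-1. (cmod (\<tau> $ k))\<^sup>2)"
      by (simp add: add_eq_0_iff2)
    then show ?thesis by (simp add: complex_eq_iff t_def)
  qed
  have "B = heis n \<tau> t"
  proof (rule eq_matI)
    fix i j assume "i < dim_row (heis n \<tau> t)" "j < dim_col (heis n \<tau> t)"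
    then have ij: "i < Suc n" "j < Suc n" by (simp_all add: heis_def)
    have "B $$ (i, j) = (B *\<^sub>v ?e j) $ i" using ij B by (simp add: mult_mat_unit_vec[OF B])
    moreover consider "j = 0" | "0 < j" "j < n" | "j = n" using ij by linarith
    then have "(B *\<^sub>v ?e j) $ i = heis n \<tau> t $$ (i, j)"
    proof cases
      case 1
      then show ?thesis using B0 ij n_pos by (simp add: heis_def)
    next
      case 2
      then show ?thesis using Bj[OF 2] aj[OF 2] \<tau>[OF 2] ij by (auto simp: heis_def)
    next
      case 3
      then have "(B *\<^sub>v ?e j) $ i = c $ i" by (simp add: c_def)
      moreover have "heis n \<tau> t $$ (i, n) = c $ i"
        using ij n_pos cn c0 \<tau>[of i] by (auto simp: heis_def)
      ultimately show ?thesis using 3 by simp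
    qed
    ultimately show "B $$ (i, j) = heis n \<tau> t $$ (i, j)" by simp
  qed (use B in \<open>auto simp: heis_def\<close>)
  moreover have "B * K = K * A"
    using assoc_mult_mat[OF KA K(2,1)] K(4) right_mult_one_mat[OF KA] by (simp add: B_def)
  ultimately have "K * A = heis n \<tau> t * K" by simp
  then show thesis using that[of \<tau> t] by (simp add: \<tau>_def)
qed

text \<open>The sum subtracted is the Heisenberg cocycle. The other two terms are symmetric in the
  factors, so comparing both orders of multiplication isolates it.\<close>

lemma heis_mult_index:
  "(heis n \<tau> t * heis n \<sigma> s) $$ (0, n) = heis n \<tau> t $$ (0, n) + heis n \<sigma> s $$ (0, n)
    - (\<Sum>k<n-1. cnj (\<tau> $ k) * \<sigma> $ k)"
proof -
  have c: "heis n \<tau> t \<in> M" "heis n \<sigma> s \<in> M" by (simp_all add: heis_def)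
  have "(heis n \<tau> t * heis n \<sigma> s) $$ (0, n) = (\<Sum>k<Suc n. heis n \<tau> t $$ (0, k) * heis n \<sigma> s $$ (k, n))"
    by (rule mult_mat_index[OF c]) auto
  also have "\<dots> = heis n \<tau> t $$ (0, 0) * heis n \<sigma> s $$ (0, n)
      + (\<Sum>k\<in>{1..<n}. heis n \<tau> t $$ (0, k) * heis n \<sigma> s $$ (k, n)) + heis n \<tau> t $$ (0, n) * heis n \<sigma> s $$ (n, n)"
    by (rule sum_lessThan_Suc_ends[OF n_pos])
  also have "(\<Sum>k\<in>{1..<n}. heis n \<tau> t $$ (0, k) * heis n \<sigma> s $$ (k, n)) = (\<Sum>k<n-1. - (cnj (\<tau> $ k) * \<sigma> $ k))"
    by (rule sum.reindex_bij_witness[of _ Suc "\<lambda>i. i - 1"]) (auto simp: heis_def)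
  also have "\<dots> = - (\<Sum>k<n-1. cnj (\<tau> $ k) * \<sigma> $ k)" by (rule sum_negf)
  finally have "(heis n \<tau> t * heis n \<sigma> s) $$ (0, n) = heis n \<tau> t $$ (0, 0) * heis n \<sigma> s $$ (0, n)
      + - (\<Sum>k<n-1. cnj (\<tau> $ k) * \<sigma> $ k) + heis n \<tau> t $$ (0, n) * heis n \<sigma> s $$ (n, n)" .
  moreover have "heis n \<tau> t $$ (0, 0) = 1" "heis n \<sigma> s $$ (n, n) = 1" by (simp_all add: heis_def)
  ultimately show ?thesis by simp
qed

lemma commuting_unipotents_isotropic:
  assumes A: "A \<in> U" "unipotent A" "act A x = x" and B: "B \<in> U" "unipotent B" "act B x = x"
    and x: "x \<in> bdry H" and comm: "A * B = B * A"
  shows "isotropic H n x A B"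
proof -
  obtain K Q where K: "K \<in> M" "Q \<in> M" "K * Q = 1\<^sub>m (Suc n)" "Q * K = 1\<^sub>m (Suc n)"
    and form: "\<forall>z\<in>V. \<forall>w\<in>V. hform (siegel_J n) (K *\<^sub>v z) (K *\<^sub>v w) = hf z w" and Kx: "act K x = inf_pt n"
    using siegel_frame_at_obtain[OF x] .
  obtain \<tau> t where \<tau>: "\<tau> \<in> carrier_vec (n - 1)" "K * B = heis n \<tau> t * K"
    using unipotent_heis[OF B(1,2) x B(3) K form Kx] .
  obtain \<sigma> s where \<sigma>: "\<sigma> \<in> carrier_vec (n - 1)" "K * A = heis n \<sigma> s * K"
    using unipotent_heis[OF A(1,2) x A(3) K form Kx] .
  let ?S = "heis n \<sigma> s" and ?T = "heis n \<tau> t"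
  have c: "?S \<in> M" "?T \<in> M" by (simp_all add: heis_def)
  note Ac = unitary_carrier[OF A(1)] and Bc = unitary_carrier[OF B(1)]
  have prod: "K * (A * B) = X * Y * K"
    if "A \<in> M" "B \<in> M" "X \<in> M" "Y \<in> M" "K * A = X * K" "K * B = Y * K" for A B X Y
  proof -
    have "K * (A * B) = K * A * B" by (rule assoc_mult_mat[OF K(1) that(1,2), symmetric])
    also have "\<dots> = X * (K * B)" unfolding that(5) by (rule assoc_mult_mat[OF that(3) K(1) that(2)])
    also have "\<dots> = X * Y * K" unfolding that(6) by (rule assoc_mult_mat[OF that(3,4) K(1), symmetric])
    finally show ?thesis .
  qed
  have "?S * ?T * K = ?T * ?S * K"
    using prod[OF Ac Bc c \<sigma>(2) \<tau>(2)] prod[OF Bc Ac c(2,1) \<tau>(2) \<sigma>(2)] comm by simp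
  then have "?S * ?T * K * Q = ?T * ?S * K * Q" by simp
  then have "?S * ?T = ?T * ?S"
    using assoc_mult_mat[OF mult_carrier_mat[OF c] K(1,2)] assoc_mult_mat[OF mult_carrier_mat[OF c(2,1)] K(1,2)]
      K(3) c by simp
  then have "(?S * ?T) $$ (0, n) = (?T * ?S) $$ (0, n)" by simp
  \<comment> \<open>The symmetric corner terms cancel, leaving the Hermitian product of
    \<open>\<tau>\<close> and \<open>\<sigma>\<close> equal to its own conjugate.\<close>
  then have "(\<Sum>k<n-1. cnj (\<sigma> $ k) * \<tau> $ k) = (\<Sum>k<n-1. cnj (\<tau> $ k) * \<sigma> $ k)"
    unfolding heis_mult_index by simp
  also have "(\<Sum>k<n-1. cnj (\<sigma> $ k) * \<tau> $ k) = cnj (\<Sum>k<n-1. cnj (\<tau> $ k) * \<sigma> $ k)"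
    by (simp add: mult.commute)
  finally have im: "Im (\<Sum>k<n-1. cnj (\<tau> $ k) * \<sigma> $ k) = 0"
    by (metis complex_cnj_cancel_iff Reals_cnj_iff complex_is_Real_iff)
  have inv: "invertible_mat K"
    using K by (auto simp: invertible_mat_def inverts_mat_def intro!: exI[of _ Q])
  have aKJ: "mat_adjoint K * siegel_J n * K \<in> M"
    by (rule mult_carrier_mat[OF mult_carrier_mat[OF mat_adjoint_carrier[OF K(1)] siegel_J_carrier] K(1)])
  have "mat_adjoint K * siegel_J n * K = H"
    by (rule hform_eqI[OF aKJ H_carrier]) (use form hform_adjoint_mult[OF siegel_J_carrier K(1)] in simp)
  moreover have "K \<in> carrier_mat (n + 1) (n + 1)" using K(1) by simp
  ultimately show ?thesis unfolding isotropic_def using inv Kx \<tau> \<sigma> im by blast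
qed

section \<open>Centralisers of parabolic isometries\<close>

text \<open>With eigenvalue \<open>l\<close> on a negative \<open>v\<close> and \<open>c\<close> on
  the null vector \<open>u\<close> of \<open>x\<close>, the nonzero products \<open>hf v v\<close>
  and \<open>hf u v\<close> give \<open>l * cnj l = 1\<close> and \<open>c * cnj l = 1\<close>, so
  \<open>c = l\<close>. A null and a negative vector are independent, hence \<open>l\<close> has
  multiplicity at least 2.\<close>

lemma elliptic_boundary_elliptic:
  assumes S: "elliptic H S" and x: "x \<in> bdry H" "act S x = x"
  shows "boundary_elliptic H S"
proof -
  have SU: "S \<in> U" using S by (simp add: elliptic_def)
  obtain v l where v: "v \<in> V" "v \<noteq> 0\<^sub>v (Suc n)" "Re (hf v v) < 0" "S *\<^sub>v v = l \<cdot>\<^sub>v v" using ellipticE[OF S] .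
  obtain u where u: "x = proj_pt u" "u \<in> V" "u \<noteq> 0\<^sub>v (Suc n)" "hf u u = 0" using x(1) by (rule bdryE)
  obtain c where c: "S *\<^sub>v u = c \<cdot>\<^sub>v u" using act_eq_proj_pt_iff[OF SU u(2,3)] x(2) u(1) by blast
  have uv: "hf u v \<noteq> 0" by (rule null_negative_not_orthogonal[OF u(2-4) v(1,3)])
  have "hf (S *\<^sub>v u) (S *\<^sub>v v) = c * cnj l * hf u v" using u v c by (simp add: hform_sesquilinear)
  then have cl: "c * cnj l = 1" using unitary_hf[OF SU u(2) v(1)] uv by simp
  have "hf (S *\<^sub>v v) (S *\<^sub>v v) = l * cnj l * hf v v" using v by (simp add: hform_sesquilinear)
  moreover have "hf v v \<noteq> 0" using v(3) by auto
  ultimately have ll: "l * cnj l = 1" using unitary_hf[OF SU v(1) v(1)] by simp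
  have "c = l" using cl ll by (metis mult_cancel_right mult_zero_right zero_neq_one)
  moreover have "v \<noteq> k \<cdot>\<^sub>v u" for k
  proof
    assume "v = k \<cdot>\<^sub>v u"
    then have "hf v v = 0" using u by (simp add: hform_sesquilinear)
    then show False using v(3) by simp
  qed
  ultimately have "2 \<le> Polynomial.order l (char_poly S)"
    using semisimple_order_ge_2[OF unitary_carrier[OF SU] elliptic_semisimple[OF S] v(1,4) u(2,3)] c by blast
  moreover have "negative_eigenvalue H S l" using v by (auto simp: negative_eigenvalue_def neg_vecs_def)
  ultimately show ?thesis using S by (auto simp: boundary_elliptic_def)
qed

lemma parabolic_fixed_point_unique:
  assumes T: "parabolic H T" and x: "x \<in> bdry H" "act T x = x" and y: "y \<in> bdry H" "act T y = y"
  shows "y = x"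
proof -
  obtain p where "bdry_fix H T = {p}" using T by (auto simp: parabolic_def card_1_singleton_iff)
  moreover have "x \<in> bdry_fix H T" "y \<in> bdry_fix H T" using x y by (auto simp: bdry_fix_def)
  ultimately show ?thesis by auto
qed

lemma commuting_with_parabolic_fixes:
  assumes T: "parabolic H T" and x: "x \<in> bdry H" "act T x = x" and S: "S \<in> U" "S * T = T * S"
  shows "act S x = x"
proof -
  have "T \<in> U" using T by (simp add: parabolic_def)
  moreover have "x \<subseteq> V" using x(1) cl_space_subset by (simp add: cl_space_def)
  ultimately have "act T (act S x) = act S x" using act_commute_fixed S x(2) by blast
  then show ?thesis using parabolic_fixed_point_unique[OF T x act_bdry[OF S(1) x(1)]] by blast
qed

text \<open>A second fixed point of \<open>S\<close> would be moved by \<open>T\<close> to a third one with the same eigenvalue,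
  making \<open>S\<close> elliptic.\<close>
lemma commuting_with_parabolic_cases:
  assumes T: "parabolic H T" and x: "x \<in> bdry H" "act T x = x" and S: "S \<in> U" "S * T = T * S"
  shows "boundary_elliptic H S \<or> translation H S \<or> ellipto_parabolic H S"
proof (cases "elliptic H S")
  case True
  then show ?thesis
    using elliptic_boundary_elliptic x commuting_with_parabolic_fixes[OF T x S] by blast
next
  case False
  have TU: "T \<in> U" using T by (simp add: parabolic_def)
  have Sx: "act S x = x" by (rule commuting_with_parabolic_fixes[OF T x S])
  have "y = x" if y: "y \<in> bdry H" "act S y = y" for y
  proof (rule ccontr)
    assume "y \<noteq> x"
    obtain w where w: "y = proj_pt w" "w \<in> V" "w \<noteq> 0\<^sub>v (Suc n)" "hf w w = 0" using y(1) by (rule bdryE)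
    have Ty: "act T y = proj_pt (T *\<^sub>v w)" using act_proj_pt[OF unitary_carrier[OF TU] w(2)] w(1) by simp
    then have ne: "proj_pt w \<noteq> proj_pt (T *\<^sub>v w)"
      using parabolic_fixed_point_unique[OF T x y(1)] \<open>y \<noteq> x\<close> w(1) by auto
    obtain d where d: "S *\<^sub>v w = d \<cdot>\<^sub>v w" using act_eq_proj_pt_iff[OF S(1) w(2,3)] y(2) w(1) by blast
    note c = unitary_carrier[OF S(1)] unitary_carrier[OF TU]
    have "S *\<^sub>v (T *\<^sub>v w) = T *\<^sub>v (S *\<^sub>v w)"
      using assoc_mult_mat_vec[OF c w(2)] assoc_mult_mat_vec[OF c(2,1) w(2)] S(2) by simp
    then have STw: "S *\<^sub>v (T *\<^sub>v w) = d \<cdot>\<^sub>v (T *\<^sub>v w)" using d mult_mat_vec[OF c(2) w(2)] by simp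
    have "T *\<^sub>v w \<noteq> 0\<^sub>v (Suc n)"
      using unitary_inj[OF TU w(2), of "0\<^sub>v (Suc n)"] w(3) mult_mat_zero_vec[OF c(2)] by auto
    moreover have "hf (T *\<^sub>v w) (T *\<^sub>v w) = 0" using unitary_hf[OF TU w(2,2)] w(4) by simp
    ultimately have "elliptic H S"
      using elliptic_if_null_eigenspace[OF S(1) w(2-4) _ _ _ ne d STw] TU w(2) by simp
    then show False using False by simp
  qed
  then have "bdry_fix H S = {x}" unfolding bdry_fix_def using x(1) Sx by blast
  then have "parabolic H S" using S(1) False by (simp add: parabolic_def)
  then show ?thesis by (auto simp: translation_def ellipto_parabolic_def)
qed

lemma translation_centralizer:
  assumes T: "translation H T" and x: "x \<in> bdry H" "act T x = x" and S: "S \<in> U" "S * T = T * S"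
  shows "(boundary_elliptic H S \<and> act S x = x \<and> act T ` fix_pts H S = fix_pts H S)
     \<or> (translation H S \<and> act S x = x \<and> isotropic H n x S T)
     \<or> (ellipto_parabolic H S \<and> act S x = x \<and>
          (\<exists>Ss Su. jordan_decomp H S Ss Su \<and> act T ` fix_pts H Ss = fix_pts H Ss \<and> isotropic H n x T Su))"
proof -
  have par: "parabolic H T" and uT: "unipotent T" using T by (auto simp: translation_def)
  then have TU: "T \<in> U" by (simp add: parabolic_def)
  have Sx: "act S x = x" by (rule commuting_with_parabolic_fixes[OF par x S])
  consider "boundary_elliptic H S" | "translation H S" | "ellipto_parabolic H S"
    using commuting_with_parabolic_cases[OF par x S] by blast
  then show ?thesis
  proof cases
    case 1
    then show ?thesis using Sx act_image_fix_pts[OF TU S(1) S(2)[symmetric]] by blast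
  next
    case 2
    then have "unipotent S" by (simp add: translation_def)
    then have "isotropic H n x S T"
      by (rule commuting_unipotents_isotropic[OF S(1) _ Sx TU uT x(2,1) S(2)])
    then show ?thesis using 2 Sx by blast
  next
    case 3
    obtain Ss Su where jd: "jordan_decomp H S Ss Su" using jordan_decomp_exists[OF S(1)] .
    note d = jordan_decompD[OF jd]
    note comm = jordan_decomp_commute[OF jd unitary_carrier[OF TU] S(2)[symmetric]]
    \<comment> \<open>\<open>Su\<close> commutes with the parabolic \<open>T\<close> in its own
      right, so it fixes \<open>x\<close> by the same argument as \<open>S\<close>.\<close>
    have "act Su x = x" by (rule commuting_with_parabolic_fixes[OF par x d(2) comm(2)[symmetric]])
    then have "isotropic H n x T Su"
      by (rule commuting_unipotents_isotropic[OF TU uT x(2) d(2,4) _ x(1) comm(2)])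
    then show ?thesis using 3 Sx jd act_image_fix_pts[OF TU d(1) comm(1)] by blast
  qed
qed

lemma ellipto_parabolic_centralizer:
  assumes T: "ellipto_parabolic H T" and x: "x \<in> bdry H" "act T x = x" and jdT: "jordan_decomp H T Ts Tu"
    and S: "S \<in> U" "S * T = T * S"
  shows "(boundary_elliptic H S \<and> act S x = x \<and> act Tu ` fix_pts H S = fix_pts H S \<and>
          (\<forall>l. preserves Ts (eigenspace S l)))
     \<or> (translation H S \<and> act S x = x \<and> act S ` fix_pts H Ts = fix_pts H Ts \<and> isotropic H n x S Tu)
     \<or> (ellipto_parabolic H S \<and> act S x = x \<and>
          (\<exists>Ss Su. jordan_decomp H S Ss Su \<and> act Tu ` fix_pts H Ss = fix_pts H Ss \<and>
             act Su ` fix_pts H Ts = fix_pts H Ts \<and> isotropic H n x Tu Su \<and>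
             (\<forall>l. preserves Ts (eigenspace Ss l))))"
proof -
  have par: "parabolic H T" using T by (simp add: ellipto_parabolic_def)
  then have TU: "T \<in> U" by (simp add: parabolic_def)
  note dT = jordan_decompD[OF jdT]
  note cT = unitary_carrier[OF dT(1)] unitary_carrier[OF dT(2)]
  note comm = jordan_decomp_commute[OF jdT unitary_carrier[OF S(1)] S(2)]
  have Sx: "act S x = x" by (rule commuting_with_parabolic_fixes[OF par x S])
  \<comment> \<open>\<open>T\<close> commutes with itself, hence with its unipotent factor, which
    therefore fixes \<open>x\<close> too.\<close>
  have Tux: "act Tu x = x"
    using commuting_with_parabolic_fixes[OF par x dT(2)]
      jordan_decomp_commute(2)[OF jdT unitary_carrier[OF TU] refl] by simp
  consider "boundary_elliptic H S" | "translation H S" | "ellipto_parabolic H S"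
    using commuting_with_parabolic_cases[OF par x S] by blast
  then show ?thesis
  proof cases
    case 1
    then show ?thesis
      using Sx act_image_fix_pts[OF dT(2) S(1) comm(2)[symmetric]]
        preserves_eigenspaceI[OF dT(1) S(1) comm(1)[symmetric]] by blast
  next
    case 2
    then have "unipotent S" by (simp add: translation_def)
    then have "isotropic H n x S Tu"
      by (rule commuting_unipotents_isotropic[OF S(1) _ Sx dT(2,4) Tux x(1) comm(2)])
    then show ?thesis using 2 Sx act_image_fix_pts[OF S(1) dT(1) comm(1)] by blast
  next
    case 3
    obtain Ss Su where jd: "jordan_decomp H S Ss Su" using jordan_decomp_exists[OF S(1)] .
    note d = jordan_decompD[OF jd]
    \<comment> \<open>\<open>S\<close> commutes with both \<open>Ts\<close> and \<open>Tu\<close>;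
      taking the Jordan factors of \<open>S\<close> as well makes all four factors commute across
      the two decompositions.\<close>
    note Ts_comm = jordan_decomp_commute[OF jd cT(1) comm(1)[symmetric]]
    note Tu_comm = jordan_decomp_commute[OF jd cT(2) comm(2)[symmetric]]
    have "act Su x = x"
      by (rule commuting_with_parabolic_fixes[OF par x d(2)
            jordan_decomp_commute(2)[OF jd unitary_carrier[OF TU] S(2)[symmetric], symmetric]])
    then have "isotropic H n x Tu Su"
      by (rule commuting_unipotents_isotropic[OF dT(2,4) Tux d(2,4) _ x(1) Tu_comm(2)])
    then show ?thesis
      using 3 Sx jd act_image_fix_pts[OF dT(2) d(1) Tu_comm(1)]
        act_image_fix_pts[OF d(2) dT(1) Ts_comm(2)[symmetric]]
        preserves_eigenspaceI[OF dT(1) d(1) Ts_comm(1)] by blast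
  qed
qed

end

theorem theorem1p1:
  fixes n :: nat and H :: "complex mat"
  assumes "n \<ge> 1" and "hermitian_sig H n"
  shows
   "(\<forall>T S. elliptic H T \<and> S \<in> unitary_grp H \<longrightarrow>
       (S * T = T * S \<longleftrightarrow> (\<forall>l. preserves S (eigenspace T l))))
  \<and> (\<forall>T S. hyperbolic H T \<and> S \<in> unitary_grp H \<longrightarrow>
       (S * T = T * S \<longleftrightarrow>
          (\<forall>l. preserves S (eigenspace T l)) \<and>
          (acts_identity_on S (cline_pts H T) \<or>
           acts_strictly_hyperbolic_on H S (cline_sub H T) (cline_pts H T))))
  \<and> (\<forall>T S x. translation H T \<and> x \<in> bdry H \<and> act T x = x \<and> S \<in> unitary_grp H \<and> S * T = T * S \<longrightarrow>
       (boundary_elliptic H S \<and> act S x = x \<and> act T ` fix_pts H S = fix_pts H S)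
     \<or> (translation H S \<and> act S x = x \<and> isotropic H n x S T)
     \<or> (ellipto_parabolic H S \<and> act S x = x \<and>
          (\<exists>Ss Su. jordan_decomp H S Ss Su \<and> act T ` fix_pts H Ss = fix_pts H Ss \<and>
             isotropic H n x T Su)))
  \<and> (\<forall>T Ts Tu S x. ellipto_parabolic H T \<and> x \<in> bdry H \<and> act T x = x \<and> jordan_decomp H T Ts Tu \<and>
        S \<in> unitary_grp H \<and> S * T = T * S \<longrightarrow>
       (boundary_elliptic H S \<and> act S x = x \<and> act Tu ` fix_pts H S = fix_pts H S \<and>
          (\<forall>l. preserves Ts (eigenspace S l)))
     \<or> (translation H S \<and> act S x = x \<and> act S ` fix_pts H Ts = fix_pts H Ts \<and> isotropic H n x S Tu)
     \<or> (ellipto_parabolic H S \<and> act S x = x \<and>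
          (\<exists>Ss Su. jordan_decomp H S Ss Su \<and> act Tu ` fix_pts H Ss = fix_pts H Ss \<and>
             act Su ` fix_pts H Ts = fix_pts H Ts \<and> isotropic H n x Tu Su \<and>
             (\<forall>l. preserves Ts (eigenspace Ss l)))))"
proof -
  interpret hermitian_space n H by unfold_locales (use assms in auto)
  have "S * T = T * S \<longleftrightarrow> (\<forall>l. preserves S (eigenspace T l))"
    if "elliptic H T" "S \<in> unitary_grp H" for T S
    using semisimple_commute_iff_preserves[OF _ elliptic_semisimple[OF that(1)] that(2)] that(1)
    by (simp add: elliptic_def)
  moreover have "S * T = T * S \<longleftrightarrow> (\<forall>l. preserves S (eigenspace T l)) \<and>
      (acts_identity_on S (cline_pts H T) \<or>
       acts_strictly_hyperbolic_on H S (cline_sub H T) (cline_pts H T))"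
    if "hyperbolic H T" "S \<in> unitary_grp H" for T S
  proof -
    have "T \<in> unitary_grp H" using that(1) by (simp add: hyperbolic_def)
    then show ?thesis
      using semisimple_commute_iff_preserves[OF _ hyperbolic_semisimple[OF that(1)] that(2)]
        complex_line_dichotomy[OF that] by blast
  qed
  ultimately show ?thesis
    using translation_centralizer ellipto_parabolic_centralizer
    by (intro conjI allI impI; (elim conjE)?) simp_all
qed

end
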